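(* Let $(c,f,+1)\in C_k\hat{\mathcal A}^{\mathbf x}_y$ be a corolla. Then $$\Delta_C(c,f,+1)=\sum_{\substack{S\otimes T\in C_i\hat{\mathcal A}^{\mathbf x}_y\otimes C_j\hat{\mathcal A}^{\mathbf x}_y\\ S_{\max}\le T_{\min}\\ i+j=k}}\pm(S,f,\omega_S)\otimes(T,f,\omega_T),$$ where the sum runs over all pairs of planar diagrams $S,T$ (of degrees $i,j$ with $i+j=k$, both obtained from $c$ by inserting zero or more edges, and both carrying the leaf labeling $f$ of $c$) such that $S_{\max}\le T_{\min}$, each pair occurring exactly once, with some sign $\pm$, and where $\omega_S,\omega_T$ are orientations of $S,T$.
   Context: $R$ is a commutative ring with unity; all modules are over $R$. **Planar diagrams.** There are three colors: empty ($0$), thin ($1$), thick ($2$). Planar diagrams are built from corollas (one-vertex diagrams): $T_n$ ($n\ge 2$) with $n$ thin leaves (inputs) and a thin root (output); $M_{j,k}$ ($j,k\ge 0$, $j+k\ge 1$) with, from left to right, $j$ thin leaves, one thick leaf, $k$ thin leaves, and a thick root; $I_{j,k}$ ($j,k\ge0$) with an empty root (drawn as a thick vertex), a left and a right horizontal thick leaf, $j$ thin leaves in the upper half-plane and $k$ thin leaves in the lower half-plane. A *planar tree* is obtained by grafting corollas $T_n$ (root onto leaf). A *module tree* is obtained from corollas $M_{j,k}$ by grafting thick roots onto thick leaves and planar trees onto thin leaves. An *inner product diagram* is obtained from one $I_{j,k}$ by grafting planar trees onto thin leaves and module trees onto thick leaves; a module tree grafted onto the left (resp. right) thick leaf is rotated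 by $90^\circ$ counterclockwise (resp. clockwise), so its inputs to the left of the thick line become lower (resp. upper) inputs and those to the right become upper (resp. lower) inputs. $\mathcal L(D)$ is the set of leaves of $D$; $\mathcal E(D)$ is the set of internal edges (neither leaves nor root). $D/e$ is $D$ with the edge $e$ contracted; inserting an edge is the inverse operation (leaves of $D$ and $D/e$ are identified). A labeling is a bijection $f:\{1,\dots,\#\mathcal L(D)\}\to\mathcal L(D)$. The canonical labeling $f_\circlearrowright$ numbers leaves of a (planar or module) tree from left to right, and those of an inner product diagram clockwise starting with the left thick leaf. The coloring of $(D,f)$ is $\mathbf x\times y$, where $x_i$ is the color of the leaf $f(i)$ and $y$ is the color of the root. **The three-colored operad $C_*\hat{\mathcal A}=\bigoplus_{\mathbf x\times y} C_*\hat{\mathcal A}^{\mathbf x}_y$.** It is generated by triples $(D,f,\omega)$ with $D$ a planar diagram, $f$ a labeling, $\omega$ an orientation, i.e. $\pm$ a formal skew-commutative product of all the edges of $D$ ($\pm1$ for a corolla), modulo $(D,f,-\omega)=-(D,f,\omega)$; the summand $C_*\hat{\mathcal A}^{\mathbf x}_y$ is generated by the triples of coloring $\mathbf x\times y$; units are formally adjoined in degree $0$. Degree: $\#\mathcal L(D)-\#\mathcal E(D)-2$; $C_n\hat{\mathcal A}$ is the degree $n$ part. Symmetric group action: $\sigma\cdot(D,f,\omega)=\mathrm{sgn}(\sigma)(D,f\circ\sigma,\omega)$. Composition: for $(D,f_D,\omega_D)$ and $(E,f_E,\omega_E)\in C_n\hat{\mathcal A}$ with $k=\#\mathcal L(D)$,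 $l=\#\mathcal L(E)$, $(D,f_D,\omega_D)\circ_i(E,f_E,\omega_E)$ is zero unless the root of $E$ and the leaf $f_D(i)$ have the same color, in which case it is $(-1)^{i(l+1)+kn}(D\circ_{f_D(i)}E,f_{D\circ E},\omega_D\wedge\omega_E\wedge e)$, where $D\circ_{f_D(i)}E$ is obtained by grafting the root of $E$ onto the leaf $f_D(i)$, $e$ is the new edge, and $f_{D\circ E}(j)$ is $f_D(j)$ for $j<i$, $f_E(j-i+1)$ for $i\le j<i+l$, and $f_D(j-l+1)$ for $i+l\le j\le k+l-1$. **The three-colored operad $Q_*\hat{\mathcal A}=\bigoplus_{\mathbf x\times y} Q_*\hat{\mathcal A}^{\mathbf x}_y$.** It is generated by $(D,f,g,\omega)$ modulo $(D,f,g,-\omega)=-(D,f,g,\omega)$, where $D$ is a planar diagram, $f:\{1,\dots,\#\mathcal L(D)\}\to\mathcal L(D)$ is a labeling, $g:\mathcal E(D)\to\{m,n\}$ marks edges metric ($m$) or non-metric ($n$), and $\omega$ is $\pm$ a formal skew-commutative product of all metric edges; the coloring is that of $(D,f)$. Degree: the number of metric edges. Units are formally adjoined in degree $0$. Action: $\sigma\cdot(D,f,g,\omega)=(D,f\circ\sigma,g,\omega)$. Composition: $(D,f_D,g_D,\omega_D)\circ_i(E,f_E,g_E,\omega_E)=(D\circ_{f_D(i)}E,f_{D\circ E},g_{D\circ E},\omega_D\wedge\omega_E)$ if colors match (zero otherwise), where $g_{D\circ E}$ extends $g_D,g_E$ and marks the new edge non-metric. The letter $m$ in the place of $g$ denotes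 the constant map $m$; such a generator is *fully metric*. **Binary diagrams, local moves, order.** A diagram is *binary* if each vertex coming from a $T$- or $M$-corolla has exactly two inputs and the root vertex of an inner product diagram is $I_{0,0}$; equivalently its degree (as in $C_*\hat{\mathcal A}$) is $0$. $\mathcal B$ is the set of binary diagrams. Write $ab$ for $T_2$ with $a,b$ grafted on its leaves, $a\cdot m$ for $M_{1,0}$, $m\cdot a$ for $M_{0,1}$, and $\langle m,n\rangle$ for $I_{0,0}$ with $m$ on the left leaf and $n$ on the right leaf ($a,b,c$ thin, $m,n$ thick). Consider the following pairs of two-vertex diagrams: (1) $(ab)c<a(bc)$; (2) $a\cdot(m\cdot b)<(a\cdot m)\cdot b$; (3) $(ab)\cdot m<a\cdot(b\cdot m)$; (4) $(m\cdot a)\cdot b<m\cdot(ab)$; (5) $\langle m\cdot a,n\rangle<\langle m,a\cdot n\rangle$; (6) $\langle m,n\cdot a\rangle<\langle a\cdot m,n\rangle$. A *local move* replaces, inside a binary diagram, the two-vertex subdiagram around one edge by the other member of its pair. The partial order $\le$ on $\mathcal B$ is generated by $B_1<B_2$ whenever $B_2$ arises from $B_1$ by replacing a left member by the corresponding right member. A move identifies the edges of the two diagrams: the internal edge of the subdiagram with the internal edge of its replacement, and the edges attached at each input and at the output with the corresponding ones. An edge of a binary diagram is *negative* (resp. *positive* ) if the two-vertex subdiagram around it is the left (resp. right) member of its pair. For a planar diagram $D$, the set of binary diagrams obtained from $D$ by edge insertions has a unique minimal element $D_{\min}$ and a unique maximal element $D_{\max}$. **Standard orientation $\omega^{\rm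 std}_B$** of a binary diagram $B$. It is defined to be $e_1\wedge\dots\wedge e_k$ (edges listed outward from the root) for the reference diagrams $a_1(a_2(\cdots(a_{n-1}a_n)))$; $a_1\cdot(\cdots(a_j\cdot(m\cdot(b_1(b_2(\cdots b_l))))))$; and $\langle m',a_1\cdot(\cdots(a_j\cdot(m\cdot(b_1(b_2(\cdots b_l))))))\rangle$ (the edges of each form a single path from the root; $j,l\geq 0$, with the factor $m\cdot(b_1(\cdots b_l))$ replaced by $m$ if $l=0$). It is extended to all binary diagrams by requiring that each local move, with the identification of edges in which the internal edge of the subdiagram corresponds to the internal edge of its replacement and the edges attached at each input and at the output correspond to each other, changes the sign of the standard orientation; this is well defined. For $B$ binary with $n$ leaves put $\xi_B=(-1)^{(n-2)(n-3)/2}\omega^{\rm std}_B$. **The map $q:C_*\hat{\mathcal A}\to Q_*\hat{\mathcal A}$.** $q$ is the identity on units; for a corolla $c$ with $(c,f_\circlearrowright,+1)\in C_*\hat{\mathcal A}^{\mathbf x}_y$, $q(c,f_\circlearrowright,+1)=\sum_B(B,f_\circlearrowright,m,\omega^{\rm std}_B)$, the sum over all binary diagrams $B$ for which $(B,f_\circlearrowright)$ has coloring $\mathbf x\times y$ and $B$ is obtained from $c$ by inserting edges; $q$ is extended to all of $C_*\hat{\mathcal A}$ linearly, equivariantly under the symmetric groups and multiplicatively with respect to all $\circ_i$ (well defined since $C_*\hat{\mathcal A}$ is freely generated as an operad by the corollas $(c,f_\circlearrowright,+1)$). **The orientation $\omega(S,D)$.** Contraction is given by $(e_1\wedge\dots\wedge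 e_r)\rfloor(e_1\wedge\dots\wedge e_r\wedge e_{r+1}\wedge\dots\wedge e_k)=(-1)^{r(r-1)/2}e_{r+1}\wedge\dots\wedge e_k$. Let $(D,f_\circlearrowright,m,\omega_D)$ be fully metric of degree $k$, and let $S$ be a diagram of degree $k$ (in $C_*\hat{\mathcal A}$) with $S_{\max}\le D_{\min}$. Then $D_{\min}$ and $S_{\max}$ have exactly $k$ positive edges; those of $D_{\min}$ are precisely the edges $e_1,\dots,e_k$ of $D$, and $S$ is $S_{\max}$ with its positive edges contracted. If $S_{\max}=D_{\min}$, put $\omega(S,D)=\omega_D\rfloor\xi_{D_{\min}}$. If $S_{\max}<D_{\min}$, write $\omega_D=\eta\, e_1\wedge\dots\wedge e_k$ with $\eta=\pm1$ and put $\omega(S,D)=(\eta\, e_1\wedge\dots\wedge e_k)\rfloor\xi_{S_{\max}}$, where the positive edges of $D_{\min}$ are identified with those of $S_{\max}$ along any descending chain of local moves from $D_{\min}$ to $S_{\max}$: in each move (which keeps the number of positive edges constant) the edge at which the move is made turns from positive to negative, exactly one other edge turns from negative to positive, and the former positive edge is identified with the latter, the remaining positive edges being identified with themselves. **The map $p:Q_*\hat{\mathcal A}\to C_*\hat{\mathcal A}$.** $p$ is the identity on units; on a fully metric generator $(D,f_\circlearrowright,m,\omega_D)\in Q_k\hat{\mathcal A}^{\mathbf x}_y$, $p(D,f_\circlearrowright,m,\omega_D)=\sum_S(S,f_\circlearrowright,\omega(S,D))$, the sum over all diagrams $S$ of degree $k$ with coloring $\mathbf x\times y$ (for $f_\circlearrowright$)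 and $S_{\max}\le D_{\min}$; $p$ is extended to all generators (decomposing along non-metric edges) linearly, equivariantly under the symmetric groups and multiplicatively with respect to all $\circ_i$. (A corolla is fully metric with $g$ empty.) **The diagonals.** For a generator $(D,f,g,\omega)\in Q_*\hat{\mathcal A}$ with $\omega=e_1\wedge\dots\wedge e_k$, $\{e_1,\dots,e_k\}=g^{-1}(m)$, and $X\subseteq g^{-1}(m)$, let $\bar X=g^{-1}(m)\smallsetminus X$ and $\rho(X)=\#\{(e_i,e_j)\in X\times\bar X: i<j\}$. Define $$\Delta_Q(D,f,g,\omega)=\sum_{X\subseteq g^{-1}(m)}(-1)^{\rho(X)}(D/X,f,g_{D/X},\omega_{D/X})\otimes(D_{\bar X},f,g_{D_{\bar X}},\omega_{D_{\bar X}}),$$ where $D/X$ is $D$ with the edges of $X$ contracted, $g_{D/X}$ the induced marking, $\omega_{D/X}$ is $\omega$ with the factors in $X$ deleted; $D_{\bar X}$ is $D$ with the edges of $\bar X$ re-marked non-metric (marking $g_{D_{\bar X}}$), $\omega_{D_{\bar X}}$ is $\omega$ with the factors in $\bar X$ deleted. Define $\Delta_C=(p\otimes p)\circ\Delta_Q\circ q:C_*\hat{\mathcal A}\to C_*\hat{\mathcal A}\otimes C_*\hat{\mathcal A}$. *)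

theory Defs
  imports "HOL-Library.Poly_Mapping" "HOL-Combinatorics.Permutations"
begin

section \<open>Planar diagrams\<close>

datatype color = Empty | Thin | Thick

text \<open>
  A pair \<open>(D, f)\<close> of a planar diagram and a labeling is one tree whose leaf \<open>f i\<close> carries the
  label \<open>i\<close>.  A vertex records the color of its output and the list of its inputs:
  \<^item> \<open>T\<^sub>n\<close> and \<open>M\<^sub>j\<^sub>,\<^sub>k\<close> list their inputs from left to right;
  \<^item> \<open>I\<^sub>j\<^sub>,\<^sub>k\<close> lists its inputs clockwise: left thick input, the \<open>j\<close> upper ones from left to right,
    right thick input, the \<open>k\<close> lower ones from right to left.

  The rotation of the module trees grafted onto the thick leaves of \<open>I\<^sub>j\<^sub>,\<^sub>k\<close> takes their left-to-right
  order to the clockwise order, so a depth-first traversal of an inner product diagram meets the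
  leaves clockwise.
\<close>
datatype 'a diagram = Leaf color 'a | Vertex color "'a diagram list"

abbreviation labels :: "'a diagram \<Rightarrow> 'a set" where "labels \<equiv> set_diagram"

fun is_leaf :: "'a diagram \<Rightarrow> bool" where
  "is_leaf (Leaf c a) = True"
| "is_leaf (Vertex y ts) = False"

fun root_color :: "'a diagram \<Rightarrow> color" where
  "root_color (Leaf c a) = c"
| "root_color (Vertex y ts) = y"

fun inputs :: "'a diagram \<Rightarrow> 'a diagram list" where
  "inputs (Leaf c a) = []"
| "inputs (Vertex y ts) = ts"

fun corolla_type :: "color \<Rightarrow> color list \<Rightarrow> bool" where
  "corolla_type Thin cs \<longleftrightarrow> (\<exists>n\<ge>2. cs = replicate n Thin)"
| "corolla_type Thick cs \<longleftrightarrow>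
     (\<exists>j k. j + k \<ge> 1 \<and> cs = replicate j Thin @ [Thick] @ replicate k Thin)"
| "corolla_type Empty cs \<longleftrightarrow>
     (\<exists>j k. cs = [Thick] @ replicate j Thin @ [Thick] @ replicate k Thin)"

fun well_colored :: "'a diagram \<Rightarrow> bool" where
  "well_colored (Leaf c a) \<longleftrightarrow> True"
| "well_colored (Vertex y ts) \<longleftrightarrow>
     corolla_type y (map root_color ts) \<and> (\<forall>t\<in>set ts. well_colored t)"

fun dfs_leaves :: "'a diagram \<Rightarrow> ('a \<times> color) list" where
  "dfs_leaves (Leaf c a) = [(a, c)]"
| "dfs_leaves (Vertex y ts) = concat (map dfs_leaves ts)"

definition num_leaves :: "'a diagram \<Rightarrow> nat" where
  "num_leaves D = length (dfs_leaves D)"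

text \<open>
  Cyclic rotation starting a list at its first thick entry.  The leaf order of an inner product
  diagram starts with the left thick leaf, which is the first thick leaf met depth-first (the leaves
  met before it are lower ones).
\<close>
definition start_at_thick :: "('b \<Rightarrow> color) \<Rightarrow> 'b list \<Rightarrow> 'b list" where
  "start_at_thick col xs =
     dropWhile (\<lambda>x. col x \<noteq> Thick) xs @ takeWhile (\<lambda>x. col x \<noteq> Thick) xs"

definition leaf_order :: "'a diagram \<Rightarrow> ('a \<times> color) list" where
  "leaf_order D =
     (if root_color D = Empty \<and> \<not> is_leaf D then start_at_thick snd (dfs_leaves D)
      else dfs_leaves D)"

text \<open>
  The trees that are a single leaf, \<open>Leaf c 1\<close>, stand for the formally adjoined units.
\<close>
definition labeled :: "nat diagram \<Rightarrow> bool" where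
  "labeled D \<longleftrightarrow>
     well_colored D \<and> distinct (map fst (dfs_leaves D)) \<and> labels D = {1..num_leaves D}"

definition diagrams :: "nat diagram set" where
  "diagrams = {D. labeled D \<and> \<not> is_leaf D}"

definition canonical :: "nat diagram \<Rightarrow> bool" where
  "canonical D \<longleftrightarrow> map fst (leaf_order D) = [1..<Suc (num_leaves D)]"

definition coloring :: "nat diagram \<Rightarrow> color list \<times> color" where
  "coloring D =
     (map (\<lambda>i. the (map_of (dfs_leaves D) i)) [1..<Suc (num_leaves D)], root_color D)"

text \<open>
  An internal edge is named by the set of labels of the leaves beyond it (seen from the root).
  Distinct edges have distinct names because every vertex other than the root of an inner product
  diagram has at least two inputs.  With these names, edge contraction keeps the names of the
  remaining edges.  Edges are listed depth-first, outward from the root.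
\<close>
type_synonym edge = "nat set"

fun edges :: "'a diagram \<Rightarrow> 'a set list" where
  "edges (Leaf c a) = []"
| "edges (Vertex y ts) =
     concat (map (\<lambda>t. if is_leaf t then [] else labels t # edges t) ts)"

definition corollas :: "nat diagram set" where
  "corollas = {D \<in> diagrams. edges D = []}"

text \<open>Nonnegative on diagrams; truncated subtraction gives the units degree 0.\<close>
definition degree :: "nat diagram \<Rightarrow> nat" where
  "degree D = num_leaves D - length (edges D) - 2"

text \<open>
  Contracting the left edge of \<open>\<langle>a \<cdot> m, n\<rangle>\<close> yields the cyclic list of inputs \<open>a, m, n\<close>, which has to
  be rotated to \<open>m, n, a\<close>.
\<close>
fun contract :: "'a set set \<Rightarrow> 'a diagram \<Rightarrow> 'a diagram" where
  "contract X (Leaf c a) = Leaf c a"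
| "contract X (Vertex y ts) =
     (let us = concat (map (\<lambda>t. if \<not> is_leaf t \<and> labels t \<in> X then inputs (contract X t)
                                else [contract X t]) ts)
      in Vertex y (if y = Empty then start_at_thick root_color us else us))"

definition expansions :: "nat diagram \<Rightarrow> nat diagram set" where
  "expansions c = {D \<in> diagrams. \<exists>X \<subseteq> set (edges D). contract X D = c}"


section \<open>Orientations\<close>

text \<open>\<open>(\<epsilon>, [e\<^sub>1, \<dots>, e\<^sub>k])\<close> stands for \<open>\<epsilon> e\<^sub>1 \<and> \<dots> \<and> e\<^sub>k\<close>.\<close>
type_synonym orientation = "int \<times> edge list"

definition orientation_on :: "edge set \<Rightarrow> orientation \<Rightarrow> bool" where
  "orientation_on A \<omega> \<longleftrightarrow> fst \<omega> \<in> {1, - 1} \<and> distinct (snd \<omega>) \<and> set (snd \<omega>) = A"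

text \<open>
  The sign relating two skew-commutative products of the same distinct factors:
  \<open>x\<^sub>1 \<and> \<dots> \<and> x\<^sub>k = wedge_sign xs ys y\<^sub>1 \<and> \<dots> \<and> y\<^sub>k\<close>.
\<close>
definition wedge_sign :: "'e list \<Rightarrow> 'e list \<Rightarrow> int" where
  "wedge_sign xs ys =
     (- 1) ^ card {(i, j). i < j \<and> j < length xs \<and>
                     (\<exists>k l. l < k \<and> k < length ys \<and> ys ! k = xs ! i \<and> ys ! l = xs ! j)}"

text \<open>\<open>(e\<^sub>1 \<and> \<dots> \<and> e\<^sub>r) \<rfloor> (e\<^sub>1 \<and> \<dots> \<and> e\<^sub>k) = (-1)\<^bsup>r(r-1)/2\<^esup> e\<^sub>r\<^sub>+\<^sub>1 \<and> \<dots> \<and> e\<^sub>k\<close>.\<close>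
fun contraction :: "orientation \<Rightarrow> orientation \<Rightarrow> orientation" where
  "contraction (\<eta>, es) (\<xi>, xs) =
     (let r = length es; rest = filter (\<lambda>x. x \<notin> set es) xs
      in (\<eta> * \<xi> * wedge_sign xs (es @ rest) * (- 1) ^ (r * (r - 1) div 2), rest))"


section \<open>Free modules\<close>

definition smul :: "'r::comm_ring_1 \<Rightarrow> ('b \<Rightarrow>\<^sub>0 'r) \<Rightarrow> 'b \<Rightarrow>\<^sub>0 'r" where
  "smul r x = Poly_Mapping.map (\<lambda>a. r * a) x"

definition linear_ext :: "('b \<Rightarrow> 'd \<Rightarrow>\<^sub>0 'r::comm_ring_1) \<Rightarrow> ('b \<Rightarrow>\<^sub>0 'r) \<Rightarrow> 'd \<Rightarrow>\<^sub>0 'r" where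
  "linear_ext f x = (\<Sum>a\<in>Poly_Mapping.keys x. smul (Poly_Mapping.lookup x a) (f a))"

definition bilinear_ext ::
  "('b \<Rightarrow> 'c \<Rightarrow> 'd \<Rightarrow>\<^sub>0 'r::comm_ring_1) \<Rightarrow> ('b \<Rightarrow>\<^sub>0 'r) \<Rightarrow> ('c \<Rightarrow>\<^sub>0 'r) \<Rightarrow> 'd \<Rightarrow>\<^sub>0 'r" where
  "bilinear_ext f x y =
     (\<Sum>a\<in>Poly_Mapping.keys x. \<Sum>b\<in>Poly_Mapping.keys y. smul (Poly_Mapping.lookup x a * Poly_Mapping.lookup y b) (f a b))"

definition tensor ::
  "('b \<Rightarrow>\<^sub>0 'r::comm_ring_1) \<Rightarrow> ('c \<Rightarrow>\<^sub>0 'r) \<Rightarrow> ('b \<times> 'c) \<Rightarrow>\<^sub>0 'r" where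
  "tensor = bilinear_ext (\<lambda>a b. Poly_Mapping.single (a, b) 1)"

definition tensor_map ::
  "(('b \<Rightarrow>\<^sub>0 'r::comm_ring_1) \<Rightarrow> 'd \<Rightarrow>\<^sub>0 'r) \<Rightarrow> (('c \<Rightarrow>\<^sub>0 'r) \<Rightarrow> 'e \<Rightarrow>\<^sub>0 'r)
    \<Rightarrow> (('b \<times> 'c) \<Rightarrow>\<^sub>0 'r) \<Rightarrow> ('d \<times> 'e) \<Rightarrow>\<^sub>0 'r" where
  "tensor_map F G =
     linear_ext (\<lambda>(a, b). tensor (F (Poly_Mapping.single a 1)) (G (Poly_Mapping.single b 1)))"


section \<open>The two operads\<close>

text \<open>
  Modulo \<open>(D, f, -\<omega>) = -(D, f, \<omega>)\<close>, the generators \<open>(D, f, \<omega>)\<close> with fixed \<open>(D, f)\<close> span a free module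
  of rank one; its basis vector, also written \<open>D\<close>, is the generator whose \<open>\<omega>\<close> is the product of the
  edges in the order of \<open>edges D\<close>.  Then \<open>gen_C D \<omega>\<close> is the generator \<open>(D, f, \<omega>)\<close>.  In the same way
  \<open>gen_Q D G \<omega>\<close> is \<open>(D, f, g, \<omega>)\<close>, where \<open>G\<close> is the set of edges that \<open>g\<close> marks metric.
\<close>
type_synonym 'r C = "nat diagram \<Rightarrow>\<^sub>0 'r"
type_synonym 'r Q = "(nat diagram \<times> edge set) \<Rightarrow>\<^sub>0 'r"

definition basis_C :: "nat diagram set" where
  "basis_C = {D. labeled D}"

definition basis_Q :: "(nat diagram \<times> edge set) set" where
  "basis_Q = {(D, G). labeled D \<and> G \<subseteq> set (edges D)}"

definition coloring_Q :: "nat diagram \<times> edge set \<Rightarrow> color list \<times> color" where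
  "coloring_Q b = coloring (fst b)"

definition metric_edges :: "nat diagram \<Rightarrow> edge set \<Rightarrow> edge list" where
  "metric_edges D G = filter (\<lambda>e. e \<in> G) (edges D)"

definition gen_C :: "nat diagram \<Rightarrow> orientation \<Rightarrow> 'r::comm_ring_1 C" where
  "gen_C D \<omega> = Poly_Mapping.single D (of_int (fst \<omega> * wedge_sign (snd \<omega>) (edges D)))"

definition gen_Q :: "nat diagram \<Rightarrow> edge set \<Rightarrow> orientation \<Rightarrow> 'r::comm_ring_1 Q" where
  "gen_Q D G \<omega> =
     Poly_Mapping.single (D, G) (of_int (fst \<omega> * wedge_sign (snd \<omega>) (metric_edges D G)))"

definition unit_C :: "color \<Rightarrow> 'r::comm_ring_1 C" where
  "unit_C c = gen_C (Leaf c 1) (1, [])"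

definition unit_Q :: "color \<Rightarrow> 'r::comm_ring_1 Q" where
  "unit_Q c = gen_Q (Leaf c 1) {} (1, [])"

subsection \<open>Symmetric group actions\<close>

text \<open>In \<open>f \<circ> \<sigma>\<close> the leaf \<open>f j\<close> has label \<open>\<sigma>\<inverse> j\<close>.\<close>
definition act_C :: "(nat \<Rightarrow> nat) \<Rightarrow> 'r::comm_ring_1 C \<Rightarrow> 'r C" where
  "act_C \<sigma> = linear_ext (\<lambda>D.
     gen_C (map_diagram (inv \<sigma>) D) (sign \<sigma>, map (image (inv \<sigma>)) (edges D)))"

definition act_Q :: "(nat \<Rightarrow> nat) \<Rightarrow> 'r::comm_ring_1 Q \<Rightarrow> 'r Q" where
  "act_Q \<sigma> = linear_ext (\<lambda>(D, G).
     gen_Q (map_diagram (inv \<sigma>) D) (image (inv \<sigma>) ` G)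
       (1, map (image (inv \<sigma>)) (metric_edges D G)))"

subsection \<open>Compositions\<close>

fun substitute :: "(color \<Rightarrow> 'a \<Rightarrow> 'b diagram) \<Rightarrow> 'a diagram \<Rightarrow> 'b diagram" where
  "substitute s (Leaf c a) = s c a"
| "substitute s (Vertex y ts) = Vertex y (map (substitute s) ts)"

definition graft :: "nat diagram \<Rightarrow> nat \<Rightarrow> nat diagram \<Rightarrow> nat diagram" where
  "graft D i E = substitute (\<lambda>c a.
     if a < i then Leaf c a
     else if a = i then map_diagram (\<lambda>j. j + i - 1) E
     else Leaf c (a + num_leaves E - 1)) D"

text \<open>
  The names in \<open>graft D i E\<close> of the edges of \<open>D\<close> (\<open>l\<close> is the number of leaves of \<open>E\<close>), of the edges
  of \<open>E\<close>, and of the new edge.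
\<close>
definition graft_lower_edge :: "nat \<Rightarrow> nat \<Rightarrow> edge \<Rightarrow> edge" where
  "graft_lower_edge i l A =
     (\<Union>a\<in>A. if a < i then {a} else if a = i then {i..<i + l} else {a + l - 1})"

definition graft_upper_edge :: "nat \<Rightarrow> edge \<Rightarrow> edge" where
  "graft_upper_edge i A = (\<lambda>j. j + i - 1) ` A"

definition graft_new_edge :: "nat \<Rightarrow> nat \<Rightarrow> edge" where
  "graft_new_edge i l = {i..<i + l}"

text \<open>
  The condition \<open>(i, root_color E) \<in> set (dfs_leaves D)\<close> says that the leaf with label \<open>i\<close> exists
  and has the color of the root of \<open>E\<close>.
\<close>
definition comp_C_basis :: "nat \<Rightarrow> nat diagram \<Rightarrow> nat diagram \<Rightarrow> 'r::comm_ring_1 C" where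
  "comp_C_basis i D E =
     (if (i, root_color E) \<notin> set (dfs_leaves D) then 0
      else if is_leaf D then gen_C E (1, edges E)
      else if is_leaf E then gen_C D (1, edges D)
      else
        let k = num_leaves D; l = num_leaves E; n = degree E
        in gen_C (graft D i E)
             ((- 1) ^ (i * (l + 1) + k * n),
              map (graft_lower_edge i l) (edges D) @ map (graft_upper_edge i) (edges E)
                @ [graft_new_edge i l]))"

definition comp_C :: "nat \<Rightarrow> 'r::comm_ring_1 C \<Rightarrow> 'r C \<Rightarrow> 'r C" where
  "comp_C i = bilinear_ext (comp_C_basis i)"

definition comp_Q_basis ::
  "nat \<Rightarrow> nat diagram \<times> edge set \<Rightarrow> nat diagram \<times> edge set \<Rightarrow> 'r::comm_ring_1 Q" where
  "comp_Q_basis i = (\<lambda>(D, G) (E, H).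
     (if (i, root_color E) \<notin> set (dfs_leaves D) then 0
      else if is_leaf D then gen_Q E H (1, metric_edges E H)
      else if is_leaf E then gen_Q D G (1, metric_edges D G)
      else
        let l = num_leaves E
        in gen_Q (graft D i E) (graft_lower_edge i l ` G \<union> graft_upper_edge i ` H)
             (1, map (graft_lower_edge i l) (metric_edges D G)
                  @ map (graft_upper_edge i) (metric_edges E H))))"

definition comp_Q :: "nat \<Rightarrow> 'r::comm_ring_1 Q \<Rightarrow> 'r Q \<Rightarrow> 'r Q" where
  "comp_Q i = bilinear_ext (comp_Q_basis i)"

subsection \<open>Maps of three-colored operads\<close>

definition component ::
  "'b set \<Rightarrow> ('b \<Rightarrow> color list \<times> color) \<Rightarrow> color list \<times> color \<Rightarrow> ('b \<Rightarrow>\<^sub>0 'r::zero) set" where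
  "component B col xy = {x. \<forall>b\<in>Poly_Mapping.keys x. b \<in> B \<and> col b = xy}"

definition linear_on_span ::
  "'b set \<Rightarrow> (('b \<Rightarrow>\<^sub>0 'r::comm_ring_1) \<Rightarrow> 'd \<Rightarrow>\<^sub>0 'r) \<Rightarrow> bool" where
  "linear_on_span B \<phi> \<longleftrightarrow>
     (\<forall>x y. Poly_Mapping.keys x \<subseteq> B \<longrightarrow> Poly_Mapping.keys y \<subseteq> B \<longrightarrow> \<phi> (x + y) = \<phi> x + \<phi> y) \<and>
     (\<forall>r x. Poly_Mapping.keys x \<subseteq> B \<longrightarrow> \<phi> (smul r x) = smul r (\<phi> x))"

definition operad_map_C_Q :: "('r::comm_ring_1 C \<Rightarrow> 'r Q) \<Rightarrow> bool" where
  "operad_map_C_Q \<phi> \<longleftrightarrow>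
     linear_on_span basis_C \<phi> \<and>
     (\<forall>xy. \<forall>x \<in> component basis_C coloring xy. \<phi> x \<in> component basis_Q coloring_Q xy) \<and>
     (\<forall>c. \<phi> (unit_C c) = unit_Q c) \<and>
     (\<forall>xs y \<sigma>. \<forall>x \<in> component basis_C coloring (xs, y).
        \<sigma> permutes {1..length xs} \<longrightarrow> \<phi> (act_C \<sigma> x) = act_Q \<sigma> (\<phi> x)) \<and>
     (\<forall>xs y xs' y' i. \<forall>x \<in> component basis_C coloring (xs, y).
        \<forall>x' \<in> component basis_C coloring (xs', y').
        i \<in> {1..length xs} \<longrightarrow> \<phi> (comp_C i x x') = comp_Q i (\<phi> x) (\<phi> x'))"

definition operad_map_Q_C :: "('r::comm_ring_1 Q \<Rightarrow> 'r C) \<Rightarrow> bool" where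
  "operad_map_Q_C \<phi> \<longleftrightarrow>
     linear_on_span basis_Q \<phi> \<and>
     (\<forall>xy. \<forall>x \<in> component basis_Q coloring_Q xy. \<phi> x \<in> component basis_C coloring xy) \<and>
     (\<forall>c. \<phi> (unit_Q c) = unit_C c) \<and>
     (\<forall>xs y \<sigma>. \<forall>x \<in> component basis_Q coloring_Q (xs, y).
        \<sigma> permutes {1..length xs} \<longrightarrow> \<phi> (act_Q \<sigma> x) = act_C \<sigma> (\<phi> x)) \<and>
     (\<forall>xs y xs' y' i. \<forall>x \<in> component basis_Q coloring_Q (xs, y).
        \<forall>x' \<in> component basis_Q coloring_Q (xs', y').
        i \<in> {1..length xs} \<longrightarrow> \<phi> (comp_Q i x x') = comp_C i (\<phi> x) (\<phi> x'))"


section \<open>Binary diagrams, local moves and the order\<close>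

fun all_vertices_binary :: "'a diagram \<Rightarrow> bool" where
  "all_vertices_binary (Leaf c a) \<longleftrightarrow> True"
| "all_vertices_binary (Vertex y ts) \<longleftrightarrow>
     length ts = 2 \<and> (\<forall>t\<in>set ts. all_vertices_binary t)"

definition binary_diagrams :: "nat diagram set" where
  "binary_diagrams = {D \<in> diagrams. all_vertices_binary D}"

text \<open>
  \<open>move B e B' e'\<close>: replacing the left member around the edge \<open>e\<close> of \<open>B\<close> by the right member, with
  internal edge \<open>e'\<close>, yields \<open>B'\<close>.  All other edges, being attached at an input or at the output of
  the two-vertex subdiagram or away from it, have the same names in \<open>B\<close> and \<open>B'\<close>.
\<close>
inductive move :: "'a diagram \<Rightarrow> 'a set \<Rightarrow> 'a diagram \<Rightarrow> 'a set \<Rightarrow> bool" where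
  thin: "root_color a = Thin \<Longrightarrow> root_color b = Thin \<Longrightarrow> root_color c = Thin \<Longrightarrow>
     move (Vertex Thin [Vertex Thin [a, b], c]) (labels a \<union> labels b)
          (Vertex Thin [a, Vertex Thin [b, c]]) (labels b \<union> labels c)"
| thick_middle: "root_color a = Thin \<Longrightarrow> root_color m = Thick \<Longrightarrow> root_color b = Thin \<Longrightarrow>
     move (Vertex Thick [a, Vertex Thick [m, b]]) (labels m \<union> labels b)
          (Vertex Thick [Vertex Thick [a, m], b]) (labels a \<union> labels m)"
| thick_right: "root_color a = Thin \<Longrightarrow> root_color b = Thin \<Longrightarrow> root_color m = Thick \<Longrightarrow>
     move (Vertex Thick [Vertex Thin [a, b], m]) (labels a \<union> labels b)
          (Vertex Thick [a, Vertex Thick [b, m]]) (labels b \<union> labels m)"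
| thick_left: "root_color m = Thick \<Longrightarrow> root_color a = Thin \<Longrightarrow> root_color b = Thin \<Longrightarrow>
     move (Vertex Thick [Vertex Thick [m, a], b]) (labels m \<union> labels a)
          (Vertex Thick [m, Vertex Thin [a, b]]) (labels a \<union> labels b)"
| inner_upper: "root_color m = Thick \<Longrightarrow> root_color a = Thin \<Longrightarrow> root_color n = Thick \<Longrightarrow>
     move (Vertex Empty [Vertex Thick [m, a], n]) (labels m \<union> labels a)
          (Vertex Empty [m, Vertex Thick [a, n]]) (labels a \<union> labels n)"
| inner_lower: "root_color m = Thick \<Longrightarrow> root_color n = Thick \<Longrightarrow> root_color a = Thin \<Longrightarrow>
     move (Vertex Empty [m, Vertex Thick [n, a]]) (labels n \<union> labels a)
          (Vertex Empty [Vertex Thick [a, m], n]) (labels a \<union> labels m)"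
| deeper: "move t e t' e' \<Longrightarrow>
     move (Vertex y (xs @ t # ys)) e (Vertex y (xs @ t' # ys)) e'"

definition diagram_le :: "nat diagram \<Rightarrow> nat diagram \<Rightarrow> bool" where
  "diagram_le = (\<lambda>B B'. \<exists>e e'. move B e B' e')\<^sup>*\<^sup>*"

definition negative_edges :: "nat diagram \<Rightarrow> edge set" where
  "negative_edges B = {e. \<exists>B' e'. move B e B' e'}"

definition positive_edges :: "nat diagram \<Rightarrow> edge set" where
  "positive_edges B = {e. \<exists>B' e'. move B' e' B e}"

definition binary_expansions :: "nat diagram \<Rightarrow> nat diagram set" where
  "binary_expansions D = expansions D \<inter> binary_diagrams"

definition D_min :: "nat diagram \<Rightarrow> nat diagram" where
  "D_min D = (THE B. B \<in> binary_expansions D \<and>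
     (\<forall>B' \<in> binary_expansions D. diagram_le B' B \<longrightarrow> B' = B))"

definition D_max :: "nat diagram \<Rightarrow> nat diagram" where
  "D_max D = (THE B. B \<in> binary_expansions D \<and>
     (\<forall>B' \<in> binary_expansions D. diagram_le B B' \<longrightarrow> B' = B))"


section \<open>The standard orientation\<close>

fun right_comb :: "'a list \<Rightarrow> 'a diagram" where
  "right_comb [] = undefined"
| "right_comb [a] = Leaf Thin a"
| "right_comb (a # b # as) = Vertex Thin [Leaf Thin a, right_comb (b # as)]"

definition module_comb :: "'a list \<Rightarrow> 'a \<Rightarrow> 'a list \<Rightarrow> 'a diagram" where
  "module_comb as m bs =
     foldr (\<lambda>a t. Vertex Thick [Leaf Thin a, t]) as
       (if bs = [] then Leaf Thick m else Vertex Thick [Leaf Thick m, right_comb bs])"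

definition reference_diagrams :: "nat diagram set" where
  "reference_diagrams = diagrams \<inter>
     ({right_comb as |as. as \<noteq> []} \<union>
      {module_comb as m bs |as m bs. True} \<union>
      {Vertex Empty [Leaf Thick m', module_comb as m bs] |m' as m bs. True})"

definition rename_edge :: "'e \<Rightarrow> 'e \<Rightarrow> 'e list \<Rightarrow> 'e list" where
  "rename_edge e e' es = map (\<lambda>x. if x = e then e' else x) es"

inductive std_orientation :: "nat diagram \<Rightarrow> orientation \<Rightarrow> bool" where
  reference: "B \<in> reference_diagrams \<Longrightarrow> std_orientation B (1, edges B)"
| up: "std_orientation B (\<epsilon>, es) \<Longrightarrow> move B e B' e' \<Longrightarrow>
     std_orientation B' (- \<epsilon>, rename_edge e e' es)"
| down: "std_orientation B (\<epsilon>, es) \<Longrightarrow> move B' e' B e \<Longrightarrow>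
     std_orientation B' (- \<epsilon>, rename_edge e e' es)"

text \<open>
  Any two orientations related to \<open>B\<close> by \<open>std_orientation\<close> agree as skew-commutative products; only
  their representation \<open>(\<epsilon>, es)\<close> is chosen.
\<close>
definition \<omega>_std :: "nat diagram \<Rightarrow> orientation" where
  "\<omega>_std B = (SOME \<omega>. std_orientation B \<omega>)"

definition \<xi> :: "nat diagram \<Rightarrow> orientation" where
  "\<xi> B = (let n = num_leaves B
          in ((- 1) ^ ((n - 2) * (n - 3) div 2) * fst (\<omega>_std B), snd (\<omega>_std B)))"


section \<open>The maps q and p\<close>

text \<open>
  As operads, \<open>C\<close> is freely generated by the canonically labeled corollas and \<open>Q\<close> by the canonically
  labeled fully metric generators.  Hence, on the spans of \<open>basis_C\<close> and \<open>basis_Q\<close>, the maps \<open>q\<close> and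
  \<open>p\<close> exist and are determined by \<open>is_q\<close> and \<open>is_p\<close>.
\<close>

definition is_q :: "('r::comm_ring_1 C \<Rightarrow> 'r Q) \<Rightarrow> bool" where
  "is_q q \<longleftrightarrow> operad_map_C_Q q \<and>
     (\<forall>c \<in> corollas. canonical c \<longrightarrow>
        q (gen_C c (1, [])) =
        (\<Sum>B | B \<in> binary_expansions c \<and> canonical B \<and> coloring B = coloring c.
           gen_Q B (set (edges B)) (\<omega>_std B)))"

text \<open>
  \<open>carry B es B' es'\<close>: along a descending chain of local moves from \<open>B\<close> to \<open>B'\<close> the list \<open>es\<close> of
  positive edges of \<open>B\<close> is identified with the list \<open>es'\<close> of positive edges of \<open>B'\<close>.  In the step the
  edge \<open>e\<close>, at which the move is made, is the only one to cease to be positive, and \<open>d\<close> is the only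
  one to become positive.
\<close>
inductive carry :: "nat diagram \<Rightarrow> edge list \<Rightarrow> nat diagram \<Rightarrow> edge list \<Rightarrow> bool"
  for B :: "nat diagram" and es :: "edge list" where
  start: "carry B es B es"
| step: "carry B es B1 es1 \<Longrightarrow> move B2 e' B1 e \<Longrightarrow> d \<notin> positive_edges B1 \<Longrightarrow>
     positive_edges B2 = insert d (positive_edges B1 - {e}) \<Longrightarrow>
     carry B es B2 (rename_edge e d es1)"

text \<open>
  The case \<open>S\<^sub>m\<^sub>a\<^sub>x = D\<^sub>m\<^sub>i\<^sub>n\<close> is the one of the empty chain.
\<close>
definition \<omega>_SD :: "nat diagram \<Rightarrow> nat diagram \<Rightarrow> orientation \<Rightarrow> orientation" where
  "\<omega>_SD S D \<omega> =
     contraction (fst \<omega>, SOME es. carry (D_min D) (snd \<omega>) (D_max S) es) (\<xi> (D_max S))"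

definition is_p :: "('r::comm_ring_1 Q \<Rightarrow> 'r C) \<Rightarrow> bool" where
  "is_p p \<longleftrightarrow> operad_map_Q_C p \<and>
     (\<forall>D \<in> diagrams. \<forall>\<omega>. canonical D \<longrightarrow> orientation_on (set (edges D)) \<omega> \<longrightarrow>
        p (gen_Q D (set (edges D)) \<omega>) =
        (\<Sum>S | S \<in> diagrams \<and> canonical S \<and> coloring S = coloring D \<and>
              degree S = length (edges D) \<and> diagram_le (D_max S) (D_min D).
           gen_C S (\<omega>_SD S D \<omega>)))"


section \<open>The diagonals\<close>

definition Delta_Q_gen ::
  "nat diagram \<Rightarrow> edge set \<Rightarrow> edge list
    \<Rightarrow> ((nat diagram \<times> edge set) \<times> (nat diagram \<times> edge set)) \<Rightarrow>\<^sub>0 'r::comm_ring_1" where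
  "Delta_Q_gen D G es =
     (\<Sum>X \<in> Pow G.
        let \<rho> = card {(i, j). i < j \<and> j < length es \<and> es ! i \<in> X \<and> es ! j \<in> G - X}
        in smul ((- 1) ^ \<rho>)
             (tensor (gen_Q (contract X D) (G - X) (1, filter (\<lambda>e. e \<notin> X) es))
                     (gen_Q D X (1, filter (\<lambda>e. e \<in> X) es))))"

definition Delta_Q ::
  "'r::comm_ring_1 Q \<Rightarrow> ((nat diagram \<times> edge set) \<times> (nat diagram \<times> edge set)) \<Rightarrow>\<^sub>0 'r" where
  "Delta_Q = linear_ext (\<lambda>(D, G). Delta_Q_gen D G (metric_edges D G))"

definition Delta_C ::
  "('r::comm_ring_1 Q \<Rightarrow> 'r C) \<Rightarrow> ('r C \<Rightarrow> 'r Q) \<Rightarrow> 'r C \<Rightarrow> (nat diagram \<times> nat diagram) \<Rightarrow>\<^sub>0 'r" where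
  "Delta_C p q = tensor_map p p \<circ> Delta_Q \<circ> q"

end

theory Submission
  imports Defs
begin

text \<open>
  Every orientation, \<open>wedge_sign\<close> and \<open>sign\<close> is a unit \<open>\<plusminus>1\<close>, so each term of \<open>q\<close>, \<open>p\<close> and \<open>\<Delta>\<^sub>Q\<close>
  is a basis vector up to sign and only supports have to be computed.  Applying \<open>\<Delta>\<^sub>Q\<close> to \<open>q c\<close> gives
  the terms \<open>B/X \<otimes> B\<^sub>X\<close> for binary expansions \<open>B\<close> of \<open>c\<close> and sets \<open>X\<close> of edges of \<open>B\<close>, where only the
  edges in \<open>X\<close> are metric in the second factor \<open>B\<^sub>X\<close>.  Cut at its non-metric edges, \<open>B\<^sub>X\<close> falls into
  fully metric binary pieces; \<open>p\<close> sends such a piece to its corolla if all its edges are positive, and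
  to zero otherwise.  Hence \<open>p B\<^sub>X\<close> is \<open>\<plusminus>B/X\<close> if all edges in \<open>X\<close> are positive, and zero otherwise.
  Every expansion \<open>T\<close> of \<open>c\<close> is \<open>B/X\<close> for exactly one such pair, the one with \<open>B = T\<^sub>m\<^sub>a\<^sub>x\<close>, and
  the first factor \<open>p T\<close> is the signed sum of the \<open>S\<close> of complementary degree with
  \<open>S\<^sub>m\<^sub>a\<^sub>x \<le> T\<^sub>m\<^sub>i\<^sub>n\<close>.

  That \<open>S\<^sub>m\<^sub>a\<^sub>x\<close> and \<open>T\<^sub>m\<^sub>i\<^sub>n\<close> exist and are unique rests on two facts: an expansion is determined by
  the contracted diagram if all contracted edges have the same sign, and a local move strictly
  decreases a potential.
\<close>

section \<open>Colors, leaves and contraction\<close>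

text \<open>Two circumstances shape the proof. The inputs of an inner product vertex are ordered
  cyclically, so contraction may rotate the input list of an empty root; what contraction preserves
  is therefore phrased through multisets of leaves, non-thin color lists or
  \<open>leaf_order\<close>. And \<open>p\<close> and \<open>q\<close> are prescribed on canonically
  labeled generators only, while cutting a diagram destroys that labeling; hence all supports are
  made compatible with relabeling, and a non-metric edge is renamed to \<open>{1..l}\<close> so that
  the cut becomes a composition at leaf 1.

  A fully metric binary piece with \<open>n\<close> leaves has degree \<open>n - 2\<close>, and a
  diagram with \<open>n\<close> leaves has that degree only if it is a corolla; this is why
  \<open>p\<close> leaves at most one term. An extremal expansion has contracted edges of one sign
  because a move at a contracted edge stays among the expansions of the same diagram. Signs can be
  disregarded because terms from different pairs \<open>(B, X)\<close> have different second tensor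
  factors, so nothing cancels over any commutative ring.\<close>

abbreviation nonthin :: "color list \<Rightarrow> color list" where
  "nonthin \<equiv> filter (\<lambda>c. c \<noteq> Thin)"

text \<open>Labels may be any distinct elements, in contrast to \<open>labeled\<close>: inductions
  pass to subtrees, whose labels do not form an initial segment.\<close>

definition proper :: "'a diagram \<Rightarrow> bool" where
  "proper D \<longleftrightarrow> well_colored D \<and> distinct (map fst (dfs_leaves D))"

definition arrange :: "color \<Rightarrow> 'a diagram list \<Rightarrow> 'a diagram list" where
  "arrange y us = (if y = Empty then start_at_thick root_color us else us)"

text \<open>What one input contributes to the input list of its contracted parent. It allows facts
  on contraction to be proved one input at a time.\<close>

definition branches :: "'a set set \<Rightarrow> 'a diagram \<Rightarrow> 'a diagram list" where
  "branches X t =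
     (if \<not> is_leaf t \<and> labels t \<in> X then inputs (contract X t) else [contract X t])"

lemma contract_Vertex:
  "contract X (Vertex y ts) = Vertex y (arrange y (concat (map (branches X) ts)))"
  by (simp add: arrange_def branches_def[abs_def] Let_def)

declare contract.simps(2) [simp del]
declare contract_Vertex [simp]

lemma nonthin_mapD: "c \<in> set (nonthin (map f xs)) \<Longrightarrow> \<exists>x\<in>set xs. f x = c"
  by (induction xs) (auto split: if_splits)

text \<open>A length bound, the list of non-thin entries and, for \<open>Empty\<close>, the first
  entry describe the admissible color lists. Unlike the explicit shapes, the non-thin list is
  compatible with concatenation, which is what contraction produces.\<close>

lemma corolla_type_Thin_iff: "corolla_type Thin cs \<longleftrightarrow> 2 \<le> length cs \<and> nonthin cs = []"
proof -
  have "nonthin cs = [] \<longleftrightarrow> cs = replicate (length cs) Thin"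
    by (induction cs) (auto simp: filter_empty_conv)
  then show ?thesis by auto
qed

lemma nonthin_replicate: "nonthin cs = [] \<Longrightarrow> cs = replicate (length cs) Thin"
  by (induction cs) (auto split: if_splits)

lemma corolla_type_Thick_iff:
  "corolla_type Thick cs \<longleftrightarrow> 2 \<le> length cs \<and> nonthin cs = [Thick]"
proof
  assume "2 \<le> length cs \<and> nonthin cs = [Thick]"
  then obtain us vs where "cs = us @ Thick # vs" "nonthin us = []" "nonthin vs = []" "2 \<le> length cs"
    by (metis (no_types, lifting) filter_eq_Cons_iff filter_empty_conv)
  then have "length us + length vs \<ge> 1"
    "cs = replicate (length us) Thin @ [Thick] @ replicate (length vs) Thin"
    using nonthin_replicate by force+
  then show "corolla_type Thick cs" by auto
qed auto

lemma corolla_type_Empty_iff: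
  "corolla_type Empty cs \<longleftrightarrow> cs \<noteq> [] \<and> hd cs = Thick \<and> nonthin cs = [Thick, Thick]"
proof
  assume a: "cs \<noteq> [] \<and> hd cs = Thick \<and> nonthin cs = [Thick, Thick]"
  then obtain ds where ds: "cs = Thick # ds" "nonthin ds = [Thick]" by (cases cs) auto
  then obtain us vs where "ds = us @ Thick # vs" "nonthin us = []" "nonthin vs = []"
    by (metis (no_types, lifting) filter_eq_Cons_iff filter_empty_conv)
  then have "cs = [Thick] @ replicate (length us) Thin @ [Thick] @ replicate (length vs) Thin"
    using ds nonthin_replicate by force
  then show "corolla_type Empty cs" by auto
qed auto

declare corolla_type.simps [simp del]
lemmas corolla_type_iff = corolla_type_Thin_iff corolla_type_Thick_iff corolla_type_Empty_iff

lemma corolla_type_length: "corolla_type y cs \<Longrightarrow> 2 \<le> length cs"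
proof -
  have "2 \<le> length cs" if "nonthin cs = [Thick, Thick]"
    using that length_filter_le[of "\<lambda>c. c \<noteq> Thin" cs] by simp
  then show "corolla_type y cs \<Longrightarrow> 2 \<le> length cs" by (cases y) (auto simp: corolla_type_iff)
qed

lemma corolla_type_child: "corolla_type y cs \<Longrightarrow> c \<in> set cs \<Longrightarrow> c \<noteq> Empty"
proof
  assume "corolla_type y cs" "c \<in> set cs" "c = Empty"
  moreover have "nonthin cs = [] \<or> nonthin cs = [Thick] \<or> nonthin cs = [Thick, Thick]"
    using \<open>corolla_type y cs\<close> by (cases y) (auto simp: corolla_type_iff)
  moreover have "Empty \<in> set (nonthin cs)"
    using \<open>c \<in> set cs\<close> \<open>c = Empty\<close> by simp
  ultimately show False by (elim disjE) simp_all
qed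

lemma well_colored_child_color:
  "well_colored (Vertex y ts) \<Longrightarrow> t \<in> set ts \<Longrightarrow> root_color t \<noteq> Empty"
  using corolla_type_child by force

lemma well_colored_length: "well_colored (Vertex y ts) \<Longrightarrow> 2 \<le> length ts"
  using corolla_type_length by fastforce

lemma fst_dfs_leaves: "fst ` set (dfs_leaves D) = labels D"
  by (induction D) (auto simp: image_UN)

lemma dfs_leaves_nonempty: "well_colored D \<Longrightarrow> dfs_leaves D \<noteq> []"
proof (induction D)
  case (Vertex y ts)
  then obtain t where "t \<in> set ts" using well_colored_length[of y ts] by (cases ts) auto
  then show ?case using Vertex by auto
qed simp

lemma labels_nonempty: "well_colored D \<Longrightarrow> labels D \<noteq> {}"
  using dfs_leaves_nonempty[of D] fst_dfs_leaves[of D] by auto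

lemma num_leaves_eq_card: "distinct (map fst (dfs_leaves D)) \<Longrightarrow> num_leaves D = card (labels D)"
  by (metis distinct_card fst_dfs_leaves length_map list.set_map num_leaves_def)

section \<open>Cyclic rotation and the invariants of contraction\<close>

lemma start_at_thick_rotate:
  assumes "\<forall>x\<in>set xs. col x \<noteq> Thick" "\<exists>x\<in>set ys. col x = Thick"
  shows "start_at_thick col (xs @ ys) = start_at_thick col (ys @ xs)"
proof -
  have "takeWhile (\<lambda>x. col x \<noteq> Thick) (ys @ xs) = takeWhile (\<lambda>x. col x \<noteq> Thick) ys"
    "dropWhile (\<lambda>x. col x \<noteq> Thick) (ys @ xs) = dropWhile (\<lambda>x. col x \<noteq> Thick) ys @ xs"
    using assms(2) by (auto simp: takeWhile_append1)
  then show ?thesis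
    using assms(1) by (simp add: start_at_thick_def takeWhile_append2 dropWhile_append2)
qed

lemma start_at_thick_id: "xs \<noteq> [] \<Longrightarrow> col (hd xs) = Thick \<Longrightarrow> start_at_thick col xs = xs"
  by (cases xs) (auto simp: start_at_thick_def)

lemma mset_start_at_thick [simp]: "mset (start_at_thick col xs) = mset xs"
  unfolding start_at_thick_def
  by (metis mset_append takeWhile_dropWhile_id union_commute)

lemma set_start_at_thick [simp]: "set (start_at_thick col xs) = set xs"
  by (metis mset_start_at_thick set_mset_mset)

lemma length_start_at_thick [simp]: "length (start_at_thick col xs) = length xs"
  by (metis mset_start_at_thick size_mset)

lemma start_at_thick_map: "start_at_thick col (map f xs) = map f (start_at_thick (col \<circ> f) xs)"
  by (simp add: start_at_thick_def takeWhile_map dropWhile_map o_def)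

lemma set_arrange [simp]: "set (arrange y us) = set us"
  and mset_arrange [simp]: "mset (arrange y us) = mset us"
  and length_arrange [simp]: "length (arrange y us) = length us"
  by (simp_all add: arrange_def)

lemma arrange_map: "(\<And>u. u \<in> set us \<Longrightarrow> root_color (f u) = root_color u) \<Longrightarrow>
    arrange y (map f us) = map f (arrange y us)"
proof -
  assume a: "\<And>u. u \<in> set us \<Longrightarrow> root_color (f u) = root_color u"
  have "start_at_thick (root_color \<circ> f) us = start_at_thick root_color us"
    unfolding start_at_thick_def using a by (auto cong: takeWhile_cong dropWhile_cong)
  then show ?thesis by (simp add: arrange_def start_at_thick_map)
qed

lemma root_color_contract [simp]: "root_color (contract X D) = root_color D"
  by (cases D) auto

lemma is_leaf_contract [simp]: "is_leaf (contract X D) = is_leaf D"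
  by (cases D) auto

lemma inputs_eq: "\<not> is_leaf D \<Longrightarrow> D = Vertex (root_color D) (inputs D)"
  by (cases D) auto

lemma mset_concat_map: "mset (concat (map f xs)) = (\<Sum>x\<in>#mset xs. mset (f x))"
  by (induction xs) auto

text \<open>Only a multiset equation holds in general: at an empty root the inputs, and with them
  the leaves, may be rotated.\<close>

lemma mset_dfs_leaves_contract [simp]: "mset (dfs_leaves (contract X D)) = mset (dfs_leaves D)"
proof (induction D)
  case (Vertex y ts)
  have br: "(\<Sum>u\<in>#mset (branches X t). mset (dfs_leaves u)) = mset (dfs_leaves t)" if "t \<in> set ts" for t
    using Vertex[OF that] by (cases t) (auto simp: branches_def mset_concat_map)
  have "mset (dfs_leaves (contract X (Vertex y ts))) =
      (\<Sum>u\<in>#mset (concat (map (branches X) ts)). mset (dfs_leaves u))"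
    by (simp only: contract_Vertex dfs_leaves.simps mset_concat_map mset_arrange)
  also have "\<dots> = (\<Sum>t\<in>#mset ts. \<Sum>u\<in>#mset (branches X t). mset (dfs_leaves u))"
    by (induction ts) auto
  also have "\<dots> = (\<Sum>t\<in>#mset ts. mset (dfs_leaves t))"
    using br by (intro arg_cong[of _ _ sum_mset] image_mset_cong) auto
  finally show ?case by (simp add: mset_concat_map)
qed simp

lemma set_dfs_leaves_contract [simp]: "set (dfs_leaves (contract X D)) = set (dfs_leaves D)"
  by (metis mset_dfs_leaves_contract set_mset_mset)

lemma labels_contract [simp]: "labels (contract X D) = labels D"
  by (metis set_dfs_leaves_contract fst_dfs_leaves)

lemma num_leaves_contract [simp]: "num_leaves (contract X D) = num_leaves D"
  by (metis num_leaves_def mset_dfs_leaves_contract size_mset)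

lemma distinct_names_mset:
  "mset (dfs_leaves D) = mset (dfs_leaves E) \<Longrightarrow>
   distinct (map fst (dfs_leaves D)) = distinct (map fst (dfs_leaves E))"
  by (metis mset_eq_imp_distinct_iff mset_map)

lemma distinct_names_contract [simp]:
  "distinct (map fst (dfs_leaves (contract X D))) = distinct (map fst (dfs_leaves D))"
  by (rule distinct_names_mset) simp

text \<open>A thin corolla has no non-thin input, and a thick one has exactly one, which is thick.
  Replacing a vertex by its inputs therefore leaves the non-thin colors at the parent as they
  were.\<close>

lemma nonthin_branches:
  assumes "well_colored (contract X t)" "root_color t \<noteq> Empty"
  shows "nonthin (map root_color (branches X t)) = nonthin [root_color t]"
    and "branches X t \<noteq> []"
proof -
  have "nonthin (map root_color (branches X t)) = nonthin [root_color t] \<and> branches X t \<noteq> []"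
  proof (cases "\<not> is_leaf t \<and> labels t \<in> X")
    case True
    then obtain ts where "contract X t = Vertex (root_color t) ts" by (cases t) auto
    with True assms corolla_type_length[of "root_color t" "map root_color ts"] show ?thesis
      by (cases "root_color t") (auto simp: branches_def corolla_type_iff)
  qed (auto simp: branches_def)
  then show "nonthin (map root_color (branches X t)) = nonthin [root_color t]" "branches X t \<noteq> []"
    by auto
qed

lemma filter_start_at_thick:
  assumes "filter P (takeWhile (\<lambda>x. col x \<noteq> Thick) xs) = []"
  shows "filter P (start_at_thick col xs) = filter P xs"
  using assms filter_append[of P "takeWhile (\<lambda>x. col x \<noteq> Thick) xs" "dropWhile (\<lambda>x. col x \<noteq> Thick) xs"]
  by (simp add: start_at_thick_def)

lemma hd_start_at_thick:
  assumes "\<exists>x\<in>set xs. col x = Thick"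
  shows "start_at_thick col xs \<noteq> [] \<and> col (hd (start_at_thick col xs)) = Thick"
proof -
  have ne: "dropWhile (\<lambda>x. col x \<noteq> Thick) xs \<noteq> []" using assms by auto
  from hd_dropWhile[OF this] ne show ?thesis by (simp add: start_at_thick_def)
qed

text \<open>For an empty root the entries skipped by \<open>start_at_thick\<close> are thin, so the
  rotation keeps the non-thin list, and it puts a thick entry first, as the shape of an inner
  product corolla demands.\<close>

lemma well_colored_arrange:
  assumes wc: "\<forall>u\<in>set us. well_colored u" and l: "2 \<le> length us"
    and nt: "nonthin (map root_color us) = nonthin cs" and ct: "corolla_type y cs"
  shows "well_colored (Vertex y (arrange y us))"
proof (cases "y = Empty")
  case True
  have nt2: "nonthin (map root_color us) = [Thick, Thick]"
    using ct True nt by (simp add: corolla_type_iff)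
  then have "Thick \<in> set (nonthin (map root_color us))" by simp
  then have ex: "\<exists>u\<in>set us. root_color u = Thick" by (rule nonthin_mapD)
  have ne: "\<forall>u\<in>set us. root_color u \<noteq> Empty"
  proof (rule ccontr)
    assume "\<not> ?thesis"
    then have "Empty \<in> set (nonthin (map root_color us))" by force
    with nt2 show False by auto
  qed
  have f: "filter (\<lambda>u. root_color u \<noteq> Thin) (start_at_thick root_color us) =
      filter (\<lambda>u. root_color u \<noteq> Thin) us"
  proof (rule filter_start_at_thick)
    have "root_color u = Thin" if "u \<in> set (takeWhile (\<lambda>u. root_color u \<noteq> Thick) us)" for u
      using set_takeWhileD[OF that] ne by (cases "root_color u") auto
    then show "filter (\<lambda>u. root_color u \<noteq> Thin) (takeWhile (\<lambda>u. root_color u \<noteq> Thick) us) = []"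
      by (auto simp: filter_empty_conv)
  qed
  have "nonthin (map root_color (start_at_thick root_color us)) = [Thick, Thick]"
    using f nt2 by (simp add: filter_map o_def)
  with hd_start_at_thick[OF ex] have "corolla_type Empty (map root_color (start_at_thick root_color us))"
    by (simp add: corolla_type_iff hd_map)
  with wc show ?thesis by (simp add: True arrange_def)
next
  case False
  with assms show ?thesis by (cases y) (auto simp: arrange_def corolla_type_iff)
qed

lemma nonthin_concat_branches:
  assumes "\<And>t. t \<in> set ts \<Longrightarrow> well_colored (contract X t)"
    "\<And>t. t \<in> set ts \<Longrightarrow> root_color t \<noteq> Empty"
  shows "nonthin (map root_color (concat (map (branches X) ts))) = nonthin (map root_color ts)"
    and "length ts \<le> length (concat (map (branches X) ts))"
proof -
  have "nonthin (map root_color (concat (map (branches X) ts))) = nonthin (map root_color ts) \<and>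
     length ts \<le> length (concat (map (branches X) ts))"
    using assms
  proof (induction ts)
    case (Cons t ts)
    have IH: "nonthin (map root_color (concat (map (branches X) ts))) = nonthin (map root_color ts)"
       "length ts \<le> length (concat (map (branches X) ts))"
      using Cons by auto
    have "nonthin (map root_color (branches X t)) = nonthin [root_color t]" "branches X t \<noteq> []"
      using nonthin_branches Cons.prems by (metis list.set_intros(1))+
    then have "nonthin (map root_color (branches X t)) = nonthin [root_color t]" "1 \<le> length (branches X t)"
      by (auto simp: Suc_le_eq)
    then show ?case using IH by simp
  qed simp
  then show "nonthin (map root_color (concat (map (branches X) ts))) = nonthin (map root_color ts)"
    and "length ts \<le> length (concat (map (branches X) ts))" by auto
qed

lemma well_colored_contract: "well_colored D \<Longrightarrow> well_colored (contract X D)"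
proof (induction D)
  case (Vertex y ts)
  have wc: "well_colored (contract X t)" "root_color t \<noteq> Empty" if "t \<in> set ts" for t
    using Vertex well_colored_child_color that by auto
  have "well_colored (Vertex y (arrange y (concat (map (branches X) ts))))"
  proof (rule well_colored_arrange)
    show "\<forall>u\<in>set (concat (map (branches X) ts)). well_colored u"
    proof
      fix u assume "u \<in> set (concat (map (branches X) ts))"
      then obtain t where t: "t \<in> set ts" "u \<in> set (branches X t)" by auto
      show "well_colored u"
      proof (cases "\<not> is_leaf t \<and> labels t \<in> X")
        case True
        then have "u \<in> set (inputs (contract X t))" using t by (simp add: branches_def)
        with wc(1)[OF t(1)] show ?thesis by (cases "contract X t") auto
      next
        case False
        then show ?thesis using t wc by (auto simp: branches_def)
      qed
    qed
    show "nonthin (map root_color (concat (map (branches X) ts))) = nonthin (map root_color ts)"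
      by (rule nonthin_concat_branches(1)) (use wc in auto)
    show "2 \<le> length (concat (map (branches X) ts))"
      using nonthin_concat_branches(2)[of ts X] wc well_colored_length[OF Vertex.prems] by force
    show "corolla_type y (map root_color ts)" using Vertex.prems by simp
  qed
  then show ?case by simp
qed simp

lemma nonthin_dfs_leaves:
  "well_colored D \<Longrightarrow> root_color D \<noteq> Empty \<Longrightarrow> nonthin (map snd (dfs_leaves D)) = nonthin [root_color D]"
proof (induction D)
  case (Vertex y ts)
  have "nonthin (map snd (dfs_leaves t)) = nonthin [root_color t]" if "t \<in> set ts" for t
    using that Vertex well_colored_child_color[OF Vertex.prems(1) that] by auto
  then have "nonthin (map snd (dfs_leaves (Vertex y ts))) = nonthin (map root_color ts)"
    by (induction ts) auto
  then show ?case using Vertex.prems by (cases y) (auto simp: corolla_type_iff)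
qed simp

lemma dfs_leaves_branches:
  "(root_color t \<noteq> Empty \<Longrightarrow> dfs_leaves (contract X t) = dfs_leaves t) \<Longrightarrow> root_color t \<noteq> Empty \<Longrightarrow>
   concat (map dfs_leaves (branches X t)) = dfs_leaves t"
  by (cases t) (auto simp: branches_def)

lemma concat_map_concat: "concat (map f (concat xss)) = concat (map (\<lambda>xs. concat (map f xs)) xss)"
  by (induction xss) auto

lemma dfs_leaves_contract:
  "well_colored D \<Longrightarrow> root_color D \<noteq> Empty \<Longrightarrow> dfs_leaves (contract X D) = dfs_leaves D"
proof (induction D)
  case (Vertex y ts)
  have "concat (map dfs_leaves (branches X t)) = dfs_leaves t" if "t \<in> set ts" for t
    using dfs_leaves_branches Vertex that well_colored_child_color[OF Vertex.prems(1) that] by auto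
  then have "map (\<lambda>t. concat (map dfs_leaves (branches X t))) ts = map dfs_leaves ts" by simp
  then have "concat (map (\<lambda>t. concat (map dfs_leaves (branches X t))) ts) = concat (map dfs_leaves ts)"
    by (rule arg_cong)
  then show ?case using Vertex.prems(2) by (simp add: arrange_def concat_map_concat o_def)
qed simp

lemma dfs_leaves_thick:
  "well_colored D \<Longrightarrow> root_color D = Thick \<Longrightarrow> \<exists>x\<in>set (dfs_leaves D). snd x = Thick"
proof -
  assume "well_colored D" "root_color D = Thick"
  then have "nonthin (map snd (dfs_leaves D)) = [Thick]" using nonthin_dfs_leaves[of D] by simp
  then have "Thick \<in> set (nonthin (map snd (dfs_leaves D)))" by simp
  then show ?thesis by (rule nonthin_mapD)
qed

lemma dfs_leaves_thin:
  "well_colored D \<Longrightarrow> root_color D = Thin \<Longrightarrow> x \<in> set (dfs_leaves D) \<Longrightarrow> snd x = Thin"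
proof (rule ccontr)
  assume "well_colored D" "root_color D = Thin" "x \<in> set (dfs_leaves D)" "snd x \<noteq> Thin"
  then have "snd x \<in> set (nonthin (map snd (dfs_leaves D)))" by auto
  with \<open>well_colored D\<close> \<open>root_color D = Thin\<close> show False using nonthin_dfs_leaves[of D] by simp
qed

text \<open>The inputs moved to the end are thin trees and carry only thin leaves, so moving them is
  part of what \<open>start_at_thick\<close> does to the leaf list anyway.\<close>

lemma start_at_thick_dfs_leaves:
  assumes wc: "\<forall>u\<in>set us. well_colored u \<and> root_color u \<noteq> Empty"
    and ex: "\<exists>u\<in>set us. root_color u = Thick"
  shows "start_at_thick snd (concat (map dfs_leaves (start_at_thick root_color us))) =
     start_at_thick snd (concat (map dfs_leaves us))"
proof -
  define A where "A = takeWhile (\<lambda>u. root_color u \<noteq> Thick) us"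
  define B where "B = dropWhile (\<lambda>u. root_color u \<noteq> Thick) us"
  have us: "us = A @ B" by (simp add: A_def B_def)
  have A: "\<forall>x\<in>set (concat (map dfs_leaves A)). snd x \<noteq> Thick"
  proof
    fix x assume "x \<in> set (concat (map dfs_leaves A))"
    then obtain u where u: "u \<in> set A" "x \<in> set (dfs_leaves u)" by auto
    then have "u \<in> set us" "root_color u \<noteq> Thick" by (auto simp: A_def dest: set_takeWhileD)
    then have "root_color u = Thin" "well_colored u" using wc by (cases "root_color u"; auto)+
    then show "snd x \<noteq> Thick" using dfs_leaves_thin[of u x] u by simp
  qed
  obtain u where u: "u \<in> set us" "root_color u = Thick" using ex by auto
  then have "u \<notin> set A" unfolding A_def by (auto dest: set_takeWhileD)
  then have "u \<in> set B" using u(1) arg_cong[OF us, of set] by simp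
  then have B: "\<exists>x\<in>set (concat (map dfs_leaves B)). snd x = Thick"
    using dfs_leaves_thick[of u] wc u by auto
  have "start_at_thick root_color us = B @ A" by (simp add: start_at_thick_def A_def B_def)
  with start_at_thick_rotate[OF A B] arg_cong[OF us, of "map dfs_leaves"] show ?thesis by simp
qed

lemma Empty_has_thick: "well_colored (Vertex Empty ts) \<Longrightarrow> \<exists>t\<in>set ts. root_color t = Thick"
  by (cases ts) (auto simp: corolla_type_iff)

text \<open>Contraction can rotate the leaves of an inner product diagram, but
  \<open>leaf_order\<close> starts at the left thick leaf and is insensitive to a rotation of
  leading thin leaves.\<close>

lemma leaf_order_contract: assumes "well_colored D" shows "leaf_order (contract X D) = leaf_order D"
proof (cases "root_color D = Empty \<and> \<not> is_leaf D")
  case True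
  then obtain ts where D: "D = Vertex Empty ts" by (cases D) auto
  have wc: "well_colored t" "well_colored (contract X t)" "root_color t \<noteq> Empty" if "t \<in> set ts" for t
    using assms D that well_colored_contract[of t X] well_colored_child_color[of Empty ts t] by auto
  let ?us = "concat (map (branches X) ts)"
  have wcc: "well_colored (contract X D)" using assms by (rule well_colored_contract)
  have u: "\<forall>u\<in>set ?us. well_colored u \<and> root_color u \<noteq> Empty"
    using wcc well_colored_child_color[of Empty "arrange Empty ?us"] by (simp add: D)
  have ex: "\<exists>u\<in>set ?us. root_color u = Thick"
    using wcc Empty_has_thick[of "arrange Empty ?us"] by (simp add: D)
  have "concat (map dfs_leaves (branches X t)) = dfs_leaves t" if "t \<in> set ts" for t
    using dfs_leaves_branches dfs_leaves_contract wc that by blast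
  then have "map (\<lambda>t. concat (map dfs_leaves (branches X t))) ts = map dfs_leaves ts" by simp
  then have "concat (map (\<lambda>t. concat (map dfs_leaves (branches X t))) ts) = concat (map dfs_leaves ts)"
    by (rule arg_cong)
  then have "concat (map dfs_leaves ?us) = dfs_leaves D"
    by (simp add: D concat_map_concat o_def)
  with start_at_thick_dfs_leaves[OF u ex] True show ?thesis
    by (simp add: leaf_order_def D arrange_def)
next
  case False
  then have "dfs_leaves (contract X D) = dfs_leaves D"
    using dfs_leaves_contract[OF assms] by (cases D) auto
  with False show ?thesis by (simp only: leaf_order_def root_color_contract is_leaf_contract if_False)
qed

section \<open>Edges and expansions\<close>

text \<open>The edge below \<open>t\<close> is included, which makes the edges of a vertex the union
  over its inputs.\<close>

definition branch_edges :: "'a diagram \<Rightarrow> 'a set set" where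
  "branch_edges t = (if is_leaf t then {} else insert (labels t) (set (edges t)))"

lemma set_edges_Vertex: "set (edges (Vertex y ts)) = (\<Union>t\<in>set ts. branch_edges t)"
  by (auto simp: branch_edges_def split: if_splits)

lemma branch_edges_Leaf [simp]: "branch_edges (Leaf c a) = {}"
  by (simp add: branch_edges_def)

text \<open>An edge is named by the leaves beyond it, and contraction does not alter these for the
  surviving edges.\<close>

lemma set_edges_contract: "set (edges (contract X D)) = set (edges D) - X"
proof (induction D)
  case (Vertex y ts)
  have "(\<Union>u\<in>set (branches X t). branch_edges u) = branch_edges t - X" if "t \<in> set ts" for t
  proof (cases t)
    case v: (Vertex z us)
    have "(\<Union>u\<in>set (inputs (contract X t)). branch_edges u) = set (edges t) - X"
      using Vertex[OF that] unfolding v contract_Vertex set_edges_Vertex by simp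
    then show ?thesis
      using Vertex[OF that] by (auto simp: branches_def branch_edges_def v simp del: contract_Vertex edges.simps)
  qed (simp add: branches_def)
  then have "(\<Union>t\<in>set ts. \<Union>u\<in>set (branches X t). branch_edges u) = (\<Union>t\<in>set ts. branch_edges t - X)"
    by (rule SUP_cong[OF refl])
  then show ?case by (simp add: set_edges_Vertex del: edges.simps)
qed simp

lemma edges_subset: "e \<in> set (edges D) \<Longrightarrow> e \<subseteq> labels D"
proof (induction D)
  case (Vertex y ts)
  then obtain t where t: "t \<in> set ts" "e \<in> branch_edges t" by (auto simp: set_edges_Vertex simp del: edges.simps)
  then have "e \<subseteq> labels t" using Vertex.IH by (auto simp: branch_edges_def split: if_splits)
  with t show ?case by auto
qed simp

lemma branch_edges_subset: "e \<in> branch_edges t \<Longrightarrow> e \<subseteq> labels t"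
  using edges_subset by (auto simp: branch_edges_def split: if_splits)

lemma edges_nonempty: "well_colored D \<Longrightarrow> e \<in> set (edges D) \<Longrightarrow> e \<noteq> {}"
proof (induction D)
  case (Vertex y ts)
  then obtain t where t: "t \<in> set ts" "e \<in> branch_edges t" by (auto simp: set_edges_Vertex simp del: edges.simps)
  with Vertex labels_nonempty[of t] show ?case by (auto simp: branch_edges_def split: if_splits)
qed simp

lemma branch_edges_nonempty: "well_colored D \<Longrightarrow> e \<in> branch_edges D \<Longrightarrow> e \<noteq> {}"
  using edges_nonempty[of D e] labels_nonempty[of D] by (auto simp: branch_edges_def split: if_splits)

lemma proper_child:
  assumes "proper (Vertex y ts)" "t \<in> set ts"
  shows "proper t"
proof -
  obtain us vs where "ts = us @ t # vs" using assms(2) by (meson split_list)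
  then show ?thesis using assms by (auto simp: proper_def)
qed

lemma set_names_concat: "set (map fst (concat (map dfs_leaves us))) = (\<Union>u\<in>set us. labels u)"
  by (simp add: image_UN fst_dfs_leaves)

lemma proper_split:
  assumes "proper (Vertex y (us @ t # vs))" "u \<in> set us \<union> set vs"
  shows "labels u \<inter> labels t = {}"
proof -
  have "distinct (map fst (concat (map dfs_leaves us)) @ map fst (dfs_leaves t) @ map fst (concat (map dfs_leaves vs)))"
    using assms(1) by (simp add: proper_def)
  then have "set (map fst (concat (map dfs_leaves us))) \<inter> labels t = {}"
    "set (map fst (concat (map dfs_leaves vs))) \<inter> labels t = {}"
    by (simp_all only: distinct_append set_append flip: fst_dfs_leaves list.set_map) blast+
  then show ?thesis using assms(2) unfolding set_names_concat by blast
qed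

lemma proper_disjoint:
  assumes "proper (Vertex y ts)" "t \<in> set ts" "u \<in> set ts" "labels t \<inter> labels u \<noteq> {}"
  shows "t = u"
proof -
  obtain us vs where ts: "ts = us @ t # vs" using assms(2) by (meson split_list)
  with proper_split[of y us t vs u] assms show ?thesis by auto
qed

text \<open>A second input exists and has leaves of its own. This is what makes the naming of edges
  by leaf sets injective.\<close>

lemma proper_labels_psubset:
  assumes "proper (Vertex y ts)" "t \<in> set ts"
  shows "labels t \<subset> labels (Vertex y ts)"
proof -
  obtain us vs where ts: "ts = us @ t # vs" using assms(2) by (meson split_list)
  have "2 \<le> length ts" using assms(1) well_colored_length by (auto simp: proper_def)
  then obtain u where u: "u \<in> set us \<union> set vs" using ts by (cases us; cases vs) auto
  then have "labels u \<inter> labels t = {}" "labels u \<noteq> {}"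
    using proper_split[of y us t vs u] labels_nonempty[of u] assms ts by (auto simp: proper_def)
  with u ts show ?thesis by auto
qed

lemma edges_psubset: "proper D \<Longrightarrow> e \<in> set (edges D) \<Longrightarrow> e \<subset> labels D"
proof (cases D)
  case (Vertex y ts)
  assume a: "proper D" "e \<in> set (edges D)"
  then obtain t where t: "t \<in> set ts" "e \<in> branch_edges t"
    by (auto simp: Vertex set_edges_Vertex simp del: edges.simps)
  with branch_edges_subset proper_labels_psubset[of y ts t] a Vertex show ?thesis by blast
qed simp

lemma distinct_edges: "proper D \<Longrightarrow> distinct (edges D)"
proof (induction D)
  case (Vertex y ts)
  have ch: "proper t \<and> distinct (edges t)" if "t \<in> set ts" for t
    using Vertex proper_child that by blast
  have "distinct (map fst (concat (map dfs_leaves ts)))" using Vertex.prems by (simp add: proper_def)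
  with ch have "distinct (concat (map (\<lambda>t. if is_leaf t then [] else labels t # edges t) ts))"
  proof (induction ts)
    case (Cons t ts)
    have s: "set (if is_leaf t then [] else labels t # edges t) = branch_edges t" for t :: "'a diagram"
      by (simp add: branch_edges_def)
    have dj: "labels t \<inter> labels u = {}" if "u \<in> set ts" for u
    proof -
      have "distinct (map fst (dfs_leaves t) @ map fst (concat (map dfs_leaves ts)))"
        using Cons.prems(2) by simp
      then have "labels t \<inter> set (map fst (concat (map dfs_leaves ts))) = {}"
        by (simp only: distinct_append flip: fst_dfs_leaves list.set_map)
      then show ?thesis using that unfolding set_names_concat by blast
    qed
    have "branch_edges t \<inter> branch_edges u = {}" if "u \<in> set ts" for u
    proof -
      have "well_colored t" "well_colored u" using Cons.prems(1) that by (auto simp: proper_def)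
      then show ?thesis
        using dj[OF that] branch_edges_subset[of _ t] branch_edges_subset[of _ u]
          branch_edges_nonempty[of t]
        by (metis Int_greatest disjoint_iff subset_empty)
    qed
    then have "set (if is_leaf t then [] else labels t # edges t) \<inter>
        set (concat (map (\<lambda>t. if is_leaf t then [] else labels t # edges t) ts)) = {}"
      by (simp only: set_concat list.set_map image_image s) blast
    moreover have "distinct (if is_leaf t then [] else labels t # edges t)"
      using Cons.prems(1) edges_psubset[of t] by auto
    ultimately show ?case using Cons by simp
  qed simp
  then show ?case by simp
qed simp

text \<open>Used to tell edges apart across a local move: the edge removed and the edge created
  cross, so no proper diagram contains both.\<close>

lemma edges_laminar:
  "proper D \<Longrightarrow> e \<in> set (edges D) \<Longrightarrow> f \<in> set (edges D) \<Longrightarrow> e \<subseteq> f \<or> f \<subseteq> e \<or> e \<inter> f = {}"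
proof (induction D)
  case (Vertex y ts)
  obtain t u where t: "t \<in> set ts" "e \<in> branch_edges t" and u: "u \<in> set ts" "f \<in> branch_edges u"
    using Vertex.prems by (auto simp: set_edges_Vertex simp del: edges.simps)
  show ?case
  proof (cases "t = u")
    case True
    with t u Vertex proper_child[OF Vertex.prems(1)] branch_edges_subset[of e t] branch_edges_subset[of f t]
    show ?thesis by (auto simp: branch_edges_def split: if_splits)
  next
    case False
    then have "labels t \<inter> labels u = {}" using proper_disjoint Vertex.prems(1) t u by metis
    with branch_edges_subset t u show ?thesis by blast
  qed
qed simp

lemma num_leaves_Vertex: "num_leaves (Vertex y ts) = sum_list (map num_leaves ts)"
  by (simp add: num_leaves_def[abs_def] length_concat o_def)

lemma num_leaves_Leaf [simp]: "num_leaves (Leaf c a) = 1"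
  by (simp add: num_leaves_def)

lemma num_leaves_pos: "well_colored D \<Longrightarrow> 1 \<le> num_leaves D"
  using dfs_leaves_nonempty[of D] by (simp add: num_leaves_def Suc_le_eq)

text \<open>Each input accounts for fewer edges than leaves, even with the edge below it counted,
  and there are at least two inputs. Hence the truncated subtraction in \<open>degree\<close> is
  exact.\<close>

lemma edges_bound: "well_colored D \<Longrightarrow> \<not> is_leaf D \<Longrightarrow> length (edges D) + 2 \<le> num_leaves D"
proof (induction D)
  case (Vertex y ts)
  have "length (if is_leaf t then [] else labels t # edges t) + 1 \<le> num_leaves t" if "t \<in> set ts" for t
    using Vertex.IH[OF that] Vertex.prems that num_leaves_pos[of t] by auto
  then have "length (concat (map (\<lambda>t. if is_leaf t then [] else labels t # edges t) ts)) + length ts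
     \<le> sum_list (map num_leaves ts)"
  proof (induction ts)
    case (Cons t ts)
    from Cons.prems[of t] Cons.IH Cons.prems show ?case by fastforce
  qed simp
  then show ?case using well_colored_length[OF Vertex.prems(1)] by (simp add: num_leaves_Vertex)
qed simp

section \<open>Corollas, their expansions and finiteness\<close>

lemma diagrams_iff:
  "D \<in> diagrams \<longleftrightarrow> proper D \<and> labels D = {1..num_leaves D} \<and> \<not> is_leaf D"
  by (auto simp: diagrams_def labeled_def proper_def)

text \<open>Without internal edges the inputs are the leaves themselves. For an empty root no
  rotation intervenes, because the first input is already thick.\<close>

lemma corolla_eq:
  assumes "well_colored D" "\<not> is_leaf D" "edges D = []"
  shows "D = Vertex (root_color D) (map (\<lambda>(a, c). Leaf c a) (leaf_order D))"
proof -
  obtain y ts where D: "D = Vertex y ts" using assms(2) by (cases D) auto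
  have lf: "is_leaf t" if "t \<in> set ts" for t using assms(3) that by (auto simp: D split: if_splits)
  then have "\<forall>t\<in>set ts. \<exists>c a. t = Leaf c a" by (metis is_leaf.elims(2))
  then have e: "map (\<lambda>(a, c). Leaf c a) (concat (map dfs_leaves ts)) = ts \<and>
     map snd (concat (map dfs_leaves ts)) = map root_color ts"
    by (induction ts) auto
  have "leaf_order D = dfs_leaves D"
  proof (cases "y = Empty")
    case True
    then have "ts \<noteq> []" "root_color (hd ts) = Thick" using assms(1) by (auto simp: D corolla_type_iff hd_map)
    moreover have "map snd (dfs_leaves D) = map root_color ts" using e by (simp add: D)
    ultimately have "dfs_leaves D \<noteq> []" "snd (hd (dfs_leaves D)) = Thick"
      by (metis Nil_is_map_conv hd_map)+
    then show ?thesis by (simp add: D leaf_order_def start_at_thick_id)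
  qed (simp add: D leaf_order_def)
  with e show ?thesis by (simp add: D)
qed

lemma set_leaf_order [simp]: "set (leaf_order D) = set (dfs_leaves D)"
  and mset_leaf_order [simp]: "mset (leaf_order D) = mset (dfs_leaves D)"
  and length_leaf_order [simp]: "length (leaf_order D) = num_leaves D"
  by (simp_all add: leaf_order_def num_leaves_def)

lemma contract_in_diagrams: "D \<in> diagrams \<Longrightarrow> contract X D \<in> diagrams"
  using well_colored_contract[of D X] by (simp add: diagrams_iff proper_def)

text \<open>Contracting every edge of \<open>D\<close> yields a corolla with the same root color and
  leaf order, and these determine it. The existential quantifier over edge sets is thereby replaced
  by two equations.\<close>

lemma expansions_corolla:
  assumes "c \<in> corollas"
  shows "expansions c = {D \<in> diagrams. root_color D = root_color c \<and> leaf_order D = leaf_order c}"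
proof (intro equalityI subsetI)
  fix D assume "D \<in> expansions c"
  then show "D \<in> {D \<in> diagrams. root_color D = root_color c \<and> leaf_order D = leaf_order c}"
    by (auto simp: expansions_def diagrams_iff proper_def leaf_order_contract)
next
  fix D assume D: "D \<in> {D \<in> diagrams. root_color D = root_color c \<and> leaf_order D = leaf_order c}"
  let ?C = "contract (set (edges D)) D"
  have "well_colored ?C" "\<not> is_leaf ?C" "edges ?C = []"
    using D well_colored_contract set_edges_contract[of "set (edges D)" D]
    by (auto simp: diagrams_iff proper_def)
  from corolla_eq[OF this] have "?C = Vertex (root_color D) (map (\<lambda>(a, c). Leaf c a) (leaf_order D))"
    using D leaf_order_contract[of D] by (simp add: diagrams_iff proper_def)
  also have "\<dots> = c"
    using assms corolla_eq[of c] D by (auto simp: corollas_def diagrams_iff proper_def)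
  finally show "D \<in> expansions c" using D by (auto simp: expansions_def)
qed

text \<open>Every input has fewer leaves than its vertex because a sibling has at least one.
  Finiteness matters: the sums prescribing \<open>q\<close> and \<open>p\<close> would be zero over
  infinite index sets.\<close>

lemma finite_diagrams_bounded:
  assumes "finite A"
  shows "finite {D. well_colored D \<and> labels D \<subseteq> A \<and> num_leaves D \<le> n}"
proof (induction n)
  case 0
  have "{D. well_colored D \<and> labels D \<subseteq> A \<and> num_leaves D \<le> 0} = {}"
    using num_leaves_pos by fastforce
  then show ?case by (metis finite.emptyI)
next
  case (Suc n)
  let ?F = "{D. well_colored D \<and> labels D \<subseteq> A \<and> num_leaves D \<le> n}"
  let ?cols = "{Empty, Thin, Thick}"
  have cols: "y \<in> ?cols" for y by (cases y) auto
  let ?L = "{ts. set ts \<subseteq> ?F \<and> length ts \<le> Suc n}"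
  have "finite ?L" using finite_lists_length_le[OF Suc] by simp
  have "D \<in> (\<lambda>(c, a). Leaf c a) ` (?cols \<times> A) \<union> (\<lambda>(y, ts). Vertex y ts) ` (?cols \<times> ?L)"
    if D: "well_colored D" "labels D \<subseteq> A" "num_leaves D \<le> Suc n" for D
  proof (cases D)
    case (Leaf c a)
    then show ?thesis using D cols by (force simp: image_iff)
  next
    case (Vertex y ts)
    have pos: "1 \<le> num_leaves t" if "t \<in> set ts" for t
      using D(1) that num_leaves_pos by (auto simp: Vertex)
    have "num_leaves t \<le> n \<and> length ts \<le> Suc n" if t: "t \<in> set ts" for t
    proof -
      obtain us vs where ts: "ts = us @ t # vs" using t by (meson split_list)
      have le: "length ws \<le> sum_list (map num_leaves ws)" if "set ws \<subseteq> set ts" for ws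
        using that pos by (induction ws) force+
      have "1 \<le> length us + length vs" using well_colored_length[of y ts] D(1) Vertex ts by auto
      moreover have "sum_list (map num_leaves ts) \<le> Suc n" using D(3) by (simp add: Vertex num_leaves_Vertex)
      moreover have "length us \<le> sum_list (map num_leaves us)" "length vs \<le> sum_list (map num_leaves vs)"
        using le[of us] le[of vs] by (auto simp: ts)
      ultimately show ?thesis using pos[OF t] by (simp add: ts)
    qed
    moreover have "length ts \<le> Suc n" using calculation by (cases ts) auto
    ultimately have "ts \<in> ?L" using D by (auto simp: Vertex)
    then show ?thesis using cols[of y] by (auto simp: Vertex image_iff)
  qed
  then have "{D. well_colored D \<and> labels D \<subseteq> A \<and> num_leaves D \<le> Suc n} \<subseteq>
     (\<lambda>(c, a). Leaf c a) ` (?cols \<times> A) \<union> (\<lambda>(y, ts). Vertex y ts) ` (?cols \<times> ?L)" by blast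
  moreover have "finite ((\<lambda>(c, a). Leaf c a) ` (?cols \<times> A) \<union> (\<lambda>(y, ts). Vertex y ts) ` (?cols \<times> ?L))"
    using \<open>finite ?L\<close> assms by blast
  ultimately show ?case by (rule finite_subset)
qed

lemma finite_leaf_order: "finite {D \<in> diagrams. leaf_order D = ls}"
proof (rule finite_subset)
  show "{D \<in> diagrams. leaf_order D = ls} \<subseteq>
     {D. well_colored D \<and> labels D \<subseteq> fst ` set ls \<and> num_leaves D \<le> length ls}"
    by (auto simp: diagrams_iff proper_def simp flip: fst_dfs_leaves)
qed (rule finite_diagrams_bounded, simp)

lemma map_of_dfs_leaves:
  "distinct (map fst (dfs_leaves D)) \<Longrightarrow> (a, c) \<in> set (dfs_leaves D) \<Longrightarrow> map_of (dfs_leaves D) a = Some c"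
  by simp

lemma coloring_leaf_order_eq:
  assumes "distinct (map fst (dfs_leaves D))" "leaf_order S = leaf_order D" "root_color S = root_color D"
  shows "coloring S = coloring D"
proof -
  have m: "mset (dfs_leaves S) = mset (dfs_leaves D)" using assms(2) by (metis mset_leaf_order)
  then have "distinct (map fst (dfs_leaves S))" "set (dfs_leaves S) = set (dfs_leaves D)"
    "num_leaves S = num_leaves D"
    using assms(1) distinct_names_mset by (auto simp: num_leaves_def dest: mset_eq_setD mset_eq_length)
  then have "map_of (dfs_leaves S) = map_of (dfs_leaves D)" using assms(1) by (metis map_of_inject_set)
  then show ?thesis using assms(3) \<open>num_leaves S = num_leaves D\<close> by (simp add: coloring_def)
qed

lemma canonical_leaf_order:
  assumes "distinct (map fst (dfs_leaves D))" "canonical D"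
  shows "leaf_order D = zip [1..<Suc (length (fst (coloring D)))] (fst (coloring D))"
proof -
  have "fst (coloring D) = map (\<lambda>x. the (map_of (dfs_leaves D) (fst x))) (leaf_order D)"
    using assms(2) by (metis (no_types, lifting) canonical_def coloring_def fst_conv list.map_comp comp_apply map_eq_conv)
  also have "\<dots> = map snd (leaf_order D)"
    using assms(1) map_of_dfs_leaves by (intro map_cong) auto
  finally have c: "fst (coloring D) = map snd (leaf_order D)" .
  then have "[1..<Suc (length (fst (coloring D)))] = map fst (leaf_order D)"
    using assms(2) by (simp add: canonical_def)
  with c show ?thesis by (metis zip_map_fst_snd)
qed

text \<open>For canonical labelings the coloring lists the leaf colors in leaf order. The right-hand
  side, unlike the left, suits arbitrary labelings and is transported by relabeling.\<close>

lemma canonical_same_coloring_iff: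
  assumes "D \<in> diagrams" "canonical D" "S \<in> diagrams"
  shows "canonical S \<and> coloring S = coloring D \<longleftrightarrow>
     leaf_order S = leaf_order D \<and> root_color S = root_color D"
proof
  assume "canonical S \<and> coloring S = coloring D"
  then show "leaf_order S = leaf_order D \<and> root_color S = root_color D"
    using assms canonical_leaf_order[of S] canonical_leaf_order[of D]
    by (auto simp: diagrams_iff proper_def coloring_def)
next
  assume a: "leaf_order S = leaf_order D \<and> root_color S = root_color D"
  then have "num_leaves S = num_leaves D" by (metis length_leaf_order)
  with a assms show "canonical S \<and> coloring S = coloring D"
    using coloring_leaf_order_eq by (auto simp: canonical_def diagrams_iff proper_def)
qed

section \<open>Signs of the edges of a binary diagram\<close>

lemma root_color_map [simp]: "root_color (map_diagram f D) = root_color D"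
  by (cases D) auto

lemma is_leaf_map [simp]: "is_leaf (map_diagram f D) = is_leaf D"
  by (cases D) auto

lemma inputs_map: "inputs (map_diagram f D) = map (map_diagram f) (inputs D)"
  by (cases D) auto

lemma dfs_leaves_map: "dfs_leaves (map_diagram f D) = map (apfst f) (dfs_leaves D)"
proof (induction D)
  case (Vertex y ts)
  then show ?case by (simp add: map_concat o_def cong: map_cong)
qed simp

lemma num_leaves_map [simp]: "num_leaves (map_diagram f D) = num_leaves D"
  by (simp add: num_leaves_def dfs_leaves_map)

lemma leaf_order_map: "leaf_order (map_diagram f D) = map (apfst f) (leaf_order D)"
  by (simp add: leaf_order_def dfs_leaves_map start_at_thick_map o_def)

lemma well_colored_map [simp]: "well_colored (map_diagram f D) = well_colored D"
  by (induction D) (simp_all add: o_def)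

lemma proper_map: "inj f \<Longrightarrow> proper (map_diagram f D) = proper D"
proof -
  assume f: "inj f"
  have "map fst (dfs_leaves (map_diagram f D)) = map f (map fst (dfs_leaves D))"
    by (simp add: dfs_leaves_map)
  moreover have "distinct (map f (map fst (dfs_leaves D))) = distinct (map fst (dfs_leaves D))"
    using f distinct_map[of f "map fst (dfs_leaves D)"] inj_on_subset[OF f, of "set (map fst (dfs_leaves D))"] by simp
  ultimately show ?thesis by (simp add: proper_def del: map_map)
qed

lemma edges_map: "edges (map_diagram f D) = map (image f) (edges D)"
proof (induction D)
  case (Vertex y ts)
  have "map (\<lambda>t. if is_leaf t then [] else labels (map_diagram f t) # edges (map_diagram f t)) ts =
     map (\<lambda>t. map (image f) (if is_leaf t then [] else labels t # edges t)) ts"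
    using Vertex by (auto simp: diagram.set_map)
  then show ?case using arg_cong[of "map _ _" "map _ _" concat] by (simp only: edges.simps diagram.map map_map map_concat o_def is_leaf_map)
qed simp

lemma contract_map:
  assumes "inj f" shows "contract (image f ` X) (map_diagram f D) = map_diagram f (contract X D)"
proof (induction D)
  case (Vertex y ts)
  have i: "f ` A \<in> image f ` X \<longleftrightarrow> A \<in> X" for A
    using assms by (auto simp: inj_image_eq_iff)
  have br: "branches (image f ` X) (map_diagram f t) = map (map_diagram f) (branches X t)" if "t \<in> set ts" for t
    using Vertex[OF that] i by (simp add: branches_def diagram.set_map inputs_map)
  have "concat (map (branches (image f ` X) \<circ> map_diagram f) ts) =
     map (map_diagram f) (concat (map (branches X) ts))"
    unfolding map_concat map_map o_def using br by (simp cong: map_cong)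
  then show ?case by (simp add: arrange_map)
qed simp

lemma binary_induct [consumes 1, case_names Leaf Vertex]:
  assumes "all_vertices_binary B" "\<And>c a. P (Leaf c a)"
    "\<And>y s t. all_vertices_binary s \<Longrightarrow> all_vertices_binary t \<Longrightarrow> P s \<Longrightarrow> P t \<Longrightarrow> P (Vertex y [s, t])"
  shows "P B"
  using assms(1)
proof (induction B)
  case (Vertex y ts)
  then obtain s t where "ts = [s, t]" by (auto simp: length_Suc_conv numeral_2_eq_2)
  with Vertex show ?case by (auto intro!: assms(3))
qed (rule assms(2))

lemma all_vertices_binary_map [simp]: "all_vertices_binary (map_diagram f D) = all_vertices_binary D"
  by (induction D) auto

lemma corolla_type_two:
  "corolla_type y [c, d] \<longleftrightarrow> y = Thin \<and> c = Thin \<and> d = Thin \<or>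
     y = Thick \<and> (c = Thin \<and> d = Thick \<or> c = Thick \<and> d = Thin) \<or>
     y = Empty \<and> c = Thick \<and> d = Thick"
  by (cases y; cases c; cases d) (simp_all add: corolla_type_iff)

text \<open>
  In a binary diagram the sign of the edge below \<open>t\<close> depends only on \<open>t\<close> and, if that edge is thin,
  on whether \<open>t\<close> is the right (\<open>r\<close>) or the left input.
\<close>
definition positive_branch :: "bool \<Rightarrow> 'a diagram \<Rightarrow> bool" where
  "positive_branch r t = (if root_color t = Thin then r else root_color (last (inputs t)) = Thick)"

definition sign_ok :: "bool \<Rightarrow> 'a set set \<Rightarrow> bool \<Rightarrow> 'a diagram \<Rightarrow> bool" where
  "sign_ok b X r t \<longleftrightarrow> (\<not> is_leaf t \<and> labels t \<in> X \<longrightarrow> positive_branch r t = b)"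

text \<open>The flag \<open>b\<close> selects positive (\<open>True\<close>) or negative
  (\<open>False\<close>) edges, so that maximal and minimal expansions are treated at once. The edge
  below \<open>D\<close> itself is not tested. Among binary diagrams only leaves fall under the
  default case.\<close>

fun all_sign :: "bool \<Rightarrow> 'a set set \<Rightarrow> 'a diagram \<Rightarrow> bool" where
  "all_sign b X (Vertex y [s, t]) \<longleftrightarrow>
     sign_ok b X False s \<and> sign_ok b X True t \<and> all_sign b X s \<and> all_sign b X t"
| "all_sign b X D \<longleftrightarrow> True"

lemma all_sign_map:
  assumes "inj f" "all_vertices_binary D"
  shows "all_sign b (image f ` X) (map_diagram f D) = all_sign b X D"
  using assms(2)
proof (induction D rule: binary_induct)
  case (Vertex y s t)
  have i: "f ` A \<in> image f ` X \<longleftrightarrow> A \<in> X" for A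
    using assms by (auto simp: inj_image_eq_iff)
  have "sign_ok b (image f ` X) r (map_diagram f u) = sign_ok b X r u" if "all_vertices_binary u" for r u
  proof (cases "is_leaf u")
    case False
    then have "inputs u \<noteq> []" using that by (cases u) auto
    then show ?thesis
      by (simp add: sign_ok_def positive_branch_def i diagram.set_map inputs_map last_map)
  qed (simp add: sign_ok_def)
  with Vertex show ?case by simp
qed simp

lemma all_sign_cong:
  assumes "all_vertices_binary D" "X \<inter> set (edges D) = Y \<inter> set (edges D)"
  shows "all_sign b X D = all_sign b Y D"
  using assms
proof (induction D rule: binary_induct)
  case (Vertex y s t)
  have e: "set (edges (Vertex y [s, t])) = branch_edges s \<union> branch_edges t"
    by (simp add: set_edges_Vertex del: edges.simps)
  have "sign_ok b X r u = sign_ok b Y r u" if "u = s \<or> u = t" for r u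
    using that Vertex.prems unfolding e sign_ok_def branch_edges_def by (auto split: if_splits)
  moreover have "X \<inter> set (edges s) = Y \<inter> set (edges s)" "X \<inter> set (edges t) = Y \<inter> set (edges t)"
    using Vertex.prems unfolding e branch_edges_def by (cases s; cases t; auto)+
  ultimately show ?case using Vertex.IH by simp
qed simp

lemma contract_cong:
  "X \<inter> set (edges D) = Y \<inter> set (edges D) \<Longrightarrow> contract X D = contract Y D"
proof (induction D)
  case (Vertex y ts)
  have "branches X t = branches Y t" if "t \<in> set ts" for t
  proof (cases "is_leaf t")
    case True
    then show ?thesis by (cases t) (auto simp: branches_def)
  next
    case False
    then have "insert (labels t) (set (edges t)) \<subseteq> set (edges (Vertex y ts))"
      using that unfolding set_edges_Vertex by (auto simp: branch_edges_def)
    then have "labels t \<in> X \<longleftrightarrow> labels t \<in> Y" "X \<inter> set (edges t) = Y \<inter> set (edges t)"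
      using Vertex.prems by blast+
    then show ?thesis using Vertex.IH[OF that] by (simp add: branches_def)
  qed
  then show ?case by (simp cong: map_cong)
qed simp

lemma branches_cong: "X \<inter> branch_edges t = Y \<inter> branch_edges t \<Longrightarrow> branches X t = branches Y t"
proof -
  assume a: "X \<inter> branch_edges t = Y \<inter> branch_edges t"
  then have "X \<inter> set (edges t) = Y \<inter> set (edges t)"
    by (cases t) (auto simp: branch_edges_def)
  then show ?thesis using contract_cong[of X t Y] a
    by (auto simp: branches_def branch_edges_def split: if_splits)
qed

lemma branches_Vertex: "y \<noteq> Empty \<Longrightarrow> labels (Vertex y ts) \<in> X \<Longrightarrow>
    branches X (Vertex y ts) = concat (map (branches X) ts)"
  by (simp add: branches_def arrange_def)

lemma branches_nonempty: "well_colored t \<Longrightarrow> root_color t \<noteq> Empty \<Longrightarrow> branches X t \<noteq> []"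
  using nonthin_branches(2) well_colored_contract by blast

lemma nonthin_branches': "well_colored t \<Longrightarrow> root_color t \<noteq> Empty \<Longrightarrow>
    nonthin (map root_color (branches X t)) = nonthin [root_color t]"
  using nonthin_branches(1) well_colored_contract by blast

text \<open>All contracted thick vertices have their thick input on the same side, on the right if
  positive and on the left if negative, so splicing keeps the thick entry at that end.\<close>

lemma branches_end_thick:
  assumes "all_vertices_binary t" "well_colored t" "root_color t = Thick" "all_sign b X t" "sign_ok b X r t"
  shows "root_color ((if b then last else hd) (branches X t)) = Thick"
  using assms
proof (induction t arbitrary: r rule: binary_induct)
  case (Leaf c a)
  then show ?case by (simp add: branches_def)
next
  case (Vertex y s t)
  have ct: "corolla_type Thick [root_color s, root_color t]" using Vertex.prems by simp
  show ?case
  proof (cases "labels (Vertex y [s, t]) \<in> X")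
    case True
    have br: "branches X (Vertex y [s, t]) = branches X s @ branches X t"
      using branches_Vertex[OF _ True] Vertex.prems by simp
    have ne: "branches X s \<noteq> []" "branches X t \<noteq> []"
      using Vertex.prems(1) ct branches_nonempty[of s X] branches_nonempty[of t X]
      by (auto simp: corolla_type_two)
    have "(root_color t = Thick) = b"
      using Vertex.prems True by (simp add: sign_ok_def positive_branch_def)
    with ct have "if b then root_color t = Thick else root_color s = Thick"
      by (auto simp: corolla_type_two)
    with Vertex.IH Vertex.prems ne show ?thesis unfolding br by (cases b) auto
  next
    case False
    with Vertex.prems show ?thesis by (simp add: branches_def)
  qed
qed

section \<open>Recovering the two inputs of a binary vertex\<close>

lemma append_Cons_unique:
  assumes "xs @ x # ys = xs' @ x' # ys'" "\<forall>z\<in>set xs. \<not> P z" "\<forall>z\<in>set xs'. \<not> P z" "P x" "P x'"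
  shows "xs = xs' \<and> x = x' \<and> ys = ys'"
  using assms by (induction xs arbitrary: xs') (auto simp: Cons_eq_append_conv)

text \<open>
  What is known about the branches of an input \<open>t\<close> of a binary vertex if all contracted edges have
  sign \<open>b\<close>.  It suffices to recover the branches of both inputs from their concatenation.
\<close>
definition side_ok :: "bool \<Rightarrow> bool \<Rightarrow> color \<Rightarrow> 'a diagram list \<Rightarrow> bool" where
  "side_ok b r c us \<longleftrightarrow> us \<noteq> [] \<and> nonthin (map root_color us) = nonthin [c] \<and>
     (c = Thin \<longrightarrow> b = r \<or> length us = 1) \<and>
     (c = Thick \<longrightarrow> root_color ((if b then last else hd) us) = Thick)"

text \<open>The sign of a thin edge is the side \<open>r\<close> on which it is attached, so a thin
  input with \<open>b \<noteq> r\<close> cannot have been contracted and contributes one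
  entry.\<close>

lemma side_ok_branches:
  assumes "all_vertices_binary t" "well_colored t" "root_color t \<noteq> Empty" "all_sign b X t" "sign_ok b X r t"
  shows "side_ok b r (root_color t) (branches X t)"
proof -
  have "b = r \<or> length (branches X t) = 1" if "root_color t = Thin"
    using assms(5) that by (auto simp: sign_ok_def positive_branch_def branches_def)
  then show ?thesis
    using branches_end_thick[OF assms(1,2) _ assms(4,5)] branches_nonempty[OF assms(2,3)]
      nonthin_branches'[OF assms(2,3)] by (auto simp: side_ok_def)
qed

lemma side_ok_thin: "side_ok b r Thin us \<Longrightarrow> u \<in> set us \<Longrightarrow> root_color u = Thin"
  by (auto simp: side_ok_def filter_empty_conv)

lemma side_ok_nonempty: "side_ok b r c us \<Longrightarrow> us \<noteq> []"
  by (simp add: side_ok_def)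

lemma side_ok_end: "side_ok b r Thick us \<Longrightarrow> root_color (if b then last us else hd us) = Thick"
  by (cases b) (simp_all add: side_ok_def)

lemma side_ok_singleton: "side_ok b r Thin us \<Longrightarrow> b \<noteq> r \<Longrightarrow> \<exists>u. us = [u]"
  by (auto simp: side_ok_def length_Suc_conv)

lemma side_ok_last: "side_ok True r Thick us \<Longrightarrow>
    \<exists>vs u. us = vs @ [u] \<and> root_color u = Thick \<and> (\<forall>v\<in>set vs. root_color v = Thin)"
  by (cases us rule: rev_cases) (auto simp: side_ok_def filter_empty_conv split: if_splits)

lemma side_ok_hd: "side_ok False r Thick us \<Longrightarrow>
    \<exists>vs u. us = u # vs \<and> root_color u = Thick \<and> (\<forall>v\<in>set vs. root_color v = Thin)"
  by (cases us) (auto simp: side_ok_def filter_empty_conv split: if_splits)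

text \<open>If the thick input is on the same side in both splits, the cut is located by the thick
  entry or by a thin side of length one. If it is on different sides, one end of the concatenation
  would be both thick and thin.\<close>

lemma split_unique_thick:
  assumes ok: "side_ok b False c us" "side_ok b True d vs" "side_ok b False c' us'" "side_ok b True d' vs'"
    and c: "corolla_type Thick [c, d]" "corolla_type Thick [c', d']"
    and eq: "us @ vs = us' @ vs'"
  shows "us = us'"
proof -
  have thick: "\<not> root_color u = Thick" if "root_color u = Thin" for u :: "'a diagram" using that by simp
  consider "c = Thin" "d = Thick" "c' = Thin" "d' = Thick" | "c = Thick" "d = Thin" "c' = Thick" "d' = Thin"
    | "c = Thin" "d = Thick" "c' = Thick" "d' = Thin" | "c = Thick" "d = Thin" "c' = Thin" "d' = Thick"
    using c by (auto simp: corolla_type_two)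
  then show ?thesis
  proof cases
    case 1
    show ?thesis
    proof (cases b)
      case True
      with 1 ok side_ok_singleton have "\<exists>u. us = [u]" "\<exists>u. us' = [u]" by blast+
      with eq show ?thesis by auto
    next
      case False
      then obtain n q where n: "vs = n # q" "root_color n = Thick"
        using side_ok_hd[of True vs] ok(2) 1 by auto
      obtain n' q' where n': "vs' = n' # q'" "root_color n' = Thick"
        using side_ok_hd[of True vs'] ok(4) 1 False by auto
      have "\<forall>u\<in>set us. \<not> root_color u = Thick" "\<forall>u\<in>set us'. \<not> root_color u = Thick"
        using 1 ok(1,3) side_ok_thin[of b False us] side_ok_thin[of b False us'] thick by auto
      with n n' eq append_Cons_unique[of us n q us' n' q' "\<lambda>u. root_color u = Thick"]
      show ?thesis by simp
    qed
  next
    case 2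
    show ?thesis
    proof (cases b)
      case True
      obtain p m where p: "us = p @ [m]" "root_color m = Thick" "\<forall>v\<in>set p. root_color v = Thin"
        using side_ok_last[of False us] ok(1) 2 True by auto
      obtain p' m' where p': "us' = p' @ [m']" "root_color m' = Thick" "\<forall>v\<in>set p'. root_color v = Thin"
        using side_ok_last[of False us'] ok(3) 2 True by auto
      with p eq append_Cons_unique[of p m vs p' m' vs' "\<lambda>u. root_color u = Thick"]
      show ?thesis by simp
    next
      case False
      with 2 ok side_ok_singleton have "\<exists>u. vs = [u]" "\<exists>u. vs' = [u]" by blast+
      with eq show ?thesis by auto
    qed
  next
    case 3
    have t: "\<forall>u\<in>set us. root_color u = Thin" "\<forall>u\<in>set vs'. root_color u = Thin"
      using ok 3 side_ok_thin by blast+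
    have ne: "us \<noteq> []" "vs \<noteq> []" "us' \<noteq> []" "vs' \<noteq> []"
      using ok side_ok_nonempty by blast+
    have k: "root_color (if b then last vs else hd us') = Thick"
      using side_ok_end[of b True vs] side_ok_end[of b False us'] ok 3 by (cases b) simp_all
    have "last vs = last vs'" "hd us = hd us'" using eq ne by (metis last_appendR, metis hd_append2)
    then show ?thesis using t ne k last_in_set[of vs'] hd_in_set[of us] by (auto split: if_splits)
  next
    case 4
    have t: "\<forall>u\<in>set us'. root_color u = Thin" "\<forall>u\<in>set vs. root_color u = Thin"
      using ok 4 side_ok_thin by blast+
    have ne: "us \<noteq> []" "vs \<noteq> []" "us' \<noteq> []" "vs' \<noteq> []"
      using ok side_ok_nonempty by blast+
    have k: "root_color (if b then last vs' else hd us) = Thick"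
      using side_ok_end[of b True vs'] side_ok_end[of b False us] ok 4 by (cases b) simp_all
    have "last vs = last vs'" "hd us = hd us'" using eq ne by (metis last_appendR, metis hd_append2)
    then show ?thesis using t ne k last_in_set[of vs] hd_in_set[of us'] by (auto split: if_splits)
  qed
qed

text \<open>\<open>p\<close> and \<open>q\<close> are the upper and the lower inputs,
  \<open>m\<close> and \<open>n\<close> the thick ones. For positive edges the left branch brings
  the lower inputs and the right branch the upper ones, for negative edges it is the other way
  round; hence the cyclic list determines both branches.\<close>

lemma start_at_thick_split:
  assumes "side_ok b False Thick us" "side_ok b True Thick vs"
  shows "\<exists>m p n q. root_color m = Thick \<and> root_color n = Thick \<and>
    (\<forall>v\<in>set p. \<not> root_color v = Thick) \<and> (\<forall>v\<in>set q. \<not> root_color v = Thick) \<and>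
    start_at_thick root_color (us @ vs) = m # p @ n # q \<and>
    us = (if b then q @ [m] else m # p) \<and> vs = (if b then p @ [n] else n # q)"
proof (cases b)
  case True
  then obtain q m where "us = q @ [m]" "root_color m = Thick" "\<forall>v\<in>set q. root_color v = Thin"
    using side_ok_last[of False us] assms(1) by auto
  moreover obtain p n where "vs = p @ [n]" "root_color n = Thick" "\<forall>v\<in>set p. root_color v = Thin"
    using side_ok_last[of True vs] assms(2) True by auto
  ultimately have s: "us = q @ [m]" "vs = p @ [n]" "root_color m = Thick" "root_color n = Thick"
    "\<forall>v\<in>set q. root_color v = Thin" "\<forall>v\<in>set p. root_color v = Thin" by auto
  have t: "\<And>v. v \<in> set q \<Longrightarrow> root_color v \<noteq> Thick" using s by auto
  have "start_at_thick root_color (us @ vs) = m # p @ n # q"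
    using s t by (simp add: start_at_thick_def takeWhile_append2[of q] dropWhile_append2[of q])
  with s True show ?thesis by (intro exI[of _ m] exI[of _ p] exI[of _ n] exI[of _ q]) auto
next
  case False
  then obtain p m where "us = m # p" "root_color m = Thick" "\<forall>v\<in>set p. root_color v = Thin"
    using side_ok_hd[of False us] assms(1) by auto
  moreover obtain q n where "vs = n # q" "root_color n = Thick" "\<forall>v\<in>set q. root_color v = Thin"
    using side_ok_hd[of True vs] assms(2) False by auto
  ultimately have s: "us = m # p" "vs = n # q" "root_color m = Thick" "root_color n = Thick"
    "\<forall>v\<in>set q. root_color v = Thin" "\<forall>v\<in>set p. root_color v = Thin" by auto
  then have "start_at_thick root_color (us @ vs) = m # p @ n # q"
    by (simp add: start_at_thick_def)
  with s False show ?thesis by (intro exI[of _ m] exI[of _ p] exI[of _ n] exI[of _ q]) auto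
qed

text \<open>For a thin vertex the side with \<open>r \<noteq> b\<close> consists of one entry, which
  locates the cut. For an empty one the normal forms of the rotated lists are compared.\<close>

lemma split_unique:
  assumes ok: "side_ok b False c us" "side_ok b True d vs" "side_ok b False c' us'" "side_ok b True d' vs'"
    and c: "corolla_type y [c, d]" "corolla_type y [c', d']"
    and eq: "arrange y (us @ vs) = arrange y (us' @ vs')"
  shows "us = us' \<and> vs = vs'"
proof (cases y)
  case Thin
  with c have cs: "c = Thin" "d = Thin" "c' = Thin" "d' = Thin" by (auto simp: corolla_type_two)
  have "us @ vs = us' @ vs'" using eq Thin by (simp add: arrange_def)
  moreover have "b \<Longrightarrow> (\<exists>u. us = [u]) \<and> (\<exists>u. us' = [u])" "\<not> b \<Longrightarrow> (\<exists>u. vs = [u]) \<and> (\<exists>u. vs' = [u])"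
    using ok cs side_ok_singleton by blast+
  ultimately show ?thesis by (cases b) auto
next
  case Thick
  with eq have "us @ vs = us' @ vs'" by (simp add: arrange_def)
  with split_unique_thick[OF ok] c Thick show ?thesis by auto
next
  case Empty
  with c have cs: "c = Thick" "d = Thick" "c' = Thick" "d' = Thick" by (auto simp: corolla_type_two)
  obtain m p n q where 1: "root_color m = Thick" "root_color n = Thick"
    "\<forall>v\<in>set p. \<not> root_color v = Thick" "start_at_thick root_color (us @ vs) = m # p @ n # q"
    "us = (if b then q @ [m] else m # p)" "vs = (if b then p @ [n] else n # q)"
    using start_at_thick_split[of b us vs] ok unfolding cs by metis
  obtain m' p' n' q' where 2: "root_color m' = Thick" "root_color n' = Thick"
    "\<forall>v\<in>set p'. \<not> root_color v = Thick" "start_at_thick root_color (us' @ vs') = m' # p' @ n' # q'"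
    "us' = (if b then q' @ [m'] else m' # p')" "vs' = (if b then p' @ [n'] else n' # q')"
    using start_at_thick_split[of b us' vs'] ok unfolding cs by metis
  have "m = m'" "p @ n # q = p' @ n' # q'" using eq Empty 1(4) 2(4) by (auto simp: arrange_def)
  with append_Cons_unique[of p n q p' n' q' "\<lambda>u. root_color u = Thick"] 1 2 show ?thesis by simp
qed

text \<open>A contracted edge shows in the length: a vertex has at least two inputs, whereas an
  uncontracted input contributes one entry. The color of the lost root is read off from the non-thin
  entries.\<close>

lemma branches_determine:
  assumes "well_colored t" "root_color t \<noteq> Empty" "well_colored t'" "root_color t' \<noteq> Empty"
    and eq: "branches X t = branches X' t'"
  shows "contract X t = contract X' t'"
proof -
  have len: "2 \<le> length (branches Y u) \<and> contract Y u = Vertex (root_color u) (branches Y u)"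
    if "well_colored u" "\<not> is_leaf u \<and> labels u \<in> Y" for Y and u :: "'a diagram"
  proof -
    have i: "contract Y u = Vertex (root_color u) (inputs (contract Y u))"
      using that inputs_eq[of "contract Y u"] by simp
    moreover have "2 \<le> length (inputs (contract Y u))"
      using well_colored_contract[OF that(1), of Y] i well_colored_length by metis
    ultimately show ?thesis using that(2) by (simp add: branches_def)
  qed
  have single: "branches Y u = [contract Y u]" if "\<not> (\<not> is_leaf u \<and> labels u \<in> Y)" for Y and u :: "'a diagram"
    using that by (auto simp: branches_def)
  have "nonthin [root_color t] = nonthin [root_color t']"
    using nonthin_branches' assms by metis
  then have "root_color t = root_color t'" using assms by (auto split: if_splits)
  moreover have iff: "(\<not> is_leaf u \<and> labels u \<in> Y) \<longleftrightarrow> 2 \<le> length (branches Y u)"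
    if "well_colored u" for Y and u :: "'a diagram"
    by (cases "\<not> is_leaf u \<and> labels u \<in> Y") (use len[OF that, of Y] single[of u Y] in simp_all)
  moreover have "(\<not> is_leaf t \<and> labels t \<in> X) \<longleftrightarrow> (\<not> is_leaf t' \<and> labels t' \<in> X')"
    unfolding iff[OF assms(1)] iff[OF assms(3)] eq ..
  ultimately show ?thesis
    using len[OF assms(1), of X] len[OF assms(3), of X'] single[of t X] single[of t' X'] eq
    by (metis list.inject)
qed

text \<open>Reconstruction from the root outward: the input list of the contracted root splits in
  one way, and each part determines a contraction to which the induction hypothesis applies. The
  sets \<open>X\<close> and \<open>X'\<close> may differ.\<close>

lemma all_sign_unique:
  assumes "all_vertices_binary B" "well_colored B" "all_sign b X B"
    "all_vertices_binary B'" "well_colored B'" "all_sign b X' B'" "contract X B = contract X' B'"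
  shows "B = B'"
  using assms
proof (induction B arbitrary: B' rule: binary_induct)
  case (Leaf c a)
  then show ?case by (cases B') auto
next
  case (Vertex y s t)
  have "\<not> is_leaf B'" using Vertex.prems(6) by (metis contract_Vertex is_leaf.simps(2) is_leaf_contract)
  then obtain y' s' t' where B': "B' = Vertex y' [s', t']"
    using Vertex.prems(3) by (cases B') (auto simp: length_Suc_conv numeral_2_eq_2)
  have y: "y' = y" using Vertex.prems(6) by (simp add: B')
  have c: "corolla_type y [root_color s, root_color t]" "corolla_type y [root_color s', root_color t']"
    using Vertex.prems by (simp_all add: B' y)
  then have ne: "root_color s \<noteq> Empty" "root_color t \<noteq> Empty" "root_color s' \<noteq> Empty" "root_color t' \<noteq> Empty"
    by (auto simp: corolla_type_two)
  have "branches X s = branches X' s' \<and> branches X t = branches X' t'"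
  proof (rule split_unique)
    show "side_ok b False (root_color s) (branches X s)" "side_ok b True (root_color t) (branches X t)"
      "side_ok b False (root_color s') (branches X' s')" "side_ok b True (root_color t') (branches X' t')"
      using Vertex.hyps Vertex.prems ne by (auto intro!: side_ok_branches simp: B')
    show "arrange y (branches X s @ branches X t) = arrange y (branches X' s' @ branches X' t')"
      using Vertex.prems(6) by (simp add: B' y)
  qed (use c in auto)
  then have "contract X s = contract X' s'" "contract X t = contract X' t'"
    using branches_determine Vertex.prems ne by (auto simp: B')
  with Vertex.IH Vertex.prems show ?case by (auto simp: B' y)
qed

section \<open>Binary expansions and local moves\<close>

text \<open>The cut is made after the first input or, for an empty root, before the second thick
  one. Then each half is a single tree or the input list of an admissible vertex.\<close>

lemma branch_split:
  assumes "corolla_type y (map root_color ts)"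
  shows "\<exists>us vs c d. ts = us @ vs \<and> us \<noteq> [] \<and> vs \<noteq> [] \<and> corolla_type y [c, d] \<and>
     nonthin (map root_color us) = nonthin [c] \<and> nonthin (map root_color vs) = nonthin [d]"
proof -
  obtain t ts' where ts: "ts = t # ts'" "ts' \<noteq> []"
    using corolla_type_length[OF assms] by (cases ts rule: remdups_adj.cases) auto
  show ?thesis
  proof (cases y)
    case Thin
    with assms ts show ?thesis
      by (intro exI[of _ "[t]"] exI[of _ ts'] exI[of _ Thin]) (auto simp: corolla_type_iff split: if_splits)
  next
    case Thick
    show ?thesis
    proof (cases "root_color t = Thin")
      case True
      with assms ts Thick show ?thesis
        by (intro exI[of _ "[t]"] exI[of _ ts'] exI[of _ Thin] exI[of _ Thick]) (auto simp: corolla_type_iff)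
    next
      case False
      with assms ts Thick show ?thesis
        by (intro exI[of _ "[t]"] exI[of _ ts'] exI[of _ Thick] exI[of _ Thin]) (auto simp: corolla_type_iff)
    qed
  next
    case Empty
    then have t: "root_color t = Thick" "nonthin (map root_color ts') = [Thick]"
      using assms ts by (auto simp: corolla_type_iff)
    then have "Thick \<in> set (nonthin (map root_color ts'))" by simp
    then have "\<exists>u\<in>set ts'. root_color u = Thick" by (rule nonthin_mapD)
    from split_list_first_prop[OF this]
    obtain us n vs where s: "ts' = us @ n # vs" "root_color n = Thick" by blast
    then have "nonthin (map root_color us) @ Thick # nonthin (map root_color vs) = [Thick]"
      using t by simp
    then have "nonthin (map root_color us) = []" "nonthin (map root_color vs) = []"
      by (auto simp: append_eq_Cons_conv)
    then show ?thesis using s t Empty ts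
      by (intro exI[of _ "t # us"] exI[of _ "n # vs"] exI[of _ Thick]) (auto simp: corolla_type_iff)
  qed
qed

lemma proper_Vertex_iff:
  "proper (Vertex y ts) \<longleftrightarrow> corolla_type y (map root_color ts) \<and> (\<forall>t\<in>set ts. well_colored t) \<and>
     distinct (map fst (concat (map dfs_leaves ts)))"
  by (auto simp: proper_def)

lemma branches_not_in: "proper t \<Longrightarrow> X \<subseteq> set (edges t) \<Longrightarrow> branches X t = [contract X t]"
  using edges_psubset by (fastforce simp: branches_def)

text \<open>The induction is on the number of leaves and not on the tree: half of the inputs may be
  joined under a new vertex, which is no subtree of \<open>S\<close>.\<close>

lemma binary_expansion_exists:
  "proper S \<Longrightarrow> \<exists>B X. proper B \<and> all_vertices_binary B \<and> X \<subseteq> set (edges B) \<and> contract X B = S"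
proof (induction "num_leaves S" arbitrary: S rule: less_induct)
  case less
  show ?case
  proof (cases S)
    case (Leaf c a)
    then show ?thesis using less.prems by (intro exI[of _ S] exI[of _ "{}"]) auto
  next
    case (Vertex y ts)
    obtain us vs c d where s: "ts = us @ vs" "us \<noteq> []" "vs \<noteq> []" "corolla_type y [c, d]"
      "nonthin (map root_color us) = nonthin [c]" "nonthin (map root_color vs) = nonthin [d]"
      using branch_split[of y ts] less.prems Vertex by (auto simp: proper_Vertex_iff)
    have cd: "c \<noteq> Empty" "d \<noteq> Empty" using s(4) by (auto simp: corolla_type_two)
    have wc: "\<forall>t\<in>set ts. well_colored t" and dist: "distinct (map fst (concat (map dfs_leaves (us @ vs))))"
      using less.prems Vertex s by (auto simp: proper_Vertex_iff)
    have smaller: "sum_list (map num_leaves ws) < num_leaves S" if "ws = us \<or> ws = vs" for ws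
    proof -
      have "0 < sum_list (map num_leaves zs)" if "zs \<noteq> []" "set zs \<subseteq> set ts" for zs
        using that wc num_leaves_pos by (cases zs) force+
      with s have "0 < sum_list (map num_leaves us)" "0 < sum_list (map num_leaves vs)" by auto
      with that show ?thesis by (auto simp: Vertex num_leaves_Vertex s)
    qed
    \<comment> \<open>A half consisting of one tree is expanded as it is. A longer half is joined
      under a vertex of color \<open>e\<close>, and the edge below that vertex is contracted along
      with the others.\<close>
    have build: "\<exists>B X. proper B \<and> all_vertices_binary B \<and> X \<subseteq> branch_edges B \<and> branches X B = ws \<and>
       root_color B = e \<and> mset (dfs_leaves B) = mset (concat (map dfs_leaves ws))"
      if ws: "ws = us \<or> ws = vs" "nonthin (map root_color ws) = nonthin [e]" "e \<noteq> Empty" for ws e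
    proof -
      have ne: "ws \<noteq> []" and sub: "set ws \<subseteq> set ts" and dws: "distinct (map fst (concat (map dfs_leaves ws)))"
        using ws(1) s dist by auto
      show ?thesis
      proof (cases "length ws = 1")
        case True
        then obtain w where w: "ws = [w]" by (auto simp: length_Suc_conv)
        have "root_color w = e" using ws(2,3) w by (auto split: if_splits)
        have "proper w" using dws wc sub w by (auto simp: proper_def)
        moreover have "num_leaves w < num_leaves S" using smaller[OF ws(1)] w by simp
        ultimately obtain B X where B: "proper B" "all_vertices_binary B" "X \<subseteq> set (edges B)" "contract X B = w"
          using less.hyps by blast
        have "X \<subseteq> branch_edges B" using B(3) by (cases B) (auto simp: branch_edges_def)
        moreover have "mset (dfs_leaves B) = mset (dfs_leaves w)" "root_color B = root_color w"
          using mset_dfs_leaves_contract[of X B] root_color_contract[of X B] B(4) by auto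
        ultimately show ?thesis using B branches_not_in[OF B(1,3)] w \<open>root_color w = e\<close> by auto
      next
        case False
        then have len: "2 \<le> length ws" using ne by (cases ws) (auto simp: Suc_le_eq)
        have "corolla_type e (map root_color ws)"
          using ws(2,3) len by (cases e) (auto simp: corolla_type_iff)
        then have W: "proper (Vertex e ws)" using dws wc sub by (auto simp: proper_Vertex_iff)
        moreover have "num_leaves (Vertex e ws) < num_leaves S" using smaller[OF ws(1)] by (simp add: num_leaves_Vertex)
        ultimately obtain B X where B: "proper B" "all_vertices_binary B" "X \<subseteq> set (edges B)"
          "contract X B = Vertex e ws"
          using less.hyps by blast
        have nl: "\<not> is_leaf B" using is_leaf_contract[of X B] B(4) by simp
        have rc: "root_color B = e" and ms: "mset (dfs_leaves B) = mset (dfs_leaves (Vertex e ws))"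
          using root_color_contract[of X B] mset_dfs_leaves_contract[of X B] B(4) by simp_all
        \<comment> \<open>The edge below \<open>B\<close> is not an edge of \<open>B\<close>, so
          marking it has the sole effect that the parent splices in the inputs.\<close>
        have "labels B \<notin> set (edges B)" using edges_psubset[OF B(1)] by blast
        then have "contract (insert (labels B) X) B = contract X B"
          by (intro contract_cong) auto
        then have "branches (insert (labels B) X) B = ws" using nl B(4) by (simp add: branches_def)
        moreover have "insert (labels B) X \<subseteq> branch_edges B" using nl B(3) by (auto simp: branch_edges_def)
        ultimately show ?thesis using B rc ms by (intro exI[of _ B] exI[of _ "insert (labels B) X"]) simp
      qed
    qed
    obtain B1 X1 where B1: "proper B1" "all_vertices_binary B1" "X1 \<subseteq> branch_edges B1" "branches X1 B1 = us"
       "root_color B1 = c" "mset (dfs_leaves B1) = mset (concat (map dfs_leaves us))"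
      using build[of us c] s cd by auto
    obtain B2 X2 where B2: "proper B2" "all_vertices_binary B2" "X2 \<subseteq> branch_edges B2" "branches X2 B2 = vs"
       "root_color B2 = d" "mset (dfs_leaves B2) = mset (concat (map dfs_leaves vs))"
      using build[of vs d] s cd by auto
    let ?B = "Vertex y [B1, B2]"
    have "mset (map fst (dfs_leaves B1 @ dfs_leaves B2)) = mset (map fst (concat (map dfs_leaves (us @ vs))))"
      using B1(6) B2(6) by simp
    then have "distinct (map fst (dfs_leaves B1 @ dfs_leaves B2))"
      using dist mset_eq_imp_distinct_iff by blast
    then have B: "proper ?B" using B1 B2 s(4) by (auto simp: proper_Vertex_iff proper_def)
    have "labels B1 \<inter> labels B2 = {}" using proper_split[of y "[B1]" B2 "[]" B1] B by simp
    then have "branch_edges B1 \<inter> branch_edges B2 = {}"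
      using branch_edges_subset[of _ B1] branch_edges_subset[of _ B2] branch_edges_nonempty[of B1] B1(1)
      unfolding proper_def by (metis Int_greatest disjoint_iff subset_empty)
    then have "branches (X1 \<union> X2) B1 = us" "branches (X1 \<union> X2) B2 = vs"
      using branches_cong[of "X1 \<union> X2" B1 X1] branches_cong[of "X1 \<union> X2" B2 X2] B1(3,4) B2(3,4) by auto
    moreover have "arrange y ts = ts"
      using less.prems Vertex by (cases ts) (auto simp: arrange_def proper_Vertex_iff corolla_type_iff start_at_thick_id)
    ultimately have "contract (X1 \<union> X2) ?B = S" by (simp add: Vertex s)
    moreover have "X1 \<union> X2 \<subseteq> set (edges ?B)"
      using B1(3) B2(3) by (auto simp: set_edges_Vertex simp del: edges.simps)
    ultimately show ?thesis using B B1(2) B2(2) by (intro exI[of _ ?B] exI[of _ "X1 \<union> X2"]) simp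
  qed
qed

section \<open>Local moves\<close>

lemma move_root: "move B e B' e' \<Longrightarrow> root_color B' = root_color B \<and> \<not> is_leaf B \<and> \<not> is_leaf B'"
  by (induction rule: move.induct) auto

lemma move_dfs_leaves: "move B e B' e' \<Longrightarrow> mset (dfs_leaves B') = mset (dfs_leaves B)"
  by (induction rule: move.induct) auto

lemma move_labels: "move B e B' e' \<Longrightarrow> labels B' = labels B"
  by (metis move_dfs_leaves fst_dfs_leaves mset_eq_setD)

lemma move_num_leaves: "move B e B' e' \<Longrightarrow> num_leaves B' = num_leaves B"
  by (metis move_dfs_leaves num_leaves_def mset_eq_length)

lemma move_well_colored: "move B e B' e' \<Longrightarrow> well_colored B' = well_colored B"
  by (induction rule: move.induct) (auto simp: corolla_type_two move_root)

lemma move_proper: "move B e B' e' \<Longrightarrow> proper B' = proper B"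
  by (metis move_dfs_leaves move_well_colored proper_def distinct_names_mset)

lemma move_binary: "move B e B' e' \<Longrightarrow> all_vertices_binary B' = all_vertices_binary B"
  by (induction rule: move.induct) auto

lemma move_diagrams: "move B e B' e' \<Longrightarrow> (B' \<in> diagrams) = (B \<in> diagrams)"
  by (auto simp: diagrams_iff move_proper move_labels move_num_leaves move_root)

lemma move_edges: "move B e B' e' \<Longrightarrow> e \<in> set (edges B) \<and> e' \<in> set (edges B')"
proof (induction rule: move.induct)
  case (deeper t e t' e' y xs ys)
  then show ?case using move_root[OF deeper.hyps] by auto
qed (auto simp: Un_commute)

text \<open>Each of the two edges has two of the three inputs beyond it, and exactly one input is
  common to both; the inputs have disjoint nonempty leaf sets.\<close>

lemma move_crossing:
  "move B e B' e' \<Longrightarrow> proper B \<Longrightarrow> \<not> e \<subseteq> e' \<and> \<not> e' \<subseteq> e \<and> e \<inter> e' \<noteq> {}"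
proof (induction rule: move.induct)
  case (deeper t e t' e' y xs ys)
  then show ?case using proper_child by fastforce
next
  case (thin a b c)
  then show ?case using labels_nonempty[of a] labels_nonempty[of b] labels_nonempty[of c]
    by (auto simp: proper_def fst_dfs_leaves)
next
  case (thick_middle a m b)
  then show ?case using labels_nonempty[of a] labels_nonempty[of b] labels_nonempty[of m]
    by (auto simp: proper_def fst_dfs_leaves)
next
  case (thick_right a b m)
  then show ?case using labels_nonempty[of a] labels_nonempty[of b] labels_nonempty[of m]
    by (auto simp: proper_def fst_dfs_leaves)
next
  case (thick_left m a b)
  then show ?case using labels_nonempty[of a] labels_nonempty[of b] labels_nonempty[of m]
    by (auto simp: proper_def fst_dfs_leaves)
next
  case (inner_upper m a n)
  then show ?case using labels_nonempty[of a] labels_nonempty[of n] labels_nonempty[of m]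
    by (auto simp: proper_def fst_dfs_leaves)
next
  case (inner_lower m n a)
  then show ?case using labels_nonempty[of a] labels_nonempty[of n] labels_nonempty[of m]
    by (auto simp: proper_def fst_dfs_leaves)
qed

lemma move_new_edge: "move B e B' e' \<Longrightarrow> proper B \<Longrightarrow> e' \<notin> set (edges B) \<and> e \<notin> set (edges B')"
  using move_crossing[of B e B' e'] move_edges[of B e B' e'] edges_laminar[of B e e'] edges_laminar[of B' e e']
    move_proper[of B e B' e'] by blast

lemma branches_thin: "well_colored a \<Longrightarrow> root_color a = Thin \<Longrightarrow> u \<in> set (branches X a) \<Longrightarrow> root_color u \<noteq> Thick"
  using nonthin_branches'[of a X] by (auto simp: filter_empty_conv)

lemma branches_thick: "well_colored a \<Longrightarrow> root_color a = Thick \<Longrightarrow> \<exists>u\<in>set (branches X a). root_color u = Thick"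
proof -
  assume "well_colored a" "root_color a = Thick"
  then have "Thick \<in> set (nonthin (map root_color (branches X a)))" using nonthin_branches'[of a X] by simp
  then show ?thesis by (rule nonthin_mapD)
qed

text \<open>Both members of a pair contract to the same corolla. Only for \<open>inner_lower\<close>
  do the spliced input lists differ, by a cyclic shift that \<open>start_at_thick\<close>
  undoes.\<close>

lemma move_contract:
  "move B e B' e' \<Longrightarrow> well_colored B \<Longrightarrow> e \<in> X \<Longrightarrow> e' \<in> X \<Longrightarrow> contract X B = contract X B'"
proof (induction rule: move.induct)
  case (inner_lower m n a)
  have br: "branches X (Vertex Thick [n, a]) = branches X n @ branches X a"
    "branches X (Vertex Thick [a, m]) = branches X a @ branches X m"
    using inner_lower by (simp_all add: branches_Vertex)
  have "start_at_thick root_color (branches X a @ (branches X m @ branches X n)) =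
     start_at_thick root_color ((branches X m @ branches X n) @ branches X a)"
    by (rule start_at_thick_rotate)
      (use inner_lower branches_thin[of a] branches_thick[of m X] in auto)
  then show ?case by (simp add: br arrange_def)
next
  case (deeper t e t' e' y xs ys)
  have "contract X t = contract X t'" using deeper by simp
  then have "branches X t = branches X t'"
    using move_root[OF deeper.hyps] move_labels[OF deeper.hyps] by (simp add: branches_def)
  then show ?case by simp
qed (simp_all add: branches_Vertex)

text \<open>The colors around an edge admit only members of the six pairs, left ones for negative
  and right ones for positive edges. So an edge in \<open>X\<close> whose sign differs from
  \<open>b\<close> can be moved, upward if \<open>b\<close> holds and downward otherwise.\<close>

lemma move_exists:
  assumes "all_vertices_binary B" "well_colored B" "\<not> all_sign b X B"
  shows "\<exists>e\<in>X. \<exists>B' e'. if b then move B e B' e' else move B' e' B e"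
  using assms
proof (induction B rule: binary_induct)
  case (Vertex y s t)
  have ct: "corolla_type y [root_color s, root_color t]" using Vertex.prems by simp
  consider "\<not> all_sign b X s" | "\<not> all_sign b X t" | "\<not> sign_ok b X False s" | "\<not> sign_ok b X True t"
    using Vertex.prems by auto
  then show ?case
  proof cases
    case 1
    with Vertex obtain e B' e' where "e \<in> X" "if b then move s e B' e' else move B' e' s e" by auto
    with move.deeper[of s e B' e' y "[]" "[t]"] move.deeper[of B' e' s e y "[]" "[t]"] show ?thesis
      by (cases b) auto
  next
    case 2
    with Vertex obtain e B' e' where "e \<in> X" "if b then move t e B' e' else move B' e' t e" by auto
    with move.deeper[of t e B' e' y "[s]" "[]"] move.deeper[of B' e' t e y "[s]" "[]"] show ?thesis
      by (cases b) auto
  next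
    case 3
    then obtain z ss where s: "s = Vertex z ss" by (cases s) (auto simp: sign_ok_def)
    then obtain u v where uv: "ss = [u, v]" using Vertex.hyps(1) by (auto simp: length_Suc_conv numeral_2_eq_2)
    have X: "labels u \<union> labels v \<in> X" and p: "positive_branch False s \<noteq> b" using 3 by (auto simp: sign_ok_def s uv)
    have cs: "corolla_type z [root_color u, root_color v]" using Vertex.prems by (simp add: s uv)
    \<comment> \<open>A thin edge on the left is always negative, so the edge below \<open>s\<close>
      is positive only if it is thick and the vertex beyond it has its thick input on the
      right.\<close>
    have p: "b \<longleftrightarrow> \<not> (z = Thick \<and> root_color v = Thick)"
      using p ct cs by (auto simp: positive_branch_def s uv corolla_type_two)
    show ?thesis
    proof (cases b)
      case b: True
      have "\<exists>B' e'. move (Vertex y [Vertex z [u, v], t]) (labels u \<union> labels v) B' e'"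
      proof -
        consider "y = Thin" "z = Thin" "root_color u = Thin" "root_color v = Thin" "root_color t = Thin"
          | "y = Thick" "z = Thin" "root_color u = Thin" "root_color v = Thin" "root_color t = Thick"
          | "y = Thick" "z = Thick" "root_color u = Thick" "root_color v = Thin" "root_color t = Thin"
          | "y = Empty" "z = Thick" "root_color u = Thick" "root_color v = Thin" "root_color t = Thick"
          using ct cs p b by (auto simp: corolla_type_two s uv)
        then show ?thesis
        proof cases
          case 1
          then show ?thesis using thin[of u v t] by auto
        next
          case 2
          then show ?thesis using thick_right[of u v t] by auto
        next
          case 3
          then show ?thesis using thick_left[of u v t] by auto
        next
          case 4
          then show ?thesis using inner_upper[of u v t] by auto
        qed
      qed
      with X b show ?thesis by (auto simp: s uv)
    next
      case b: False
      have "\<exists>B' e'. move B' e' (Vertex y [Vertex z [u, v], t]) (labels u \<union> labels v)"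
      proof -
        consider "y = Thick" "z = Thick" "root_color u = Thin" "root_color v = Thick" "root_color t = Thin"
          | "y = Empty" "z = Thick" "root_color u = Thin" "root_color v = Thick" "root_color t = Thick"
          using ct cs p b by (auto simp: corolla_type_two s uv)
        then show ?thesis
        proof cases
          case 1
          then show ?thesis using thick_middle[of u v t] by auto
        next
          case 2
          then show ?thesis using inner_lower[of v t u] by auto
        qed
      qed
      with X b show ?thesis by (auto simp: s uv)
    qed
  next
    case 4
    then obtain z ts where t: "t = Vertex z ts" by (cases t) (auto simp: sign_ok_def)
    then obtain u v where uv: "ts = [u, v]" using Vertex.hyps(2) by (auto simp: length_Suc_conv numeral_2_eq_2)
    have X: "labels u \<union> labels v \<in> X" and p: "positive_branch True t \<noteq> b" using 4 by (auto simp: sign_ok_def t uv)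
    have cs: "corolla_type z [root_color u, root_color v]" using Vertex.prems by (simp add: t uv)
    \<comment> \<open>A thin edge on the right is always positive, so the edge below
      \<open>t\<close> is negative only if it is thick and the vertex beyond it has its thick input
      on the left.\<close>
    have p: "b \<longleftrightarrow> z = Thick \<and> root_color v = Thin"
      using p ct cs by (auto simp: positive_branch_def t uv corolla_type_two)
    show ?thesis
    proof (cases b)
      case b: True
      have "\<exists>B' e'. move (Vertex y [s, Vertex z [u, v]]) (labels u \<union> labels v) B' e'"
      proof -
        consider "y = Thick" "z = Thick" "root_color s = Thin" "root_color u = Thick" "root_color v = Thin"
          | "y = Empty" "z = Thick" "root_color s = Thick" "root_color u = Thick" "root_color v = Thin"
          using ct cs p b by (auto simp: corolla_type_two t uv)
        then show ?thesis
        proof cases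
          case 1
          then show ?thesis using thick_middle[of s u v] by auto
        next
          case 2
          then show ?thesis using inner_lower[of s u v] by auto
        qed
      qed
      with X b show ?thesis by (auto simp: t uv)
    next
      case b: False
      have "\<exists>B' e'. move B' e' (Vertex y [s, Vertex z [u, v]]) (labels u \<union> labels v)"
      proof -
        consider "y = Thin" "z = Thin" "root_color s = Thin" "root_color u = Thin" "root_color v = Thin"
          | "y = Thick" "z = Thick" "root_color s = Thin" "root_color u = Thin" "root_color v = Thick"
          | "y = Thick" "z = Thin" "root_color s = Thick" "root_color u = Thin" "root_color v = Thin"
          | "y = Empty" "z = Thick" "root_color s = Thick" "root_color u = Thin" "root_color v = Thick"
          using ct cs p b by (auto simp: corolla_type_two t uv)
        then show ?thesis
        proof cases
          case 1
          then show ?thesis using thin[of s u v] by auto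
        next
          case 2
          then show ?thesis using thick_right[of s u v] by auto
        next
          case 3
          then show ?thesis using thick_left[of s u v] by auto
        next
          case 4
          then show ?thesis using inner_upper[of s u v] by auto
        qed
      qed
      with X b show ?thesis by (auto simp: t uv)
    qed
  qed
qed simp

text \<open>
  The potential of a thin tree is the usual one for the Tamari order, the total number of leaves in
  left subtrees.  The number \<open>right_leaves\<close> of inputs to the right of the thick line enters because
  the moves at thick vertices carry an action of \<open>a\<close> past the actions on the right.
\<close>
fun right_leaves :: "'a diagram \<Rightarrow> nat" where
  "right_leaves (Vertex Thick [s, t]) =
     (if root_color s = Thick then right_leaves s + num_leaves t else right_leaves t)"
| "right_leaves D = 0"

fun potential :: "'a diagram \<Rightarrow> nat" where
  "potential (Vertex y [s, t]) = potential s + potential t +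
     (case y of Thin \<Rightarrow> num_leaves s
      | Thick \<Rightarrow> if root_color s = Thick then right_leaves s + num_leaves t + 1
                else num_leaves s * right_leaves t
      | Empty \<Rightarrow> right_leaves s * right_leaves t)"
| "potential D = 0"

text \<open>Besides its own potential, a subtree enters the potential of the whole through its root
  color, its number of leaves and its \<open>right_leaves\<close>. Their invariance carries a
  decrease deep inside over to the whole diagram.\<close>

lemma move_right_leaves:
  "move B e B' e' \<Longrightarrow> all_vertices_binary B \<Longrightarrow> right_leaves B' = right_leaves B"
proof (induction rule: move.induct)
  case (deeper t e t' e' y xs ys)
  then consider u where "xs = []" "ys = [u]" | u where "xs = [u]" "ys = []"
    by (cases xs; cases ys) auto
  then show ?case
    by cases (use deeper move_root[OF deeper.hyps] move_num_leaves[OF deeper.hyps] in \<open>cases y; simp\<close>)+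
qed (simp_all add: num_leaves_Vertex)

text \<open>With \<open>N\<close> for \<open>num_leaves\<close> and \<open>R\<close> for
  \<open>right_leaves\<close>, the six moves, in the order of the rules, lower the potential by
  \<open>N a\<close>, \<open>N a * N b\<close>, \<open>N a\<close>, \<open>R m + 1\<close>,
  \<open>R m + N a + 1\<close> and \<open>R n + N a + 1\<close>. The summand 1 in
  \<open>potential\<close> is there for \<open>thick_left\<close>, where \<open>R m\<close> may be
  zero.\<close>

lemma move_potential:
  "move B e B' e' \<Longrightarrow> all_vertices_binary B \<Longrightarrow> well_colored B \<Longrightarrow> potential B' < potential B"
proof (induction rule: move.induct)
  case (deeper t e t' e' y xs ys)
  then consider u where "xs = []" "ys = [u]" | u where "xs = [u]" "ys = []"
    by (cases xs; cases ys) auto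
  then show ?case
    by cases (use deeper move_root[OF deeper.hyps] move_num_leaves[OF deeper.hyps]
        move_right_leaves[OF deeper.hyps] in \<open>cases y; simp\<close>)+
next
  case (thin a b c)
  then show ?case using num_leaves_pos[of a] by (simp add: num_leaves_Vertex)
next
  case (thick_middle a m b)
  then show ?case using num_leaves_pos[of a] num_leaves_pos[of b] by (simp add: num_leaves_Vertex algebra_simps)
next
  case (thick_right a b m)
  then show ?case using num_leaves_pos[of a] by (simp add: num_leaves_Vertex algebra_simps)
qed (simp_all add: num_leaves_Vertex algebra_simps)

section \<open>Minimal and maximal expansions, standard orientations\<close>

text \<open>The contracted set is forced: since names survive contraction, it consists of the edges
  of \<open>B\<close> that are not edges of \<open>S\<close>.\<close>

lemma binary_expansions_iff:
  "B \<in> binary_expansions S \<longleftrightarrow>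
     B \<in> diagrams \<and> all_vertices_binary B \<and> contract (set (edges B) - set (edges S)) B = S"
proof
  assume "B \<in> binary_expansions S"
  then obtain X where "B \<in> diagrams" "all_vertices_binary B" "X \<subseteq> set (edges B)" "contract X B = S"
    by (auto simp: binary_expansions_def expansions_def binary_diagrams_def)
  moreover from this have "X = set (edges B) - set (edges S)" using set_edges_contract[of X B] by blast
  ultimately show "B \<in> diagrams \<and> all_vertices_binary B \<and> contract (set (edges B) - set (edges S)) B = S"
    by simp
qed (auto simp: binary_expansions_def expansions_def binary_diagrams_def)

lemma binary_expansionsI:
  assumes "B \<in> diagrams" "all_vertices_binary B" "contract X B = S"
  shows "B \<in> binary_expansions S"
proof -
  have "contract (X \<inter> set (edges B)) B = S" using assms(3) contract_cong[of "X \<inter> set (edges B)" B X] by simp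
  then show ?thesis using assms(1,2)
    by (auto simp: binary_expansions_def expansions_def binary_diagrams_def intro!: exI[of _ "X \<inter> set (edges B)"])
qed

lemma binary_expansionsD:
  assumes "B \<in> binary_expansions S"
  shows "B \<in> diagrams" "all_vertices_binary B" "proper B" "well_colored B"
    "leaf_order B = leaf_order S" "root_color B = root_color S" "num_leaves B = num_leaves S"
proof -
  let ?X = "set (edges B) - set (edges S)"
  show "B \<in> diagrams" and bin: "all_vertices_binary B" using assms by (auto simp: binary_expansions_iff)
  then show p: "proper B" and wc: "well_colored B" by (auto simp: diagrams_iff proper_def)
  have "contract ?X B = S" using assms by (simp add: binary_expansions_iff)
  then show "leaf_order B = leaf_order S" "root_color B = root_color S" "num_leaves B = num_leaves S"
    using leaf_order_contract[OF wc, of ?X] root_color_contract[of ?X B] num_leaves_contract[of ?X B] by simp_all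
qed

lemma finite_binary_expansions: "finite (binary_expansions S)"
  by (rule finite_subset[OF _ finite_leaf_order[of "leaf_order S"]]) (auto dest: binary_expansionsD)

lemma binary_expansions_nonempty:
  assumes "S \<in> diagrams" shows "\<exists>B. B \<in> binary_expansions S"
proof -
  obtain B X where B: "proper B" "all_vertices_binary B" "contract X B = S"
    using binary_expansion_exists[of S] assms by (auto simp: diagrams_iff)
  then have "labels B = labels S" "num_leaves B = num_leaves S" "is_leaf B = is_leaf S" by auto
  then have "B \<in> diagrams" using B(1) assms by (simp add: diagrams_iff)
  with B show ?thesis using binary_expansionsI by blast
qed

section \<open>Extremal expansions in both directions of the order\<close>

definition step :: "bool \<Rightarrow> 'a diagram \<Rightarrow> 'a diagram \<Rightarrow> bool" where
  "step b B B' \<longleftrightarrow> (\<exists>e e'. if b then move B e B' e' else move B' e' B e)"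

definition le_dir :: "bool \<Rightarrow> nat diagram \<Rightarrow> nat diagram \<Rightarrow> bool" where
  "le_dir b B B' \<longleftrightarrow> (if b then diagram_le B B' else diagram_le B' B)"

text \<open>Integer valued, since the potential is negated for descending steps; a step in either
  direction then lowers it.\<close>

definition potential_dir :: "bool \<Rightarrow> 'a diagram \<Rightarrow> int" where
  "potential_dir b B = (if b then int (potential B) else - int (potential B))"

lemma le_dir_refl [simp]: "le_dir b B B"
  by (simp add: le_dir_def diagram_le_def)

lemma le_dir_trans: "le_dir b A B \<Longrightarrow> le_dir b B C \<Longrightarrow> le_dir b A C"
  by (auto simp: le_dir_def diagram_le_def)

lemma le_dir_step: "step b B B' \<Longrightarrow> le_dir b B B'"
  using r_into_rtranclp[of "\<lambda>B B'. \<exists>e e'. move B e B' e'" B B']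
    r_into_rtranclp[of "\<lambda>B B'. \<exists>e e'. move B e B' e'" B' B]
  by (cases b) (auto simp: le_dir_def diagram_le_def step_def)

lemma step_potential:
  "step b B B' \<Longrightarrow> all_vertices_binary B \<Longrightarrow> well_colored B \<Longrightarrow> potential_dir b B' < potential_dir b B"
  using move_potential[of B _ B'] move_potential[of B' _ B] move_binary[of B' _ B] move_well_colored[of B' _ B]
  by (cases b) (auto simp: step_def potential_dir_def)

lemma diagram_le_potential:
  assumes "diagram_le B B'" "all_vertices_binary B" "well_colored B"
  shows "all_vertices_binary B' \<and> well_colored B' \<and> (B' = B \<or> potential B' < potential B)"
  using assms(1) unfolding diagram_le_def
proof (induction rule: rtranclp_induct)
  case (step C D)
  then obtain e e' where "move C e D e'" by blast
  with step.IH move_potential[of C e D e'] move_binary[of C e D e'] move_well_colored[of C e D e']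
  show ?case by auto
qed (use assms in auto)

lemma le_dir_antisym:
  assumes "le_dir b B B'" "le_dir b B' B" "all_vertices_binary B" "well_colored B"
  shows "B = B'"
proof -
  have "diagram_le B B'" "diagram_le B' B" using assms by (auto simp: le_dir_def split: if_splits)
  with diagram_le_potential[of B B'] diagram_le_potential[of B' B] assms(3,4) show ?thesis by auto
qed

text \<open>The move is made at a contracted edge, and its new edge is no edge of \<open>B\<close>.
  Adding the new edge to the contracted set thus changes nothing for \<open>B\<close>, while both
  diagrams have the same contraction along the enlarged set.\<close>

lemma step_in_expansions:
  assumes "B \<in> binary_expansions S" "\<not> all_sign b (set (edges B) - set (edges S)) B"
  shows "\<exists>B'\<in>binary_expansions S. step b B B'"
proof -
  let ?X = "set (edges B) - set (edges S)"
  have B: "B \<in> diagrams" "all_vertices_binary B" "contract ?X B = S" "proper B" "well_colored B"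
    using assms(1) by (auto simp: binary_expansions_iff diagrams_iff proper_def)
  obtain e B' e' where e: "e \<in> ?X" and m: "if b then move B e B' e' else move B' e' B e"
    using move_exists[OF B(2,5) assms(2)] by blast
  have B': "B' \<in> diagrams" "all_vertices_binary B'" "proper B'"
    using B m move_diagrams[of B e B' e'] move_diagrams[of B' e' B e] move_binary[of B e B' e']
      move_binary[of B' e' B e] move_proper[of B e B' e'] move_proper[of B' e' B e]
    by (auto split: if_splits)
  then have wc': "well_colored B'" by (simp add: proper_def)
  have new: "e' \<notin> set (edges B)" 
    using m B(4) B'(3) move_new_edge[of B e B' e'] move_new_edge[of B' e' B e] by (auto split: if_splits)
  have "contract (insert e' ?X) B = contract (insert e' ?X) B'"
    using m move_contract[of B e B' e' "insert e' ?X"] move_contract[of B' e' B e "insert e' ?X"] e B(5) wc'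
    by (auto split: if_splits)
  moreover have "contract (insert e' ?X) B = S" using B(3) contract_cong[of "insert e' ?X" B ?X] new by auto
  ultimately have "B' \<in> binary_expansions S" using binary_expansionsI B' by metis
  moreover have "step b B B'" unfolding step_def using m by blast
  ultimately show ?thesis by blast
qed

text \<open>A contracted edge of the wrong sign permits a step within the finite set of expansions,
  which lowers \<open>potential_dir\<close>; a minimizer among those reachable from \<open>B\<close>
  has no such edge.\<close>

lemma all_sign_reachable:
  assumes "B \<in> binary_expansions S"
  shows "\<exists>M\<in>binary_expansions S. all_sign b (set (edges M) - set (edges S)) M \<and> le_dir b B M"
proof -
  let ?R = "{M \<in> binary_expansions S. le_dir b B M}"
  have "finite ?R" "?R \<noteq> {}" using finite_binary_expansions assms by auto
  then obtain M where M: "M \<in> ?R" and min: "\<And>N. N \<in> ?R \<Longrightarrow> potential_dir b M \<le> potential_dir b N"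
    using ex_is_arg_min_if_finite[of ?R "potential_dir b"] by (auto simp: is_arg_min_linorder)
  have "all_sign b (set (edges M) - set (edges S)) M"
  proof (rule ccontr)
    assume "\<not> ?thesis"
    then obtain N where N: "N \<in> binary_expansions S" "step b M N" using step_in_expansions M by blast
    then have "N \<in> ?R" using M le_dir_step le_dir_trans by blast
    with min[of N] step_potential[OF N(2)] M binary_expansionsD show False by fastforce
  qed
  with M show ?thesis by blast
qed

lemma all_sign_expansion_unique:
  assumes "B \<in> binary_expansions S" "all_sign b X B" "contract X B = S"
    "B' \<in> binary_expansions S" "all_sign b X' B'" "contract X' B' = S"
  shows "B = B'"
  using assms binary_expansionsD all_sign_unique by metis

text \<open>The property under the description operators of \<open>D_max\<close> (for
  \<open>True\<close>) and \<open>D_min\<close> (for \<open>False\<close>).\<close>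

definition extremal :: "bool \<Rightarrow> nat diagram \<Rightarrow> nat diagram \<Rightarrow> bool" where
  "extremal b S M \<longleftrightarrow> M \<in> binary_expansions S \<and> (\<forall>B\<in>binary_expansions S. le_dir b M B \<longrightarrow> B = M)"

text \<open>An expansion beyond a correctly signed \<open>M\<close> can be continued to a correctly
  signed one. By uniqueness that is \<open>M\<close> again, and antisymmetry closes the loop.
  Conversely, an extremal expansion equals the correctly signed one reachable from it.\<close>

lemma extremal_iff:
  "extremal b S M \<longleftrightarrow> M \<in> binary_expansions S \<and> all_sign b (set (edges M) - set (edges S)) M"
proof
  assume "extremal b S M"
  then show "M \<in> binary_expansions S \<and> all_sign b (set (edges M) - set (edges S)) M"
    using all_sign_reachable by (metis extremal_def)
next
  assume M: "M \<in> binary_expansions S \<and> all_sign b (set (edges M) - set (edges S)) M"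
  have "B = M" if B: "B \<in> binary_expansions S" "le_dir b M B" for B
  proof -
    obtain N where N: "N \<in> binary_expansions S" "all_sign b (set (edges N) - set (edges S)) N" "le_dir b B N"
      using all_sign_reachable B by blast
    then have "N = M" using all_sign_expansion_unique M by (metis binary_expansions_iff)
    with N B le_dir_antisym[of b B M] binary_expansionsD[OF B(1)] show ?thesis by blast
  qed
  with M show "extremal b S M" by (simp add: extremal_def)
qed

lemma extremal_unique: "extremal b S M \<Longrightarrow> extremal b S N \<Longrightarrow> M = N"
  unfolding extremal_iff using all_sign_expansion_unique by (metis binary_expansions_iff)

lemma extremal_exists: "S \<in> diagrams \<Longrightarrow> \<exists>M. extremal b S M"
  using binary_expansions_nonempty all_sign_reachable unfolding extremal_iff by metis

lemma D_max_eq: "extremal True S M \<Longrightarrow> D_max S = M"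
  unfolding D_max_def
  by (rule the_equality) (auto simp: extremal_def le_dir_def intro: extremal_unique[of True S])

lemma D_min_eq: "extremal False S M \<Longrightarrow> D_min S = M"
  unfolding D_min_def
  by (rule the_equality) (auto simp: extremal_def le_dir_def intro: extremal_unique[of False S])

lemma D_max_extremal: "S \<in> diagrams \<Longrightarrow> extremal True S (D_max S)"
  using extremal_exists D_max_eq by metis

lemma D_min_extremal: "S \<in> diagrams \<Longrightarrow> extremal False S (D_min S)"
  using extremal_exists D_min_eq by metis

lemma contract_empty: "well_colored D \<Longrightarrow> contract {} D = D"
proof (induction D)
  case (Vertex y ts)
  have "concat (map (branches {}) ts) = ts"
    using Vertex by (simp add: branches_def cong: map_cong)
  moreover have "arrange y ts = ts"
    using Vertex.prems by (cases ts) (auto simp: arrange_def corolla_type_iff start_at_thick_id)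
  ultimately show ?case by simp
qed simp

lemma all_sign_empty: "all_vertices_binary D \<Longrightarrow> all_sign b {} D"
  by (induction D rule: binary_induct) (auto simp: sign_ok_def)

lemma D_min_binary: "B \<in> binary_diagrams \<Longrightarrow> D_min B = B"
  by (rule D_min_eq)
    (auto simp: extremal_iff binary_expansions_iff binary_diagrams_def diagrams_iff proper_def
      contract_empty all_sign_empty)

section \<open>Moves and extremal expansions under relabeling\<close>

lemma move_map: "move B e B' e' \<Longrightarrow> move (map_diagram f B) (f ` e) (map_diagram f B') (f ` e')"
proof (induction rule: move.induct)
  case (deeper t e t' e' y xs ys)
  then show ?case by (auto intro: move.deeper)
qed (auto simp: image_Un diagram.set_map[symmetric] intro: move.intros)

lemma diagram_le_map: "diagram_le B B' \<Longrightarrow> diagram_le (map_diagram f B) (map_diagram f B')"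
  unfolding diagram_le_def
  by (induction rule: rtranclp_induct) (auto intro: rtranclp.rtrancl_into_rtrancl move_map)

lemma diagrams_map:
  "f permutes {1..num_leaves D} \<Longrightarrow> D \<in> diagrams \<Longrightarrow> map_diagram f D \<in> diagrams"
  by (auto simp: diagrams_iff proper_map permutes_inj diagram.set_map permutes_image)

lemma extremal_map:
  assumes f: "f permutes {1..num_leaves S}" and M: "extremal b S M"
  shows "extremal b (map_diagram f S) (map_diagram f M)"
proof -
  have inj: "inj f" using f by (rule permutes_inj)
  have B: "M \<in> diagrams" "all_vertices_binary M" "contract (set (edges M) - set (edges S)) M = S"
    "all_sign b (set (edges M) - set (edges S)) M" "num_leaves M = num_leaves S"
    using M binary_expansionsD(7)[of M S] unfolding extremal_iff binary_expansions_iff by blast+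
  have e: "set (edges (map_diagram f M)) - set (edges (map_diagram f S)) =
      image f ` (set (edges M) - set (edges S))"
    using inj by (auto simp: edges_map image_set_diff inj_image_eq_iff)
  show ?thesis
    using B f by (simp add: extremal_iff binary_expansions_iff e contract_map all_sign_map inj diagrams_map)
qed

lemma D_max_map: "f permutes {1..num_leaves S} \<Longrightarrow> S \<in> diagrams \<Longrightarrow> D_max (map_diagram f S) = map_diagram f (D_max S)"
  using extremal_map D_max_extremal D_max_eq by metis

lemma D_min_map: "f permutes {1..num_leaves S} \<Longrightarrow> S \<in> diagrams \<Longrightarrow> D_min (map_diagram f S) = map_diagram f (D_min S)"
  using extremal_map D_min_extremal D_min_eq by metis

section \<open>Connectivity under local moves and standard orientations\<close>

definition move_connected :: "'a diagram \<Rightarrow> 'a diagram \<Rightarrow> bool" where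
  "move_connected = (\<lambda>B B'. \<exists>e e'. move B e B' e' \<or> move B' e' B e)\<^sup>*\<^sup>*"

lemma move_connected_refl [simp]: "move_connected B B"
  by (simp add: move_connected_def)

lemma move_connected_trans [trans]:
  "move_connected A B \<Longrightarrow> move_connected B C \<Longrightarrow> move_connected A C"
  by (simp add: move_connected_def)

lemma move_connected_sym: "move_connected A B \<Longrightarrow> move_connected B A"
  unfolding move_connected_def
  by (induction rule: rtranclp_induct) (auto intro: converse_rtranclp_into_rtranclp)

lemma move_connected_move: "move A e B e' \<Longrightarrow> move_connected A B"
  by (auto simp: move_connected_def)

lemma move_connected_move': "move A e B e' \<Longrightarrow> move_connected B A"
  by (auto simp: move_connected_def)

lemma move_connected_context:
  "move_connected t t' \<Longrightarrow> move_connected (Vertex y (xs @ t # ys)) (Vertex y (xs @ t' # ys))"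
  unfolding move_connected_def
proof (induction rule: rtranclp_induct)
  case (step t t')
  then obtain e e' where "move t e t' e' \<or> move t' e' t e" by blast
  then have "\<exists>e e'. move (Vertex y (xs @ t # ys)) e (Vertex y (xs @ t' # ys)) e' \<or>
     move (Vertex y (xs @ t' # ys)) e' (Vertex y (xs @ t # ys)) e" using move.deeper by metis
  with step.IH show ?case by (auto intro: rtranclp.rtrancl_into_rtrancl)
qed simp

lemma move_connected_left: "move_connected s s' \<Longrightarrow> move_connected (Vertex y [s, t]) (Vertex y [s', t])"
  using move_connected_context[of s s' y "[]" "[t]"] by simp

lemma move_connected_right: "move_connected t t' \<Longrightarrow> move_connected (Vertex y [s, t]) (Vertex y [s, t'])"
  using move_connected_context[of t t' y "[s]" "[]"] by simp

lemma root_color_right_comb [simp]: "as \<noteq> [] \<Longrightarrow> root_color (right_comb as) = Thin"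
  by (cases as rule: right_comb.cases) auto

lemma module_comb_Cons [simp]:
  "module_comb (a # as) m bs = Vertex Thick [Leaf Thin a, module_comb as m bs]"
  by (simp add: module_comb_def)

lemma root_color_module_comb [simp]: "root_color (module_comb as m bs) = Thick"
  by (cases as) (simp_all add: module_comb_def)

lemma right_comb_append:
  "as \<noteq> [] \<Longrightarrow> bs \<noteq> [] \<Longrightarrow> move_connected (Vertex Thin [right_comb as, right_comb bs]) (right_comb (as @ bs))"
proof (induction as rule: right_comb.induct)
  case (2 a)
  then show ?case by (cases bs) auto
next
  case (3 a a' as)
  have "move_connected (Vertex Thin [right_comb (a # a' # as), right_comb bs])
     (Vertex Thin [Leaf Thin a, Vertex Thin [right_comb (a' # as), right_comb bs]])"
    using 3 by (auto intro!: move_connected_move move.thin)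
  also have "move_connected \<dots> (Vertex Thin [Leaf Thin a, right_comb ((a' # as) @ bs)])"
    using 3 by (intro move_connected_right) simp
  finally show ?case by simp
qed simp

lemma thin_connected:
  "all_vertices_binary B \<Longrightarrow> well_colored B \<Longrightarrow> root_color B = Thin \<Longrightarrow>
   \<exists>as. as \<noteq> [] \<and> move_connected B (right_comb as)"
proof (induction B rule: binary_induct)
  case (Leaf c a)
  then show ?case by (intro exI[of _ "[a]"]) simp
next
  case (Vertex y s t)
  then obtain as bs where ne: "as \<noteq> []" "bs \<noteq> []"
    and st: "move_connected s (right_comb as)" "move_connected t (right_comb bs)"
    by (auto simp: corolla_type_two)
  have y: "y = Thin" using Vertex.prems by simp
  have "move_connected (Vertex y [s, t]) (Vertex y [right_comb as, t])"
    by (rule move_connected_left[OF st(1)])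
  also have "move_connected \<dots> (Vertex y [right_comb as, right_comb bs])"
    by (rule move_connected_right[OF st(2)])
  also have "move_connected \<dots> (right_comb (as @ bs))"
    unfolding y by (rule right_comb_append[OF ne])
  finally show ?case using ne by (intro exI[of _ "as @ bs"]) simp
qed

lemma left_action_connected:
  "as \<noteq> [] \<Longrightarrow> move_connected (Vertex Thick [right_comb as, module_comb as' m bs]) (module_comb (as @ as') m bs)"
proof (induction as rule: right_comb.induct)
  case (3 a a' as)
  have "move_connected (Vertex Thick [right_comb (a # a' # as), module_comb as' m bs])
     (Vertex Thick [Leaf Thin a, Vertex Thick [right_comb (a' # as), module_comb as' m bs]])"
    by (auto intro!: move_connected_move move.thick_right)
  also have "move_connected \<dots> (Vertex Thick [Leaf Thin a, module_comb ((a' # as) @ as') m bs])"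
    using 3 by (intro move_connected_right) simp
  finally show ?case by simp
qed simp_all

lemma right_action_connected:
  "cs \<noteq> [] \<Longrightarrow> move_connected (Vertex Thick [module_comb as m bs, right_comb cs]) (module_comb as m (bs @ cs))"
proof (induction as)
  case Nil
  show ?case
  proof (cases "bs = []")
    case False
    then have "move_connected (Vertex Thick [Vertex Thick [Leaf Thick m, right_comb bs], right_comb cs])
       (Vertex Thick [Leaf Thick m, Vertex Thin [right_comb bs, right_comb cs]])"
      using Nil by (auto intro!: move_connected_move move.thick_left)
    also have "move_connected \<dots> (Vertex Thick [Leaf Thick m, right_comb (bs @ cs)])"
      using False Nil by (intro move_connected_right right_comb_append)
    finally show ?thesis using False by (simp add: module_comb_def)
  qed (use Nil in \<open>simp add: module_comb_def\<close>)
next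
  case (Cons a as)
  have "move_connected (Vertex Thick [module_comb (a # as) m bs, right_comb cs])
     (Vertex Thick [Leaf Thin a, Vertex Thick [module_comb as m bs, right_comb cs]])"
    using Cons by (auto intro!: move_connected_move' move.thick_middle)
  also have "move_connected \<dots> (Vertex Thick [Leaf Thin a, module_comb as m (bs @ cs)])"
    using Cons by (intro move_connected_right) simp
  finally show ?case by simp
qed

text \<open>Left actions are moved outside and unfolded into single leaves, right actions are
  collected innermost into one right comb.\<close>

lemma thick_connected:
  "all_vertices_binary B \<Longrightarrow> well_colored B \<Longrightarrow> root_color B = Thick \<Longrightarrow>
   \<exists>as m bs. move_connected B (module_comb as m bs)"
proof (induction B rule: binary_induct)
  case (Leaf c a)
  then show ?case by (intro exI[of _ "[]"] exI[of _ a]) (simp add: module_comb_def)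
next
  case (Vertex y s t)
  have y: "y = Thick" using Vertex.prems by simp
  then consider "root_color s = Thin" "root_color t = Thick" | "root_color s = Thick" "root_color t = Thin"
    using Vertex.prems by (auto simp: corolla_type_two)
  then show ?case
  proof cases
    case 1
    obtain as where as: "as \<noteq> []" "move_connected s (right_comb as)"
      using thin_connected[of s] Vertex 1 by auto
    obtain as' m bs where m: "move_connected t (module_comb as' m bs)" using Vertex 1 by auto
    have "move_connected (Vertex y [s, t]) (Vertex y [right_comb as, t])"
      by (rule move_connected_left[OF as(2)])
    also have "move_connected \<dots> (Vertex y [right_comb as, module_comb as' m bs])"
      by (rule move_connected_right[OF m])
    also have "move_connected \<dots> (module_comb (as @ as') m bs)"
      unfolding y by (rule left_action_connected[OF as(1)])
    finally show ?thesis by blast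
  next
    case 2
    obtain cs where cs: "cs \<noteq> []" "move_connected t (right_comb cs)"
      using thin_connected[of t] Vertex 2 by auto
    obtain as m bs where m: "move_connected s (module_comb as m bs)" using Vertex 2 by auto
    have "move_connected (Vertex y [s, t]) (Vertex y [s, right_comb cs])"
      by (rule move_connected_right[OF cs(2)])
    also have "move_connected \<dots> (Vertex y [module_comb as m bs, right_comb cs])"
      by (rule move_connected_left[OF m])
    also have "move_connected \<dots> (module_comb as m (bs @ cs))"
      unfolding y by (rule right_action_connected[OF cs(1)])
    finally show ?thesis by blast
  qed
qed

text \<open>The outermost action on the left tree is handed over to the right tree, by
  \<open>inner_upper\<close> for an action from the right and by the inverse of
  \<open>inner_lower\<close> for one from the left, until only a leaf remains on the left. The right
  tree grows meanwhile, hence \<open>t\<close> is arbitrary in the induction.\<close>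

lemma inner_connected:
  "all_vertices_binary s \<Longrightarrow> well_colored s \<Longrightarrow> root_color s = Thick \<Longrightarrow>
   all_vertices_binary t \<Longrightarrow> well_colored t \<Longrightarrow> root_color t = Thick \<Longrightarrow>
   \<exists>m' as m bs. move_connected (Vertex Empty [s, t]) (Vertex Empty [Leaf Thick m', module_comb as m bs])"
proof (induction s arbitrary: t rule: binary_induct)
  case (Leaf c a)
  then obtain as m bs where "move_connected t (module_comb as m bs)" using thick_connected by blast
  then show ?case using move_connected_right Leaf.prems by (metis root_color.simps(1))
next
  case (Vertex y u v)
  have y: "y = Thick" using Vertex.prems by simp
  then consider "root_color u = Thin" "root_color v = Thick" | "root_color u = Thick" "root_color v = Thin"
    using Vertex.prems by (auto simp: corolla_type_two)
  then show ?case
  proof cases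
    case 1
    have "move_connected (Vertex Empty [Vertex Thick [u, v], t]) (Vertex Empty [v, Vertex Thick [t, u]])"
      using 1 Vertex.prems by (auto intro: move_connected_move' move.inner_lower)
    moreover have "\<exists>m' as m bs. move_connected (Vertex Empty [v, Vertex Thick [t, u]])
       (Vertex Empty [Leaf Thick m', module_comb as m bs])"
      using 1 Vertex by (intro Vertex.IH) (auto simp: corolla_type_two)
    ultimately show ?thesis using move_connected_trans unfolding y by blast
  next
    case 2
    have "move_connected (Vertex Empty [Vertex Thick [u, v], t]) (Vertex Empty [u, Vertex Thick [v, t]])"
      using 2 Vertex.prems by (auto intro: move_connected_move move.inner_upper)
    moreover have "\<exists>m' as m bs. move_connected (Vertex Empty [u, Vertex Thick [v, t]])
       (Vertex Empty [Leaf Thick m', module_comb as m bs])"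
      using 2 Vertex by (intro Vertex.IH) (auto simp: corolla_type_two)
    ultimately show ?thesis using move_connected_trans unfolding y by blast
  qed
qed

lemma move_connected_diagrams: "move_connected B B' \<Longrightarrow> B \<in> diagrams \<Longrightarrow> B' \<in> diagrams"
  unfolding move_connected_def
  by (induction rule: rtranclp_induct) (auto dest: move_diagrams)

text \<open>Guarantees that \<open>\<omega>_std\<close> chooses from a nonempty set; without a chain
  of moves from a reference diagram its sign would be unknown.\<close>

lemma reference_connected:
  assumes "B \<in> binary_diagrams" shows "\<exists>R\<in>reference_diagrams. move_connected R B"
proof -
  have B: "B \<in> diagrams" "all_vertices_binary B" "well_colored B" "\<not> is_leaf B"
    using assms by (auto simp: binary_diagrams_def diagrams_iff proper_def)
  have "\<exists>R\<in>{right_comb as |as. as \<noteq> []} \<union> {module_comb as m bs |as m bs. True} \<union>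
      {Vertex Empty [Leaf Thick m', module_comb as m bs] |m' as m bs. True}. move_connected B R"
  proof (cases "root_color B")
    case Empty
    then obtain ts where "B = Vertex Empty ts" using B(4) by (cases B) auto
    then obtain s t where st: "B = Vertex Empty [s, t]" using B(2) by (auto simp: length_Suc_conv numeral_2_eq_2)
    have "\<exists>m' as m bs. move_connected (Vertex Empty [s, t]) (Vertex Empty [Leaf Thick m', module_comb as m bs])"
      using B by (intro inner_connected) (auto simp: st corolla_type_two)
    then show ?thesis unfolding st by blast
  next
    case Thin
    with thin_connected[OF B(2,3)] show ?thesis by blast
  next
    case Thick
    with thick_connected[OF B(2,3)] show ?thesis by blast
  qed
  then show ?thesis
    using move_connected_diagrams B(1) move_connected_sym unfolding reference_diagrams_def by blast
qed

lemma std_orientation_sign: "std_orientation B \<omega> \<Longrightarrow> fst \<omega> \<in> {1, - 1}"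
  by (induction rule: std_orientation.induct) auto

lemma std_orientation_connected:
  "move_connected R B \<Longrightarrow> \<exists>\<omega>. std_orientation R \<omega> \<Longrightarrow> \<exists>\<omega>. std_orientation B \<omega>"
  unfolding move_connected_def
proof (induction rule: rtranclp_induct)
  case (step C D)
  then obtain \<epsilon> es e e' where "std_orientation C (\<epsilon>, es)" "move C e D e' \<or> move D e' C e" by auto
  then show ?case using std_orientation.up std_orientation.down by blast
qed

lemma fst_\<omega>_std: "B \<in> binary_diagrams \<Longrightarrow> fst (\<omega>_std B) \<in> {1, - 1}"
proof -
  assume "B \<in> binary_diagrams"
  then obtain R where "R \<in> reference_diagrams" "move_connected R B" using reference_connected by blast
  then have "\<exists>\<omega>. std_orientation B \<omega>" using std_orientation_connected std_orientation.reference by blast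
  then have "std_orientation B (\<omega>_std B)" unfolding \<omega>_std_def by (rule someI_ex)
  then show ?thesis by (rule std_orientation_sign)
qed

lemma fst_\<xi>: "B \<in> binary_diagrams \<Longrightarrow> fst (\<xi> B) \<in> {1, - 1}"
  using fst_\<omega>_std[of B] by (auto simp: \<xi>_def Let_def minus_one_power_iff)

lemma wedge_sign_unit: "wedge_sign xs ys \<in> {1, - 1}"
  by (auto simp: wedge_sign_def minus_one_power_iff)

lemma sign_mult: "(a::int) \<in> {1, - 1} \<Longrightarrow> b \<in> {1, - 1} \<Longrightarrow> a * b \<in> {1, - 1}"
  by auto

text \<open>The sign of a contraction is a product of four units for any lists of factors, so it is
  a unit whatever list the choice in \<open>\<omega>_SD\<close> returns.\<close>

lemma fst_\<omega>_SD:
  assumes "S \<in> diagrams" "fst \<omega> \<in> {1, - 1}"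
  shows "fst (\<omega>_SD S D \<omega>) \<in> {1, - 1}"
proof -
  have "D_max S \<in> binary_diagrams"
    using D_max_extremal[OF assms(1)] by (auto simp: extremal_def binary_expansions_def)
  note x = fst_\<xi>[OF this]
  obtain \<xi>' xs where xi: "\<xi> (D_max S) = (\<xi>', xs)" by (cases "\<xi> (D_max S)") auto
  have "(- 1 :: int) ^ n \<in> {1, - 1}" for n by (simp add: minus_one_power_iff)
  with x assms(2) wedge_sign_unit show ?thesis
    unfolding \<omega>_SD_def xi contraction.simps Let_def fst_conv by (intro sign_mult) auto
qed

section \<open>Modules with signed bases\<close>

abbreviation single :: "'b \<Rightarrow> 'r::zero \<Rightarrow> 'b \<Rightarrow>\<^sub>0 'r" where
  "single \<equiv> Poly_Mapping.single"

abbreviation lookup :: "('b \<Rightarrow>\<^sub>0 'r::zero) \<Rightarrow> 'b \<Rightarrow> 'r" where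
  "lookup \<equiv> Poly_Mapping.lookup"

text \<open>Signed sums of distinct basis vectors. The support and its finiteness are recorded
  explicitly because the zero ring is allowed, where neither can be read off from
  \<open>x\<close>.\<close>

definition signed :: "'b set \<Rightarrow> ('b \<Rightarrow>\<^sub>0 'r::comm_ring_1) \<Rightarrow> bool" where
  "signed A x \<longleftrightarrow> finite A \<and> (\<forall>a\<in>A. lookup x a = 1 \<or> lookup x a = - 1) \<and> (\<forall>a. a \<notin> A \<longrightarrow> lookup x a = 0)"

lemma lookup_smul [simp]: "lookup (smul r x) a = r * lookup x a"
  by (simp add: smul_def Poly_Mapping.map.rep_eq when_def)

lemma smul_single: "smul r (single a s) = single a (r * s)"
  by (rule poly_mapping_eqI) (simp add: lookup_single when_def)

lemma smul_one [simp]: "smul 1 x = x"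
  by (rule poly_mapping_eqI) simp

lemma smul_smul: "smul r (smul s x) = smul (r * s) x"
  by (rule poly_mapping_eqI) (simp add: mult.assoc)

lemma lookup_finite_sum: "lookup (sum f A) k = (\<Sum>a\<in>A. lookup (f a) k)"
  by (induction A rule: infinite_finite_induct) (auto simp: lookup_add)

lemma smul_sum: "smul r (sum f A) = (\<Sum>a\<in>A. smul r (f a))"
  by (rule poly_mapping_eqI) (simp add: lookup_finite_sum sum_distrib_left)

lemma signed_finite: "signed A x \<Longrightarrow> finite A"
  by (simp add: signed_def)

lemma signed_expand: "signed A x \<Longrightarrow> x = (\<Sum>a\<in>A. single a (lookup x a))"
  by (rule poly_mapping_eqI)
    (auto simp: signed_def lookup_finite_sum lookup_single when_def sum.delta' cong: if_cong)

lemma signed_zero: "signed {} 0"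
  by (simp add: signed_def)

lemma signed_single: "s = 1 \<or> s = - 1 \<Longrightarrow> signed {a} (single a s)"
  by (auto simp: signed_def lookup_single)

lemma of_int_sign: "s \<in> {1, - 1} \<Longrightarrow> (of_int s :: 'r::comm_ring_1) = 1 \<or> of_int s = (- 1 :: 'r)"
  by auto

lemma signed_smul: "signed A x \<Longrightarrow> s = 1 \<or> s = - 1 \<Longrightarrow> signed A (smul s x)"
  by (auto simp: signed_def)

lemma signed_Un: "signed A x \<Longrightarrow> signed B y \<Longrightarrow> A \<inter> B = {} \<Longrightarrow> signed (A \<union> B) (x + y)"
  unfolding signed_def lookup_add by (metis Un_iff add.left_neutral add.right_neutral disjoint_iff finite_UnI)

text \<open>Disjointness of the sets \<open>\<Phi> a\<close> excludes both cancellation and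
  coefficients other than units.\<close>

lemma signed_UN:
  assumes "finite A" "\<And>a. a \<in> A \<Longrightarrow> signed (\<Phi> a) (g a)"
    "\<And>a b. a \<in> A \<Longrightarrow> b \<in> A \<Longrightarrow> a \<noteq> b \<Longrightarrow> \<Phi> a \<inter> \<Phi> b = {}"
  shows "signed (\<Union>a\<in>A. \<Phi> a) (sum g A)"
  using assms
proof (induction A rule: finite_induct)
  case (insert a A)
  have "signed (\<Phi> a \<union> (\<Union>a\<in>A. \<Phi> a)) (g a + sum g A)"
  proof (rule signed_Un)
    show "\<Phi> a \<inter> (\<Union>a\<in>A. \<Phi> a) = {}" using insert.prems(2)[of a] insert.hyps by auto
  qed (use insert in auto)
  then show ?case using insert by simp
qed (simp add: signed_zero)

lemma signed_sum_points:
  assumes "finite A" "\<And>a. a \<in> A \<Longrightarrow> signed {a} (g a)" shows "signed A (sum g A)"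
  using signed_UN[of A "\<lambda>a. {a}" g] assms by auto

lemma linear_on_span_sum:
  assumes "linear_on_span B F" "finite A" "\<And>a. a \<in> A \<Longrightarrow> Poly_Mapping.keys (g a) \<subseteq> B"
  shows "F (sum g A) = (\<Sum>a\<in>A. F (g a))"
  using assms(2,3)
proof (induction A rule: finite_induct)
  case empty
  have "F (0 + 0) = F 0 + F 0" using assms(1) unfolding linear_on_span_def by (metis empty_subsetI keys_zero)
  then show ?case by simp
next
  case (insert a A)
  have "Poly_Mapping.keys (sum g A) \<subseteq> (\<Union>a\<in>A. Poly_Mapping.keys (g a))" by (rule keys_sum)
  then have "Poly_Mapping.keys (sum g A) \<subseteq> B" using insert.prems by blast
  then have "F (g a + sum g A) = F (g a) + F (sum g A)"
    using assms(1) insert.prems unfolding linear_on_span_def by blast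
  then show ?case using insert by simp
qed

lemma linear_on_span_single:
  fixes F :: "('b \<Rightarrow>\<^sub>0 'r::comm_ring_1) \<Rightarrow> 'd \<Rightarrow>\<^sub>0 'r"
  assumes "linear_on_span B F" "a \<in> B"
  shows "F (single a r) = smul r (F (single a 1))"
proof -
  have "Poly_Mapping.keys (single a (1::'r)) \<subseteq> B" using assms(2) by (simp add: keys_single)
  then have "F (smul r (single a 1)) = smul r (F (single a 1))"
    using assms(1) unfolding linear_on_span_def by blast
  then show ?thesis by (simp add: smul_single)
qed

lemma signed_linear:
  assumes F: "linear_on_span B F" and A: "A \<subseteq> B" "signed A x"
    and \<Phi>: "\<And>a. a \<in> A \<Longrightarrow> signed (\<Phi> a) (F (single a 1))"
      "\<And>a b. a \<in> A \<Longrightarrow> b \<in> A \<Longrightarrow> a \<noteq> b \<Longrightarrow> \<Phi> a \<inter> \<Phi> b = {}"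
  shows "signed (\<Union>a\<in>A. \<Phi> a) (F x)"
proof -
  have "F x = (\<Sum>a\<in>A. F (single a (lookup x a)))"
    using linear_on_span_sum[OF F signed_finite[OF A(2)], of "\<lambda>a. single a (lookup x a)"]
      signed_expand[OF A(2)] A(1) by (simp add: keys_single subset_iff)
  also have "\<dots> = (\<Sum>a\<in>A. smul (lookup x a) (F (single a 1)))"
    using linear_on_span_single[OF F] A(1) by (intro sum.cong) auto
  finally have Fx: "F x = \<dots>" .
  have "signed (\<Union>a\<in>A. \<Phi> a) (\<Sum>a\<in>A. smul (lookup x a) (F (single a 1)))"
    using A(2) \<Phi> by (intro signed_UN signed_smul) (auto simp: signed_def)
  then show ?thesis by (simp add: Fx)
qed

lemma linear_ext_superset:
  assumes "finite K" "Poly_Mapping.keys x \<subseteq> K"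
  shows "linear_ext f x = (\<Sum>a\<in>K. smul (lookup x a) (f a))"
  unfolding linear_ext_def
proof (rule sum.mono_neutral_left[OF assms])
  show "\<forall>i\<in>K - Poly_Mapping.keys x. smul (lookup x i) (f i) = 0"
    by (auto simp: in_keys_iff intro!: poly_mapping_eqI)
qed

lemma linear_ext_linear:
  fixes f :: "'a \<Rightarrow> 'd \<Rightarrow>\<^sub>0 'b::comm_ring_1"
  shows "linear_on_span B (linear_ext f)"
  unfolding linear_on_span_def
proof (intro conjI allI impI)
  fix x y :: "'a \<Rightarrow>\<^sub>0 'b"
  let ?K = "Poly_Mapping.keys x \<union> Poly_Mapping.keys y"
  have "Poly_Mapping.keys (x + y) \<subseteq> ?K" by (rule Poly_Mapping.keys_add)
  then show "linear_ext f (x + y) = linear_ext f x + linear_ext f y"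
    by (intro poly_mapping_eqI)
      (simp add: linear_ext_superset[of ?K] lookup_finite_sum lookup_add algebra_simps sum.distrib)
next
  fix r and x :: "'a \<Rightarrow>\<^sub>0 'b"
  have "Poly_Mapping.keys (smul r x) \<subseteq> Poly_Mapping.keys x" by (auto simp: in_keys_iff)
  then have "linear_ext f (smul r x) = (\<Sum>a\<in>Poly_Mapping.keys x. smul (lookup (smul r x) a) (f a))"
    by (intro linear_ext_superset) auto
  then show "linear_ext f (smul r x) = smul r (linear_ext f x)"
    by (simp add: linear_ext_def smul_sum smul_smul)
qed

lemma linear_ext_single [simp]: "linear_ext f (single a 1) = f a"
  using linear_ext_superset[of "{a}" "single a 1" f] by (simp add: keys_single)

lemma bilinear_ext_single:
  "bilinear_ext f (single a r) (single b s) = smul (r * s) (f a b)"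
  by (cases "r = 0"; cases "s = 0")
    (auto simp: bilinear_ext_def keys_single intro!: poly_mapping_eqI)

lemma bilinear_ext_zero: "bilinear_ext f 0 y = 0" "bilinear_ext f x 0 = 0"
  by (simp_all add: bilinear_ext_def)

lemma lookup_tensor: "lookup (tensor x y) (a, b) = lookup x a * lookup y b"
proof -
  have "lookup (tensor x y) (a, b) =
     (\<Sum>a'\<in>Poly_Mapping.keys x. \<Sum>b'\<in>Poly_Mapping.keys y. if a' = a \<and> b' = b then lookup x a' * lookup y b' else 0)"
    unfolding tensor_def bilinear_ext_def smul_single lookup_finite_sum
    by (intro sum.cong refl) (auto simp: lookup_single when_def)
  also have "\<dots> = (\<Sum>a'\<in>Poly_Mapping.keys x. if a' = a then (\<Sum>b'\<in>Poly_Mapping.keys y. if b' = b then lookup x a' * lookup y b' else 0) else 0)"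
    by (intro sum.cong refl) auto
  also have "\<dots> = lookup x a * lookup y b"
    by (auto simp: in_keys_iff)
  finally show ?thesis .
qed

lemma signed_tensor:
  fixes x :: "'b \<Rightarrow>\<^sub>0 'r::comm_ring_1"
  assumes a: "signed A x" "signed B y"
  shows "signed (A \<times> B) (tensor x y)"
proof -
  have "u * v = 1 \<or> u * v = - 1" if "u = 1 \<or> u = - 1" "v = 1 \<or> v = - 1" for u v :: 'r
    using that by auto
  moreover have "lookup x u * lookup y v = 0" if "u \<notin> A \<or> v \<notin> B" for u v
    using that a by (auto simp: signed_def)
  ultimately show ?thesis using a unfolding signed_def by (simp add: lookup_tensor)
qed

section \<open>Generators and symmetric group actions up to sign\<close>

lemma signed_gen_C: "fst \<omega> \<in> {1, - 1} \<Longrightarrow> signed {D} (gen_C D \<omega>)"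
  unfolding gen_C_def by (intro signed_single of_int_sign sign_mult wedge_sign_unit)

lemma signed_gen_Q: "fst \<omega> \<in> {1, - 1} \<Longrightarrow> signed {(D, G)} (gen_Q D G \<omega>)"
  unfolding gen_Q_def by (intro signed_single of_int_sign sign_mult wedge_sign_unit)

lemma sign_unit: "sign f \<in> {1, - 1}"
  by (simp add: sign_def)

text \<open>The action of \<open>\<sigma>\<close> relabels by the inverse of
  \<open>\<sigma>\<close>, so relabeling by \<open>f\<close> is the action of \<open>inv f\<close>.
  Distinct diagrams stay distinct since \<open>f\<close> is injective.\<close>

lemma signed_act_C:
  assumes "f permutes {1..n}" "signed A x"
  shows "signed (map_diagram f ` A) (act_C (inv f) x)"
proof -
  have inj: "inj (map_diagram f)" using permutes_inj[OF assms(1)] by (rule diagram.inj_map)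
  have ii: "inv (inv f) = f" using permutes_bij[OF assms(1)] by (rule inv_inv_eq)
  have "signed (\<Union>D\<in>A. {map_diagram f D}) (act_C (inv f) x)"
    unfolding act_C_def
  proof (rule signed_linear[OF linear_ext_linear subset_UNIV assms(2)])
    fix D
    show "signed {map_diagram f D} (linear_ext (\<lambda>D. gen_C (map_diagram (inv (inv f)) D)
       (sign (inv f), map ((`) (inv (inv f))) (edges D))) (single D 1))"
      by (simp add: ii del: insert_iff) (rule signed_gen_C, simp add: sign_unit del: insert_iff)
  qed (use inj in \<open>auto dest: injD\<close>)
  then show ?thesis by (simp only: UNION_singleton_eq_range)
qed

lemma signed_act_Q:
  assumes "f permutes {1..n}" "signed A x"
  shows "signed ((\<lambda>(D, G). (map_diagram f D, image f ` G)) ` A) (act_Q (inv f) x)"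
proof -
  have f: "inj f" using permutes_inj[OF assms(1)] .
  have inj: "inj (map_diagram f)" using f by (rule diagram.inj_map)
  have inj2: "image f ` G = image f ` H \<Longrightarrow> G = H" for G H
    using f by (metis inj_image_eq_iff inj_on_image_eq_iff injI)
  have ii: "inv (inv f) = f" using permutes_bij[OF assms(1)] by (rule inv_inv_eq)
  have "signed (\<Union>d\<in>A. {(\<lambda>(D, G). (map_diagram f D, image f ` G)) d}) (act_Q (inv f) x)"
    unfolding act_Q_def
  proof (rule signed_linear[OF linear_ext_linear subset_UNIV assms(2)])
    fix d :: "nat diagram \<times> edge set"
    obtain D G where "d = (D, G)" by (cases d) auto
    then show "signed {(\<lambda>(D, G). (map_diagram f D, image f ` G)) d}
       (linear_ext (\<lambda>(D, G). gen_Q (map_diagram (inv (inv f)) D) ((`) (inv (inv f)) ` G)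
       (1, map ((`) (inv (inv f))) (metric_edges D G))) (single d 1))"
      by (simp add: ii) (rule signed_gen_Q, simp)
  qed (use inj inj2 in \<open>auto dest: injD\<close>)
  then show ?thesis by (simp add: UNION_singleton_eq_range)
qed

lemma length_fst_coloring [simp]: "length (fst (coloring D)) = num_leaves D"
  by (simp add: coloring_def)

lemma single_component_C:
  "labeled D \<Longrightarrow> single D 1 \<in> component basis_C coloring (coloring D)"
  by (simp add: component_def keys_single basis_C_def)

lemma single_component_Q:
  "labeled D \<Longrightarrow> G \<subseteq> set (edges D) \<Longrightarrow>
   single (D, G) 1 \<in> component basis_Q coloring_Q (coloring D)"
  by (simp add: component_def keys_single basis_Q_def coloring_Q_def)

lemma signed_singletonE:
  assumes "signed {a} x" obtains s where "x = single a s" "s = 1 \<or> s = - 1"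
  using signed_expand[OF assms] assms by (auto simp: signed_def)

text \<open>Relabelings and compositions produce the wanted basis vector only up to a sign
  \<open>s\<close>. As \<open>s * s = 1\<close>, scaling by \<open>s\<close> once more removes it
  without changing the support.\<close>

lemma signed_rescale:
  assumes "linear_on_span B F" "a \<in> B" "s = 1 \<or> s = - 1" "signed A (F (single a s))"
  shows "signed A (F (single a 1))"
proof -
  have "smul s (smul s (F (single a 1))) = F (single a 1)"
    using assms(3) by (auto simp: smul_smul)
  then show ?thesis
    using signed_smul[OF assms(4,3)] linear_on_span_single[OF assms(1,2), of s] by simp
qed

lemma labeled_map: "f permutes {1..num_leaves D} \<Longrightarrow> labeled D \<Longrightarrow> labeled (map_diagram f D)"
  using proper_map[OF permutes_inj, of f "{1..num_leaves D}" D]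
  by (simp add: labeled_def proper_def diagram.set_map permutes_image)

section \<open>Values of \<open>p\<close> on fully metric generators and of \<open>q\<close> on
  corollas\<close>

lemma p_equivariant:
  fixes p :: "'r::comm_ring_1 Q \<Rightarrow> 'r C"
  assumes p: "is_p p" and D: "labeled D" "G \<subseteq> set (edges D)" and f: "f permutes {1..num_leaves D}"
    and A: "signed A (p (single (D, G) 1))"
  shows "signed (map_diagram f ` A) (p (single (map_diagram f D, image f ` G) 1))"
proof -
  let ?b = "(map_diagram f D, image f ` G)"
  have lin: "linear_on_span basis_Q p" using p by (simp add: is_p_def operad_map_Q_C_def)
  have b: "?b \<in> basis_Q" using D f labeled_map by (auto simp: basis_Q_def edges_map)
  have "signed {?b} (act_Q (inv f) (single (D, G) (1::'r)))"
    using signed_act_Q[OF f, of "{(D, G)}" "single (D, G) (1::'r)"] signed_single[of "1::'r" "(D, G)"] by simp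
  then obtain s :: 'r where s: "act_Q (inv f) (single (D, G) 1) = single ?b s" "s = 1 \<or> s = - 1"
    by (rule signed_singletonE)
  have "p (act_Q (inv f) (single (D, G) 1)) = act_C (inv f) (p (single (D, G) 1))"
  proof -
    have "\<forall>xs y \<sigma>. \<forall>x\<in>component basis_Q coloring_Q (xs, y).
        \<sigma> permutes {1..length xs} \<longrightarrow> p (act_Q \<sigma> x) = act_C \<sigma> (p x)"
      using p unfolding is_p_def operad_map_Q_C_def by blast
    from bspec[OF this[THEN spec, THEN spec, THEN spec, of "fst (coloring D)" "snd (coloring D)" "inv f"],
        of "single (D, G) 1"]
    show ?thesis using single_component_Q[OF D] permutes_inv[OF f] by simp
  qed
  then have "signed (map_diagram f ` A) (p (single ?b s))"
    using signed_act_C[OF f A] s(1) by simp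
  with signed_rescale[OF lin b s(2)] show ?thesis .
qed

lemma q_equivariant:
  fixes q :: "'r::comm_ring_1 C \<Rightarrow> 'r Q"
  assumes q: "is_q q" and D: "labeled D" and f: "f permutes {1..num_leaves D}"
    and A: "signed A (q (single D 1))"
  shows "signed ((\<lambda>(B, G). (map_diagram f B, image f ` G)) ` A) (q (single (map_diagram f D) 1))"
proof -
  let ?b = "map_diagram f D"
  have lin: "linear_on_span basis_C q" using q by (simp add: is_q_def operad_map_C_Q_def)
  have b: "?b \<in> basis_C" using D f labeled_map by (auto simp: basis_C_def)
  have "signed {?b} (act_C (inv f) (single D (1::'r)))"
    using signed_act_C[OF f, of "{D}" "single D (1::'r)"] signed_single[of "1::'r" D] by simp
  then obtain s :: 'r where s: "act_C (inv f) (single D 1) = single ?b s" "s = 1 \<or> s = - 1"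
    by (rule signed_singletonE)
  have "q (act_C (inv f) (single D 1)) = act_Q (inv f) (q (single D 1))"
  proof -
    have "\<forall>xs y \<sigma>. \<forall>x\<in>component basis_C coloring (xs, y).
        \<sigma> permutes {1..length xs} \<longrightarrow> q (act_C \<sigma> x) = act_Q \<sigma> (q x)"
      using q unfolding is_q_def operad_map_C_Q_def by blast
    from bspec[OF this[THEN spec, THEN spec, THEN spec, of "fst (coloring D)" "snd (coloring D)" "inv f"],
        of "single D 1"]
    show ?thesis using single_component_C[OF D] permutes_inv[OF f] by simp
  qed
  then have "signed ((\<lambda>(B, G). (map_diagram f B, image f ` G)) ` A) (q (single ?b s))"
    using signed_act_Q[OF f A] s(1) by simp
  with signed_rescale[OF lin b s(2)] show ?thesis .
qed

lemma permutation_of_lists: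
  assumes "distinct xs" "distinct ys" "set xs = set ys"
  shows "\<exists>f. f permutes set xs \<and> map f xs = ys"
proof -
  define f where "f = (\<lambda>a. if a \<in> set xs then the (map_of (zip xs ys) a) else a)"
  have len: "length xs = length ys" using assms by (metis distinct_card)
  then have "f (xs ! i) = ys ! i" if "i < length xs" for i
    using that assms(1) map_of_zip_nth[of xs ys i] by (simp add: f_def)
  then have m: "map f xs = ys" using len by (intro nth_equalityI) auto
  have "f ` set xs = set xs" using arg_cong[OF m, of set] assms(3) by simp
  moreover have "inj_on f (set xs)" using assms(2) unfolding m[symmetric] by (simp add: distinct_map)
  ultimately have "bij_betw f (set xs) (set xs)" by (simp add: bij_betw_def)
  then have "f permutes set xs" by (rule bij_imp_permutes) (simp add: f_def)
  with m show ?thesis by blast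
qed

text \<open>\<open>is_p\<close> and \<open>is_q\<close> prescribe values for canonical labelings
  only; other generators are relabeled canonically, evaluated and relabeled back.\<close>

lemma canonical_relabeling:
  assumes "D \<in> diagrams"
  shows "\<exists>f. f permutes {1..num_leaves D} \<and> canonical (map_diagram f D)"
proof -
  let ?xs = "map fst (leaf_order D)"
  have ps: "proper D" "labels D = {1..num_leaves D}" using assms by (auto simp: diagrams_iff)
  have "mset ?xs = mset (map fst (dfs_leaves D))" by simp
  then have d: "distinct ?xs" using ps by (metis mset_eq_imp_distinct_iff proper_def)
  have s: "set ?xs = {1..num_leaves D}" using ps by (simp add: fst_dfs_leaves)
  then have "set ?xs = set [1..<Suc (num_leaves D)]" by auto
  from permutation_of_lists[OF d _ this]
  obtain f where f: "f permutes set ?xs" "map f ?xs = [1..<Suc (num_leaves D)]"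
    using distinct_upt by blast
  have "map fst (leaf_order (map_diagram f D)) = map f ?xs" by (simp add: leaf_order_map)
  with f s show ?thesis by (auto simp: canonical_def)
qed

text \<open>The index set in \<open>is_p\<close> with \<open>canonical\<close> and
  \<open>coloring\<close> replaced by leaf order and root color, so that it makes sense for every
  labeling and commutes with relabeling.\<close>

definition p_support :: "nat diagram \<Rightarrow> nat diagram set" where
  "p_support D = {S \<in> diagrams. leaf_order S = leaf_order D \<and> root_color S = root_color D \<and>
     degree S = length (edges D) \<and> diagram_le (D_max S) (D_min D)}"

lemma labeled_diagrams: "D \<in> diagrams \<Longrightarrow> labeled D"
  by (simp add: diagrams_def)

lemma p_support_map:
  assumes "D \<in> diagrams" "f permutes {1..num_leaves D}"
  shows "map_diagram f ` p_support D \<subseteq> p_support (map_diagram f D)"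
proof
  fix T assume "T \<in> map_diagram f ` p_support D"
  then obtain S where S: "T = map_diagram f S" "S \<in> p_support D" by blast
  then have n: "num_leaves S = num_leaves D" by (metis (mono_tags, lifting) length_leaf_order mem_Collect_eq p_support_def)
  have "S \<in> diagrams" using S by (simp add: p_support_def)
  with S n assms show "T \<in> p_support (map_diagram f D)"
    by (simp add: p_support_def leaf_order_map diagrams_map D_max_map D_min_map diagram_le_map degree_def edges_map)
qed

lemma map_diagram_inv: "f permutes A \<Longrightarrow> map_diagram (inv f) (map_diagram f D) = D"
  by (simp add: diagram.map_comp permutes_inv_o diagram.map_id)

lemma p_support_map_eq:
  assumes "D \<in> diagrams" "f permutes {1..num_leaves D}"
  shows "map_diagram f ` p_support D = p_support (map_diagram f D)"
proof
  show "map_diagram f ` p_support D \<subseteq> p_support (map_diagram f D)" using p_support_map[OF assms] .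
  have f': "inv f permutes {1..num_leaves D}" using assms(2) by (rule permutes_inv)
  show "p_support (map_diagram f D) \<subseteq> map_diagram f ` p_support D"
  proof
    fix T assume "T \<in> p_support (map_diagram f D)"
    then have "map_diagram (inv f) T \<in> p_support (map_diagram (inv f) (map_diagram f D))"
      using p_support_map[of "map_diagram f D" "inv f"] assms f' diagrams_map by auto
    then have "map_diagram (inv f) T \<in> p_support D" using map_diagram_inv[OF assms(2)] by simp
    moreover have "map_diagram f (map_diagram (inv f) T) = T"
      using assms(2) by (simp add: diagram.map_comp permutes_inv_o diagram.map_id)
    ultimately show "T \<in> map_diagram f ` p_support D" by (metis imageI)
  qed
qed

lemma p_fully_metric_canonical:
  fixes p :: "'r::comm_ring_1 Q \<Rightarrow> 'r C"
  assumes p: "is_p p" and D: "D \<in> diagrams" "canonical D"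
  shows "signed (p_support D) (p (single (D, set (edges D)) 1))"
proof -
  let ?\<omega> = "(1, edges D) :: orientation"
  have lin: "linear_on_span basis_Q p" using p by (simp add: is_p_def operad_map_Q_C_def)
  have "orientation_on (set (edges D)) ?\<omega>" using distinct_edges D by (auto simp: orientation_on_def diagrams_iff)
  then have "p (gen_Q D (set (edges D)) ?\<omega>) =
        (\<Sum>S | S \<in> diagrams \<and> canonical S \<and> coloring S = coloring D \<and>
              degree S = length (edges D) \<and> diagram_le (D_max S) (D_min D). gen_C S (\<omega>_SD S D ?\<omega>))"
    using p D unfolding is_p_def by blast
  also have "{S \<in> diagrams. canonical S \<and> coloring S = coloring D \<and>
      degree S = length (edges D) \<and> diagram_le (D_max S) (D_min D)} = p_support D"
    using canonical_same_coloring_iff[OF D] unfolding p_support_def by blast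
  finally have e: "p (gen_Q D (set (edges D)) ?\<omega>) = (\<Sum>S\<in>p_support D. gen_C S (\<omega>_SD S D ?\<omega>))" .
  have fin: "finite (p_support D)"
    by (rule finite_subset[OF _ finite_leaf_order[of "leaf_order D"]]) (auto simp: p_support_def)
  have s: "signed (p_support D) (p (gen_Q D (set (edges D)) ?\<omega>))"
    unfolding e using fin by (intro signed_sum_points signed_gen_C fst_\<omega>_SD) (auto simp: p_support_def)
  have "signed {(D, set (edges D))} (gen_Q D (set (edges D)) ?\<omega> :: 'r Q)" by (rule signed_gen_Q) simp
  then obtain r where r: "(gen_Q D (set (edges D)) ?\<omega> :: 'r Q) = single (D, set (edges D)) r" "r = 1 \<or> r = - 1"
    by (rule signed_singletonE)
  have "(D, set (edges D)) \<in> basis_Q" using D by (simp add: basis_Q_def labeled_diagrams)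
  from signed_rescale[OF lin this r(2)] s r(1) show ?thesis by simp
qed

lemma p_fully_metric:
  assumes p: "is_p p" and D: "D \<in> diagrams"
  shows "signed (p_support D) (p (single (D, set (edges D)) 1))"
proof -
  obtain f where f: "f permutes {1..num_leaves D}" "canonical (map_diagram f D)"
    using canonical_relabeling[OF D] by blast
  let ?D = "map_diagram f D"
  have f': "inv f permutes {1..num_leaves ?D}" using f(1) permutes_inv by simp
  have D': "?D \<in> diagrams" using diagrams_map f D by blast
  have "signed (map_diagram (inv f) ` p_support ?D)
     (p (single (map_diagram (inv f) ?D, image (inv f) ` set (edges ?D)) 1))"
    by (rule p_equivariant[OF p labeled_diagrams[OF D'] _ f' p_fully_metric_canonical[OF p D' f(2)]]) simp
  moreover have "image (inv f) ` set (edges ?D) = set (edges D)"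
    using permutes_inverses(2)[OF f(1)] by (simp add: edges_map image_image)
  ultimately show ?thesis
    using p_support_map_eq[OF D' f'] map_diagram_inv[OF f(1)] by simp
qed

definition full :: "nat diagram \<Rightarrow> nat diagram \<times> edge set" where
  "full B = (B, set (edges B))"

lemma binary_expansions_map:
  assumes "f permutes {1..num_leaves S}" "B \<in> binary_expansions S"
  shows "map_diagram f B \<in> binary_expansions (map_diagram f S)"
proof (rule binary_expansionsI)
  have B: "B \<in> diagrams" "all_vertices_binary B" "num_leaves B = num_leaves S"
    using binary_expansionsD[OF assms(2)] by auto
  then show "map_diagram f B \<in> diagrams" "all_vertices_binary (map_diagram f B)"
    using diagrams_map assms(1) by auto
  show "contract (image f ` (set (edges B) - set (edges S))) (map_diagram f B) = map_diagram f S"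
    using assms by (simp add: contract_map permutes_inj binary_expansions_iff)
qed

lemma corollas_map: "c \<in> corollas \<Longrightarrow> f permutes {1..num_leaves c} \<Longrightarrow> map_diagram f c \<in> corollas"
  by (simp add: corollas_def diagrams_map edges_map)

lemma q_corolla_canonical:
  fixes q :: "'r::comm_ring_1 C \<Rightarrow> 'r Q"
  assumes q: "is_q q" and c: "c \<in> corollas" "canonical c"
  shows "signed (full ` binary_expansions c) (q (single c 1))"
proof -
  have cd: "c \<in> diagrams" "edges c = []" using c(1) by (auto simp: corollas_def)
  have "(gen_C c (1, []) :: 'r C) = single c 1"
    by (simp add: gen_C_def wedge_sign_def)
  moreover have "{B. B \<in> binary_expansions c \<and> canonical B \<and> coloring B = coloring c} = binary_expansions c"
    using canonical_same_coloring_iff[OF cd(1) c(2)] binary_expansionsD by blast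
  moreover have "q (gen_C c (1, [])) =
      (\<Sum>B | B \<in> binary_expansions c \<and> canonical B \<and> coloring B = coloring c.
         gen_Q B (set (edges B)) (\<omega>_std B))"
    using q c unfolding is_q_def by blast
  ultimately have e: "q (single c 1) =
      (\<Sum>B\<in>binary_expansions c. gen_Q B (set (edges B)) (\<omega>_std B))" by simp
  have "signed (\<Union>B\<in>binary_expansions c. {full B}) (q (single c 1))"
    unfolding e full_def using finite_binary_expansions
    by (intro signed_UN signed_gen_Q fst_\<omega>_std) (auto simp: binary_expansions_def)
  then show ?thesis by (simp add: UNION_singleton_eq_range)
qed

lemma q_corolla:
  assumes q: "is_q q" and c: "c \<in> corollas"
  shows "signed (full ` binary_expansions c) (q (single c 1))"
proof -
  have cd: "c \<in> diagrams" using c by (simp add: corollas_def)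
  obtain f where f: "f permutes {1..num_leaves c}" "canonical (map_diagram f c)"
    using canonical_relabeling[OF cd] by blast
  let ?c = "map_diagram f c" and ?g = "inv f"
  have f': "?g permutes {1..num_leaves ?c}" using f(1) permutes_inv by simp
  have c': "?c \<in> corollas" using corollas_map c f by blast
  have "labeled ?c" using c' labeled_diagrams by (simp add: corollas_def)
  from q_equivariant[OF q this f' q_corolla_canonical[OF q c' f(2)]]
  have s: "signed ((\<lambda>(B, G). (map_diagram ?g B, image ?g ` G)) ` full ` binary_expansions ?c)
     (q (single c 1))"
    by (simp add: map_diagram_inv[OF f(1)])
  have full_map: "(\<lambda>(B, G). (map_diagram ?g B, image ?g ` G)) (full B) = full (map_diagram ?g B)" for B
    by (simp add: full_def edges_map)
  have "map_diagram ?g ` binary_expansions ?c = binary_expansions c"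
  proof
    show "map_diagram ?g ` binary_expansions ?c \<subseteq> binary_expansions c"
      using binary_expansions_map[OF f'] map_diagram_inv[OF f(1), of c] by auto
    show "binary_expansions c \<subseteq> map_diagram ?g ` binary_expansions ?c"
    proof
      fix B assume "B \<in> binary_expansions c"
      then have "map_diagram f B \<in> binary_expansions ?c" using binary_expansions_map f(1) by blast
      then show "B \<in> map_diagram ?g ` binary_expansions ?c"
        using map_diagram_inv[OF f(1), of B] by (metis imageI)
    qed
  qed
  then have "(\<lambda>(B, G). (map_diagram ?g B, image ?g ` G)) ` full ` binary_expansions ?c = full ` binary_expansions c"
    unfolding image_image full_map by (metis image_image)
  with s show ?thesis by simp
qed

section \<open>Grafting at the first leaf\<close>

text \<open>
  Only compositions at the first leaf are needed, since the symmetric group acts on labels.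
\<close>
definition graft_first :: "nat diagram \<Rightarrow> nat diagram \<Rightarrow> nat diagram" where
  "graft_first D E = graft D 1 E"

definition lower_edge :: "nat \<Rightarrow> edge \<Rightarrow> edge" where
  "lower_edge l A = graft_lower_edge 1 l A"

lemma lower_edge_eq:
  "lower_edge l A = (\<Union>a\<in>A. if a = 0 then {0} else if a = 1 then {1..l} else {a + l - 1})"
  unfolding lower_edge_def graft_lower_edge_def by (intro SUP_cong) auto

lemma graft_Vertex: "graft_first (Vertex y ts) E = Vertex y (map (\<lambda>t. graft_first t E) ts)"
  by (simp add: graft_first_def graft_def)

lemma graft_Leaf:
  "graft_first (Leaf c a) E = (if a = 0 then Leaf c 0 else if a = 1 then E else Leaf c (a + num_leaves E - 1))"
  by (simp add: graft_first_def graft_def diagram.map_ident)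

lemma upper_edge_one: "graft_upper_edge 1 A = A"
  by (simp add: graft_upper_edge_def)

text \<open>Grafting shifts a label \<open>a > 1\<close> to \<open>a + l - 1\<close>, and
  \<open>x + 1 - l\<close> inverts this shift; the truncated subtraction is exact because
  \<open>l < x\<close>.\<close>

lemma lower_edge_mem:
  assumes "A \<subseteq> {1..}" "1 \<le> l"
  shows "x \<in> lower_edge l A \<longleftrightarrow> 1 \<in> A \<and> 1 \<le> x \<and> x \<le> l \<or> l < x \<and> x + 1 - l \<in> A"
proof
  assume "x \<in> lower_edge l A"
  then obtain a where a: "a \<in> A" "x \<in> (if a = 0 then {0} else if a = 1 then {1..l} else {a + l - 1})"
    by (auto simp: lower_edge_eq)
  have "1 \<le> a" using a(1) assms by auto
  with a assms show "1 \<in> A \<and> 1 \<le> x \<and> x \<le> l \<or> l < x \<and> x + 1 - l \<in> A"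
    by (cases "a = 1") auto
next
  assume "1 \<in> A \<and> 1 \<le> x \<and> x \<le> l \<or> l < x \<and> x + 1 - l \<in> A"
  then show "x \<in> lower_edge l A"
  proof
    assume "1 \<in> A \<and> 1 \<le> x \<and> x \<le> l"
    then show ?thesis by (auto simp: lower_edge_eq intro!: bexI[of _ 1])
  next
    assume "l < x \<and> x + 1 - l \<in> A"
    then show ?thesis using assms(2) by (auto simp: lower_edge_eq intro!: bexI[of _ "x + 1 - l"])
  qed
qed

lemma lower_edge_inj:
  assumes "A \<subseteq> {1..}" "B \<subseteq> {1..}" "1 \<le> l" "lower_edge l A = lower_edge l B"
  shows "A = B"
proof -
  have "a \<in> A \<longleftrightarrow> a \<in> B" if "1 \<le> a" for a
  proof (cases "a = 1")
    case True
    then show ?thesis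
      using lower_edge_mem[OF assms(1,3), of 1] lower_edge_mem[OF assms(2,3), of 1] assms(3,4) by auto
  next
    case False
    have "a + l - 1 \<in> lower_edge l A \<longleftrightarrow> a + l - 1 \<in> lower_edge l B" using assms by simp
    moreover have "a + l - 1 > l" "a + l - 1 + 1 - l = a" using False that assms(3) by auto
    ultimately show ?thesis
      using lower_edge_mem[OF assms(1,3), of "a + l - 1"] lower_edge_mem[OF assms(2,3), of "a + l - 1"] by simp
  qed
  then show ?thesis using assms(1,2) by force
qed

lemma lower_edge_UN: "lower_edge l (\<Union>t\<in>T. f t) = (\<Union>t\<in>T. lower_edge l (f t))"
  by (auto simp: lower_edge_eq)

lemma lower_edge_one: "lower_edge l {1} = {1..l}"
  by (auto simp: lower_edge_eq)

text \<open>If \<open>A\<close> contains the grafted leaf, its image contains \<open>{1..l}\<close>;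
  otherwise it has an element beyond \<open>l\<close>. Edges of \<open>E\<close> are proper subsets
  of \<open>{1..l}\<close>, so the edges coming from the two factors have different names.\<close>

lemma lower_edge_not_below:
  assumes "A \<subseteq> {1..}" "A \<noteq> {}" "1 \<le> l" shows "\<not> lower_edge l A \<subset> {1..l}"
proof
  assume s: "lower_edge l A \<subset> {1..l}"
  obtain a where a: "a \<in> A" "1 \<le> a" using assms by auto
  show False
  proof (cases "1 \<in> A")
    case True
    then have "x \<in> lower_edge l A" if "x \<in> {1..l}" for x
      using lower_edge_mem[OF assms(1,3), of x] that by simp
    then have "{1..l} \<subseteq> lower_edge l A" by blast
    with s show ?thesis by auto
  next
    case False
    then have "a > 1" using a by (metis le_neq_implies_less)
    then have "l < a + l - 1" "a + l - 1 + 1 - l = a" using assms(3) by linarith+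
    then have "a + l - 1 \<in> lower_edge l A"
      using lower_edge_mem[OF assms(1,3), of "a + l - 1"] a assms(3) by simp
    then have "a + l - 1 \<le> l" using s by auto
    with \<open>a > 1\<close> show False by simp
  qed
qed

locale grafting =
  fixes E :: "nat diagram" and l :: nat
  assumes E: "E \<in> diagrams" and l: "l = num_leaves E"
begin

lemma E_simps: "proper E" "well_colored E" "\<not> is_leaf E" "labels E = {1..l}" "1 \<le> l"
  using E num_leaves_pos[of E] by (auto simp: diagrams_iff proper_def l)

text \<open>Holds also for subtrees of the lower diagram, in which leaf 1 need not occur, so that
  inductions go through.\<close>

definition graftable :: "nat diagram \<Rightarrow> bool" where
  "graftable D \<longleftrightarrow> well_colored D \<and> labels D \<subseteq> {1..} \<and> (\<forall>c. (1, c) \<in> set (dfs_leaves D) \<longrightarrow> c = root_color E)"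

lemma graftable_child: "graftable (Vertex y ts) \<Longrightarrow> t \<in> set ts \<Longrightarrow> graftable t"
  by (fastforce simp: graftable_def)

lemma graftable_labels: "graftable D \<Longrightarrow> labels D \<subseteq> {1..} \<and> labels D \<noteq> {}"
  using labels_nonempty by (auto simp: graftable_def)

lemma root_color_graft: "graftable D \<Longrightarrow> root_color (graft_first D E) = root_color D"
  by (cases D) (auto simp: graft_Vertex graft_Leaf graftable_def)

lemma labels_graft: "graftable D \<Longrightarrow> labels (graft_first D E) = lower_edge l (labels D)"
proof (induction D)
  case (Leaf c a)
  then show ?case using E_simps by (auto simp: graft_Leaf lower_edge_eq l graftable_def)
next
  case (Vertex y ts)
  then show ?case using graftable_child[OF Vertex.prems] by (simp add: graft_Vertex lower_edge_UN)
qed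

lemma is_leaf_graft: "\<not> is_leaf D \<Longrightarrow> \<not> is_leaf (graft_first D E)"
  by (cases D) (auto simp: graft_Vertex)

text \<open>With \<open>branch_edges\<close> the induction can start at leaf 1, where the edge below
  the grafted \<open>E\<close>, named \<open>{1..l}\<close>, makes its appearance.\<close>

lemma edges_graft: "graftable D \<Longrightarrow>
    branch_edges (graft_first D E) \<subseteq> lower_edge l ` branch_edges D \<union> insert {1..l} (set (edges E))"
proof (induction D)
  case (Leaf c a)
  then show ?case using E_simps by (auto simp: graft_Leaf branch_edges_def)
next
  case (Vertex y ts)
  let ?R = "insert {1..l} (set (edges E))" and ?g = "lower_edge l"
  have "branch_edges (graft_first (Vertex y ts) E) =
      insert (?g (labels (Vertex y ts))) (\<Union>t\<in>set ts. branch_edges (graft_first t E))"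
    using labels_graft[OF Vertex.prems] unfolding branch_edges_def[of "graft_first (Vertex y ts) E"]
    by (simp add: graft_Vertex set_edges_Vertex del: edges.simps)
  also have "\<dots> \<subseteq> insert (?g (labels (Vertex y ts))) (\<Union>t\<in>set ts. ?g ` branch_edges t \<union> ?R)"
    using Vertex.IH graftable_child[OF Vertex.prems] by (intro insert_mono UN_mono) auto
  also have "\<dots> \<subseteq> ?g ` branch_edges (Vertex y ts) \<union> ?R"
    unfolding branch_edges_def[of "Vertex y ts"] set_edges_Vertex by auto
  finally show ?case .
qed

text \<open>
  The new edge is named \<open>lower_edge l {1} = {1..l}\<close>, so the condition \<open>A \<noteq> {1}\<close> keeps it out of \<open>X\<close>.
\<close>
context
  fixes G H X :: "edge set"
  assumes G: "\<And>A. A \<in> G \<Longrightarrow> A \<subseteq> {1..} \<and> A \<noteq> {} \<and> A \<noteq> {1}"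
    and H: "\<And>A. A \<in> H \<Longrightarrow> A \<subset> {1..l}"
    and X: "X = lower_edge l ` G \<union> H"
begin

lemma marked_lower: "A \<subseteq> {1..} \<Longrightarrow> A \<noteq> {} \<Longrightarrow> lower_edge l A \<in> X \<longleftrightarrow> A \<in> G"
proof
  assume A: "A \<subseteq> {1..}" "A \<noteq> {}" and "lower_edge l A \<in> X"
  moreover have "lower_edge l A \<notin> H" using H lower_edge_not_below[OF A E_simps(5)] by blast
  ultimately obtain B where "B \<in> G" "lower_edge l A = lower_edge l B" unfolding X by blast
  then show "A \<in> G" using lower_edge_inj[of A B l] A G E_simps(5) by blast
qed (simp add: X)

lemma new_edge_unmarked: "{1..l} \<notin> X"
  using marked_lower[of "{1}"] G[of "{1}"] unfolding lower_edge_one by auto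

lemma marked_upper: "X \<inter> set (edges E) = H \<inter> set (edges E)"
proof -
  have "lower_edge l A \<notin> set (edges E)" if "A \<in> G" for A
    using edges_psubset[OF E_simps(1)] lower_edge_not_below[of A l] G[OF that] E_simps(4,5) by metis
  then show ?thesis unfolding X by blast
qed

text \<open>The new edge is not in \<open>X\<close>, so the root of \<open>E\<close> stays a vertex
  of its own and contraction acts on the two factors separately.\<close>

lemma contract_graft:
  "graftable D \<Longrightarrow> contract X (graft_first D E) = graft_first (contract G D) (contract H E)"
proof (induction D)
  case (Leaf c a)
  then show ?case using contract_cong[OF marked_upper] by (auto simp: graft_Leaf l)
next
  case (Vertex y ts)
  have br: "branches X (graft_first t E) = map (\<lambda>u. graft_first u (contract H E)) (branches G t)" if t: "t \<in> set ts" for t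
  proof (cases "is_leaf t")
    case True
    then obtain c a where ca: "t = Leaf c a" by (cases t) auto
    show ?thesis
    proof (cases "a = 1")
      case True
      then show ?thesis
        using contract_cong[OF marked_upper] new_edge_unmarked E_simps
        by (simp add: ca graft_Leaf branches_def)
    qed (simp add: ca graft_Leaf branches_def l)
  next
    case False
    have gt: "graftable t" using graftable_child Vertex.prems t by blast
    have "labels (graft_first t E) \<in> X \<longleftrightarrow> labels t \<in> G"
      using marked_lower[of "labels t"] graftable_labels[OF gt] labels_graft[OF gt] by simp
    moreover have "inputs (graft_first u F) = map (\<lambda>u. graft_first u F) (inputs u)" if "\<not> is_leaf u" for u F
      using that by (cases u) (auto simp: graft_Vertex)
    ultimately show ?thesis using Vertex.IH[OF t gt] False is_leaf_graft[OF False]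
      by (simp add: branches_def)
  qed
  have "concat (map (branches X) (map (\<lambda>t. graft_first t E) ts)) =
     map (\<lambda>u. graft_first u (contract H E)) (concat (map (branches G) ts))"
    unfolding map_concat map_map o_def using br by (simp cong: map_cong)
  moreover have "arrange y (map (\<lambda>u. graft_first u (contract H E)) (concat (map (branches G) ts))) =
     map (\<lambda>u. graft_first u (contract H E)) (arrange y (concat (map (branches G) ts)))"
  proof (rule arrange_map)
    fix u assume "u \<in> set (concat (map (branches G) ts))"
    moreover have "set (concat (map (branches G) ts)) = set (inputs (contract G (Vertex y ts)))" by simp
    ultimately have "u \<in> set (inputs (contract G (Vertex y ts)))" by simp
    moreover have "graftable (contract G (Vertex y ts))"
      using Vertex.prems well_colored_contract unfolding graftable_def by (metis labels_contract set_dfs_leaves_contract)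
    ultimately have "graftable u" using graftable_child by (metis contract_Vertex inputs.simps(2))
    then show "root_color (graft_first u (contract H E)) = root_color u"
      by (cases u) (auto simp: graft_Vertex graft_Leaf graftable_def)
  qed
  ultimately show ?case by (simp add: graft_Vertex)
qed

text \<open>The sign of an edge of \<open>D\<close> is read off from sides and root colors, which
  grafting preserves; the edges of \<open>E\<close> keep their surroundings; the new edge is not
  tested.\<close>

lemma all_sign_graft:
  "all_vertices_binary D \<Longrightarrow> all_vertices_binary E \<Longrightarrow> graftable D \<Longrightarrow>
   all_sign b X (graft_first D E) \<longleftrightarrow> all_sign b G D \<and> (1 \<in> labels D \<longrightarrow> all_sign b H E)"
proof (induction D rule: binary_induct)
  case (Leaf c a)
  then show ?case using all_sign_cong[OF _ marked_upper] by (auto simp: graft_Leaf)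
next
  case (Vertex y s t)
  have g: "graftable s" "graftable t" using graftable_child[OF Vertex.prems(2)] by auto
  have ok: "sign_ok b X r (graft_first u E) \<longleftrightarrow> sign_ok b G r u" if u: "graftable u" "all_vertices_binary u" for r u
  proof (cases u)
    case (Leaf c a)
    then show ?thesis using new_edge_unmarked E_simps by (auto simp: sign_ok_def graft_Leaf)
  next
    case v: (Vertex z us)
    then obtain u1 u2 where us: "us = [u1, u2]" using u(2) by (auto simp: length_Suc_conv numeral_2_eq_2)
    have "labels (graft_first u E) \<in> X \<longleftrightarrow> labels u \<in> G"
      using marked_lower[of "labels u"] graftable_labels[OF u(1)] labels_graft[OF u(1)] by simp
    moreover have "root_color (graft_first u2 E) = root_color u2"
      using root_color_graft graftable_child u(1) v us by auto
    then have "positive_branch r (graft_first u E) = positive_branch r u"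
      by (simp add: positive_branch_def v us graft_Vertex)
    ultimately show ?thesis by (simp add: sign_ok_def v graft_Vertex)
  qed
  have "all_sign b X (graft_first (Vertex y [s, t]) E) \<longleftrightarrow>
     sign_ok b G False s \<and> sign_ok b G True t \<and> all_sign b X (graft_first s E) \<and> all_sign b X (graft_first t E)"
    using ok g Vertex.hyps by (simp add: graft_Vertex)
  with Vertex.IH Vertex.prems(1) g show ?case by auto
qed

end

end

section \<open>Cutting a diagram along an edge\<close>

lemma map_diagram_shift:
  assumes "\<forall>a\<in>labels D. l < a" "l = num_leaves E" "1 \<le> l"
  shows "graft_first (map_diagram (\<lambda>a. a + 1 - l) D) E = D"
  using assms by (induction D) (auto simp: graft_Leaf graft_Vertex intro: map_idI)

text \<open>Induction along the path from the root to the edge. The part beyond the edge is replaced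
  by leaf 1, and every label outside it is lowered by \<open>l - 1\<close>, which undoes the shift
  of a grafting at leaf 1.\<close>

lemma cut_at_edge:
  assumes "proper B" "labels B \<subseteq> {1..}" "{1..l} \<in> set (edges B)" "1 \<le> l"
  shows "\<exists>D E. \<not> is_leaf D \<and> \<not> is_leaf E \<and> labels E = {1..l} \<and> proper E \<and> well_colored D \<and>
     B = graft_first D E \<and> num_leaves D + num_leaves E = num_leaves B + 1 \<and>
     labels D = insert 1 ((\<lambda>a. a + 1 - l) ` (labels B - {1..l})) \<and>
     (1, root_color E) \<in> set (dfs_leaves D) \<and>
     root_color D = root_color B \<and> (all_vertices_binary B \<longrightarrow> all_vertices_binary D \<and> all_vertices_binary E)"
  using assms(1-3)
proof (induction B)
  case (Vertex y ts)
  let ?h = "\<lambda>a. a + 1 - l"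
  obtain t where t: "t \<in> set ts" "{1..l} \<in> branch_edges t"
    using Vertex.prems(3) by (auto simp: set_edges_Vertex simp del: edges.simps)
  obtain us vs where ts: "ts = us @ t # vs" using t(1) by (meson split_list)
  have pt: "proper t" using proper_child Vertex.prems(1) t(1) by blast
  have nl: "\<not> is_leaf t" using t(2) by (auto simp: branch_edges_def)
  \<comment> \<open>Here \<open>D\<close> may be a leaf: this happens if the edge to be cut is the
    one directly below \<open>t\<close>.\<close>
  have "\<exists>D E. \<not> is_leaf E \<and> labels E = {1..l} \<and> proper E \<and> well_colored D \<and>
     t = graft_first D E \<and> num_leaves D + num_leaves E = num_leaves t + 1 \<and>
     labels D = insert 1 (?h ` (labels t - {1..l})) \<and> (1, root_color E) \<in> set (dfs_leaves D) \<and>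
     root_color D = root_color t \<and> (all_vertices_binary t \<longrightarrow> all_vertices_binary D \<and> all_vertices_binary E)"
  proof (cases "labels t = {1..l}")
    case True
    with nl pt show ?thesis
      by (intro exI[of _ "Leaf (root_color t) 1"] exI[of _ t]) (simp add: graft_Leaf)
  next
    case False
    then have "{1..l} \<in> set (edges t)" using t(2) by (auto simp: branch_edges_def split: if_splits)
    moreover have "labels t \<subseteq> {1..}" using Vertex.prems(2) t(1) by auto
    ultimately show ?thesis using Vertex.IH[OF t(1) pt] by blast
  qed
  then obtain D E where D: "\<not> is_leaf E" "labels E = {1..l}" "proper E" "well_colored D"
     "t = graft_first D E" "num_leaves D + num_leaves E = num_leaves t + 1"
     "labels D = insert 1 (?h ` (labels t - {1..l}))" "(1, root_color E) \<in> set (dfs_leaves D)"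
     "root_color D = root_color t" "all_vertices_binary t \<longrightarrow> all_vertices_binary D \<and> all_vertices_binary E"
    by blast
  have lE: "num_leaves E = l" using num_leaves_eq_card[of E] D(2,3) by (simp add: proper_def)
  have sub: "{1..l} \<subseteq> labels t" using branch_edges_subset[OF t(2)] .
  have dj: "labels u \<inter> {1..l} = {}" "\<forall>a\<in>labels u. l < a" if "u \<in> set us \<union> set vs" for u
  proof -
    have "labels u \<inter> labels t = {}" using proper_split[of y us t vs u] Vertex.prems(1) that ts by simp
    then show 1: "labels u \<inter> {1..l} = {}" using sub by blast
    have "labels u \<subseteq> {1..}" using Vertex.prems(2) that ts by auto
    with 1 show "\<forall>a\<in>labels u. l < a" by force
  qed
  let ?sh = "map_diagram ?h"
  let ?D = "Vertex y (map ?sh us @ D # map ?sh vs)"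
  have g: "graft_first (?sh u) E = u" if "u \<in> set us \<union> set vs" for u
    by (rule map_diagram_shift[OF dj(2)[OF that]]) (use lE assms(4) in simp_all)
  have "well_colored ?D" using Vertex.prems(1) D(4,9) ts by (auto simp: proper_Vertex_iff o_def)
  moreover have "graft_first ?D E = Vertex y ts"
  proof -
    have "map (\<lambda>u. graft_first (?sh u) E) us = us" "map (\<lambda>u. graft_first (?sh u) E) vs = vs"
      by (rule map_idI, rule g, simp)+
    then show ?thesis unfolding graft_Vertex ts D(5) by (simp add: o_def)
  qed
  moreover have "num_leaves ?D + num_leaves E = num_leaves (Vertex y ts) + 1"
    using D(6) by (simp add: num_leaves_Vertex ts o_def)
  moreover have "labels ?D = insert 1 (?h ` (labels (Vertex y ts) - {1..l}))"
  proof -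
    have "labels (Vertex y ts) - {1..l} = (\<Union>u\<in>set us \<union> set vs. labels u) \<union> (labels t - {1..l})"
      using dj(1) by (auto simp: ts)
    then show ?thesis using D(7) by (simp add: diagram.set_map image_Un image_UN) blast
  qed
  moreover have "(1, root_color E) \<in> set (dfs_leaves ?D)" using D(8) by simp
  moreover have "all_vertices_binary (Vertex y ts) \<longrightarrow> all_vertices_binary ?D \<and> all_vertices_binary E"
    using D(10) by (auto simp: ts)
  ultimately show ?case using D(1,2,3)
    by (intro exI[of _ ?D] exI[of _ E]) simp
qed simp

lemma cut_diagrams:
  assumes "B \<in> diagrams" "{1..l} \<in> set (edges B)" "1 \<le> l"
  shows "\<exists>D E. D \<in> diagrams \<and> E \<in> diagrams \<and> num_leaves E = l \<and> B = graft_first D E \<and>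
     num_leaves D + num_leaves E = num_leaves B + 1 \<and> (1, root_color E) \<in> set (dfs_leaves D) \<and>
     (all_vertices_binary B \<longrightarrow> all_vertices_binary D \<and> all_vertices_binary E)"
proof -
  have B: "proper B" "labels B = {1..num_leaves B}" using assms(1) by (auto simp: diagrams_iff)
  then obtain D E where D: "\<not> is_leaf D" "\<not> is_leaf E" "labels E = {1..l}" "proper E" "well_colored D"
     "B = graft_first D E" "num_leaves D + num_leaves E = num_leaves B + 1"
     "labels D = insert 1 ((\<lambda>a. a + 1 - l) ` (labels B - {1..l}))"
     "(1, root_color E) \<in> set (dfs_leaves D)"
     "all_vertices_binary B \<longrightarrow> all_vertices_binary D \<and> all_vertices_binary E"
    using cut_at_edge[OF B(1) _ assms(2,3)] by auto
  have lE: "num_leaves E = l" using num_leaves_eq_card[of E] D(3,4) by (simp add: proper_def)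
  have le: "l \<le> num_leaves B" using edges_subset[OF assms(2)] assms(3) B(2) by auto
  have "{1..num_leaves B} - {1..l} = {l + 1..num_leaves B}" by auto
  then have "labels D = insert 1 ((\<lambda>a. a + 1 - l) ` {l + 1..num_leaves B})" using D(8) B(2) by simp
  also have "(\<lambda>a. a + 1 - l) ` {l + 1..num_leaves B} = {2..num_leaves D}"
  proof
    show "{2..num_leaves D} \<subseteq> (\<lambda>a. a + 1 - l) ` {l + 1..num_leaves B}"
    proof
      fix x assume "x \<in> {2..num_leaves D}"
      then have "x + l - 1 \<in> {l + 1..num_leaves B}" "x = x + l - 1 + 1 - l" using D(7) lE assms(3) by auto
      then show "x \<in> (\<lambda>a. a + 1 - l) ` {l + 1..num_leaves B}" by blast
    qed
  qed (use D(7) lE in auto)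
  also have "insert 1 {2..num_leaves D} = {1..num_leaves D}" using num_leaves_pos[OF D(5)] by auto
  finally have lD: "labels D = {1..num_leaves D}" .
  \<comment> \<open>The construction leaves open whether the labels of \<open>D\<close> are
    distinct. Counting settles it, since the label set has as many elements as \<open>D\<close> has
    leaves.\<close>
  have "card (set (map fst (dfs_leaves D))) = length (map fst (dfs_leaves D))"
    using lD fst_dfs_leaves[of D] by (simp add: num_leaves_def)
  then have "distinct (map fst (dfs_leaves D))" by (rule card_distinct)
  then have "D \<in> diagrams" using D(1,5) lD by (simp add: diagrams_iff proper_def)
  moreover have "E \<in> diagrams" using D lE by (simp add: diagrams_iff)
  ultimately show ?thesis using D lE by blast
qed

section \<open>The diagonal of a corolla\<close>

lemma edges_binary:
  "all_vertices_binary B \<Longrightarrow> length (edges B) + (if is_leaf B then 1 else 2) = num_leaves B"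
proof (induction B rule: binary_induct)
  case (Vertex y s t)
  then show ?case by (cases s; cases t) (auto simp: num_leaves_Vertex)
qed simp

definition cut_support :: "edge set \<Rightarrow> nat diagram \<Rightarrow> nat diagram set" where
  "cut_support X B = (if all_sign True X B then {contract X B} else {})"

text \<open>A member of the support has degree equal to the number of leaves minus two, hence no
  edges, so it is the corolla \<open>?C\<close>. It belongs to the support if and only if its
  maximal expansion lies below \<open>B\<close>; as \<open>B\<close> is itself an expansion of
  \<open>?C\<close>, this means that \<open>B\<close> is that maximum.\<close>

lemma p_support_binary:
  assumes "B \<in> binary_diagrams"
  shows "p_support B = cut_support (set (edges B)) B"
proof -
  let ?C = "contract (set (edges B)) B"
  have B: "B \<in> diagrams" "all_vertices_binary B" "well_colored B" "\<not> is_leaf B"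
    using assms by (auto simp: binary_diagrams_def diagrams_iff proper_def)
  have C: "?C \<in> diagrams" "edges ?C = []" "leaf_order ?C = leaf_order B" "well_colored ?C" "\<not> is_leaf ?C"
    using contract_in_diagrams[OF B(1)] set_edges_contract[of "set (edges B)" B] leaf_order_contract[OF B(3)]
      well_colored_contract[OF B(3)] B(4) by simp_all
  have BC: "B \<in> binary_expansions ?C" using B by (intro binary_expansionsI) auto
  have len: "length (edges B) + 2 = num_leaves B" using edges_binary[OF B(2)] B(4) by simp
  have "S = ?C" if S: "S \<in> p_support B" for S
  proof -
    have s: "well_colored S" "\<not> is_leaf S" "leaf_order S = leaf_order B" "root_color S = root_color B"
      "degree S = length (edges B)" using S by (auto simp: p_support_def diagrams_iff proper_def)
    have "num_leaves S = num_leaves B" using s(3) by (metis length_leaf_order)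
    then have "length (edges S) = 0" using s(5) len edges_bound[OF s(1,2)] unfolding degree_def by linarith
    then have "edges S = []" by simp
    with corolla_eq[of S] corolla_eq[of ?C] s C show ?thesis by simp
  qed
  moreover have "?C \<in> p_support B \<longleftrightarrow> all_sign True (set (edges B)) B"
  proof -
    have "?C \<in> p_support B \<longleftrightarrow> diagram_le (D_max ?C) B"
      using C len[symmetric] D_min_binary[OF assms] by (simp add: p_support_def degree_def)
    also have "\<dots> \<longleftrightarrow> extremal True ?C B"
    proof
      assume "diagram_le (D_max ?C) B"
      then have "B = D_max ?C"
        using D_max_extremal[OF C(1)] BC by (auto simp: extremal_def le_dir_def)
      then show "extremal True ?C B" using D_max_extremal[OF C(1)] by simp
    next
      assume "extremal True ?C B"
      then show "diagram_le (D_max ?C) B" using D_max_eq by (simp add: diagram_le_def)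
    qed
    also have "\<dots> \<longleftrightarrow> all_sign True (set (edges B)) B" using BC C(2) by (simp add: extremal_iff)
    finally show ?thesis .
  qed
  ultimately show ?thesis by (auto simp: cut_support_def)
qed

text \<open>The leaves beyond \<open>e\<close> are numbered before all others, so that
  \<open>e\<close> gets the name of the new edge of a grafting at leaf 1.\<close>

lemma relabel_edge:
  assumes "D \<in> diagrams" "e \<in> set (edges D)"
  shows "\<exists>f. f permutes {1..num_leaves D} \<and> f ` e = {1..card e}"
proof -
  let ?n = "num_leaves D"
  have e: "e \<subseteq> {1..?n}" using assms edges_subset by (auto simp: diagrams_iff)
  then have fin: "finite e" by (rule finite_subset) simp
  let ?xs = "sorted_list_of_set e" and ?zs = "sorted_list_of_set ({1..?n} - e)"
  have d: "distinct (?xs @ ?zs)" "set (?xs @ ?zs) = {1..?n}" using fin e by auto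
  moreover have "set (?xs @ ?zs) = set [1..<Suc ?n]" unfolding d(2) by auto
  ultimately obtain f where f: "f permutes {1..?n}" "map f (?xs @ ?zs) = [1..<Suc ?n]"
    using permutation_of_lists[of "?xs @ ?zs" "[1..<Suc ?n]"] distinct_upt by metis
  have le: "card e \<le> ?n" using card_mono[OF _ e] by simp
  have "map f ?xs = take (card e) [1..<Suc ?n]"
    using arg_cong[OF f(2), of "take (card e)"] by simp
  also have "\<dots> = [1..<Suc (card e)]" using le by (simp add: take_upt del: upt_Suc)
  finally have "set (map f ?xs) = {1..card e}" by auto
  then have "f ` e = {1..card e}" using fin by simp
  with f show ?thesis by blast
qed

lemma p_comp:
  assumes "is_p p" "labeled D" "G \<subseteq> set (edges D)" "labeled E" "H \<subseteq> set (edges E)" "1 \<le> num_leaves D"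
  shows "p (comp_Q 1 (single (D, G) 1) (single (E, H) 1)) =
     comp_C 1 (p (single (D, G) 1)) (p (single (E, H) 1))"
proof -
  have "\<forall>xs y xs' y' i. \<forall>x \<in> component basis_Q coloring_Q (xs, y).
        \<forall>x' \<in> component basis_Q coloring_Q (xs', y').
        i \<in> {1..length xs} \<longrightarrow> p (comp_Q i x x') = comp_C i (p x) (p x')"
    using assms(1) unfolding is_p_def operad_map_Q_C_def by blast
  from bspec[OF bspec[OF this[THEN spec, THEN spec, THEN spec, THEN spec, THEN spec,
      of "fst (coloring D)" "snd (coloring D)" "fst (coloring E)" "snd (coloring E)" 1]],
      of "single (D, G) 1" "single (E, H) 1"]
  show ?thesis
    using single_component_Q[OF assms(2,3)] single_component_Q[OF assms(4,5)] assms(6) by simp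
qed

lemma signed_comp_Q:
  assumes "(1, root_color E) \<in> set (dfs_leaves D)" "\<not> is_leaf D" "\<not> is_leaf E"
  shows "signed {(graft_first D E, lower_edge (num_leaves E) ` G \<union> H)}
     (comp_Q 1 (single (D, G) 1) (single (E, H) 1))"
proof -
  have g: "graft_upper_edge 1 = (\<lambda>A. A)" by (rule ext) (rule upper_edge_one)
  have "comp_Q 1 (single (D, G) 1) (single (E, H) 1) =
     (comp_Q_basis 1 (D, G) (E, H) :: 'a Q)"
    by (simp add: comp_Q_def bilinear_ext_single)
  also have "signed {(graft_first D E, lower_edge (num_leaves E) ` G \<union> H)} \<dots>"
    using assms unfolding comp_Q_basis_def graft_first_def lower_edge_def[abs_def]
    by (simp add: Let_def g del: One_nat_def) (rule signed_gen_Q, simp)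
  finally show ?thesis .
qed

lemma signed_comp_C:
  assumes "(1, root_color E) \<in> set (dfs_leaves D)" "\<not> is_leaf D" "\<not> is_leaf E"
    "r = 1 \<or> r = - 1" "s = 1 \<or> s = - 1"
  shows "signed {graft_first D E} (comp_C 1 (single D r) (single E s))"
proof -
  have "comp_C 1 (single D r) (single E s) = smul (r * s) (comp_C_basis 1 D E)"
    by (simp add: comp_C_def bilinear_ext_single)
  moreover have "signed {graft_first D E} (comp_C_basis 1 D E :: 'a C)"
    using assms(1-3) unfolding comp_C_basis_def graft_first_def
    by (simp add: Let_def del: One_nat_def) (rule signed_gen_C, simp add: minus_one_power_iff)
  moreover have "r * s = 1 \<or> r * s = - 1" using assms(4,5) by auto
  ultimately show ?thesis using signed_smul by metis
qed

text \<open>As \<open>{1..l}\<close> is non-metric, \<open>(B, X)\<close> is up to sign a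
  composition of two marked diagrams with fewer leaves, and \<open>p\<close> is multiplicative. The
  supports of the factors graft together to the support for \<open>B\<close>, or one of them is
  empty and the value is zero.\<close>

lemma p_cut_first:
  fixes p :: "'r::comm_ring_1 Q \<Rightarrow> 'r C"
  assumes p: "is_p p" and B: "B \<in> binary_diagrams" "X \<subseteq> set (edges B)"
    and new: "{1..l} \<in> set (edges B)" "{1..l} \<notin> X" "1 \<le> l"
    and IH: "\<And>D G. D \<in> binary_diagrams \<Longrightarrow> num_leaves D < num_leaves B \<Longrightarrow> G \<subseteq> set (edges D) \<Longrightarrow>
        signed (cut_support G D) (p (single (D, G) 1))"
  shows "signed (cut_support X B) (p (single (B, X) 1))"
proof -
  have Bd: "B \<in> diagrams" "all_vertices_binary B" using B by (auto simp: binary_diagrams_def)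
  obtain D E where D: "D \<in> diagrams" and E: "E \<in> diagrams" and lE: "num_leaves E = l"
    and BDE: "B = graft_first D E" and num: "num_leaves D + num_leaves E = num_leaves B + 1"
    and root: "(1, root_color E) \<in> set (dfs_leaves D)"
    and bin: "all_vertices_binary D" "all_vertices_binary E"
    using cut_diagrams[OF Bd(1) new(1,3)] Bd(2) by blast
  interpret grafting E l using E lE by unfold_locales auto
  have Dp: "proper D" "well_colored D" "labels D = {1..num_leaves D}" "\<not> is_leaf D"
    using D by (auto simp: diagrams_iff proper_def)
  have "c = root_color E" if "(1, c) \<in> set (dfs_leaves D)" for c
    using that root Dp(1) by (metis eq_key_imp_eq_value proper_def)
  then have gD: "graftable D" using Dp by (auto simp: graftable_def)
  let ?G = "{A \<in> set (edges D). lower_edge l A \<in> X}" and ?H = "X \<inter> set (edges E)"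
  have "branch_edges B = insert (labels B) (set (edges B))" "branch_edges D = insert (labels D) (set (edges D))"
    using Bd Dp by (auto simp: branch_edges_def diagrams_iff)
  then have "set (edges B) \<subseteq> lower_edge l ` insert (labels D) (set (edges D)) \<union> insert {1..l} (set (edges E))"
    using edges_graft[OF gD] BDE by auto
  \<comment> \<open>\<open>edges_graft\<close> also lists the name of the edge below the whole
    diagram. It equals \<open>labels B\<close>, which is no internal edge and hence not in
    \<open>X\<close>.\<close>
  moreover have "lower_edge l (labels D) \<notin> X"
    using labels_graft[OF gD] edges_psubset[of B] B(2) Bd(1) BDE by (auto simp: diagrams_iff)
  ultimately have "X \<subseteq> lower_edge l ` ?G \<union> ?H" using B(2) new(2) by blast
  then have X: "X = lower_edge l ` ?G \<union> ?H" by blast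
  have G: "A \<subseteq> {1..} \<and> A \<noteq> {} \<and> A \<noteq> {1}" if A: "A \<in> ?G" for A
  proof -
    have "A \<subseteq> {1..}" "A \<noteq> {}" using A edges_subset[of A D] edges_nonempty[OF Dp(2), of A] Dp(3) by auto
    moreover have "A \<noteq> {1}" using A new(2) lower_edge_one[of l] by auto
    ultimately show ?thesis by blast
  qed
  have H: "A \<subset> {1..l}" if "A \<in> ?H" for A using that edges_psubset[OF E_simps(1)] E_simps(4) by blast
  have D2: "D \<in> binary_diagrams" and E2: "E \<in> binary_diagrams" using D E bin by (auto simp: binary_diagrams_def)
  \<comment> \<open>Each factor has at least two leaves and together they have one more than
    \<open>B\<close>, so both are smaller than \<open>B\<close>.\<close>
  have "2 \<le> num_leaves D" "2 \<le> num_leaves E"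
    using edges_bound[of D] edges_bound[of E] Dp E_simps by auto
  then have small: "num_leaves D < num_leaves B" "num_leaves E < num_leaves B" using num by auto
  have sD: "signed (cut_support ?G D) (p (single (D, ?G) 1))"
    by (rule IH[OF D2 small(1)]) auto
  have sE: "signed (cut_support ?H E) (p (single (E, ?H) 1))"
    by (rule IH[OF E2 small(2)]) auto
  have one: "1 \<in> labels D" using Dp(3) num small by auto
  have cut: "cut_support X B = (if all_sign True ?G D \<and> all_sign True ?H E
      then {graft_first (contract ?G D) (contract ?H E)} else {})"
    using contract_graft[OF G H X gD] all_sign_graft[OF G H X bin gD] one
    by (simp add: cut_support_def BDE)
  have lin: "linear_on_span basis_Q p" using p by (simp add: is_p_def operad_map_Q_C_def)
  have BX: "(B, X) \<in> basis_Q" using Bd B(2) by (simp add: basis_Q_def labeled_diagrams)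
  have "signed {(B, X)} (comp_Q 1 (single (D, ?G) 1) (single (E, ?H) 1) :: 'r Q)"
    using signed_comp_Q[OF root Dp(4) E_simps(3), of ?G ?H] X BDE lE by simp
  then obtain r :: 'r where r: "comp_Q 1 (single (D, ?G) 1) (single (E, ?H) 1) =
      single (B, X) r" "r = 1 \<or> r = - 1" by (rule signed_singletonE)
  have "p (single (B, X) r) =
     comp_C 1 (p (single (D, ?G) 1)) (p (single (E, ?H) 1))"
    unfolding r(1)[symmetric]
    by (rule p_comp[OF p labeled_diagrams[OF D] _ labeled_diagrams[OF E]]) (use num_leaves_pos[OF Dp(2)] in auto)
  moreover have "signed (cut_support X B)
     (comp_C 1 (p (single (D, ?G) 1)) (p (single (E, ?H) 1)))"
  proof (cases "all_sign True ?G D \<and> all_sign True ?H E")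
    case True
    then have "signed {contract ?G D} (p (single (D, ?G) 1))"
      "signed {contract ?H E} (p (single (E, ?H) 1))"
      using sD sE by (auto simp: cut_support_def)
    note sDE = this
    obtain a where a: "p (single (D, ?G) 1) = single (contract ?G D) a" "a = 1 \<or> a = - 1"
      by (rule signed_singletonE[OF sDE(1)])
    obtain b where b: "p (single (E, ?H) 1) = single (contract ?H E) b" "b = 1 \<or> b = - 1"
      by (rule signed_singletonE[OF sDE(2)])
    show ?thesis unfolding a(1) b(1) cut if_P[OF True]
      by (rule signed_comp_C[OF _ _ _ a(2) b(2)]) (use root Dp(4) E_simps(3) in auto)
  next
    case False
    then have "p (single (D, ?G) 1) = 0 \<or> p (single (E, ?H) 1) = 0"
      using signed_expand[OF sD] signed_expand[OF sE] by (auto simp: cut_support_def split: if_splits)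
    then have "comp_C 1 (p (single (D, ?G) 1)) (p (single (E, ?H) 1)) = 0"
      by (auto simp: comp_C_def bilinear_ext_zero)
    then show ?thesis unfolding cut if_not_P[OF False] using signed_zero by simp
  qed
  ultimately show ?thesis using signed_rescale[OF lin BX r(2)] by simp
qed

text \<open>A fully metric \<open>B\<close> is settled by \<open>p_support_binary\<close>. Otherwise
  some edge is non-metric; after a relabeling that names it \<open>{1..card e}\<close> the cut
  applies, and the relabeling is undone at the end.\<close>

lemma p_cut:
  assumes p: "is_p p"
  shows "B \<in> binary_diagrams \<Longrightarrow> X \<subseteq> set (edges B) \<Longrightarrow>
    signed (cut_support X B) (p (single (B, X) 1))"
proof (induction "num_leaves B" arbitrary: B X rule: less_induct)
  case less
  have Bd: "B \<in> diagrams" "all_vertices_binary B" using less.prems by (auto simp: binary_diagrams_def)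
  show ?case
  proof (cases "X = set (edges B)")
    case True
    then show ?thesis using p_fully_metric[OF p Bd(1)] p_support_binary[OF less.prems(1)] by simp
  next
    case False
    then obtain e where e: "e \<in> set (edges B)" "e \<notin> X" using less.prems(2) by blast
    obtain f where f: "f permutes {1..num_leaves B}" "f ` e = {1..card e}" using relabel_edge[OF Bd(1) e(1)] by blast
    have inj: "inj f" using f(1) by (rule permutes_inj)
    let ?B = "map_diagram f B" and ?X = "image f ` X"
    have B': "?B \<in> binary_diagrams" "?X \<subseteq> set (edges ?B)"
      using less.prems(2) Bd diagrams_map[OF f(1)] by (auto simp: binary_diagrams_def edges_map)
    have "finite e" "e \<noteq> {}"
      using e(1) Bd(1) edges_nonempty[of B e] edges_subset[of e B]
      by (auto simp: diagrams_iff proper_def intro: finite_subset)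
    then have card: "1 \<le> card e" by (simp add: Suc_le_eq card_gt_0_iff)
    have new: "{1..card e} \<in> set (edges ?B)" "{1..card e} \<notin> ?X"
      unfolding f(2)[symmetric] using e inj by (auto simp: edges_map inj_image_eq_iff)
    have s: "signed (cut_support ?X ?B) (p (single (?B, ?X) 1))"
      by (rule p_cut_first[OF p B' new card]) (use less.hyps in auto)
    have f': "inv f permutes {1..num_leaves ?B}" using permutes_inv[OF f(1)] by simp
    have "labeled ?B" using B' by (simp add: binary_diagrams_def labeled_diagrams)
    from p_equivariant[OF p this B'(2) f' s]
    have "signed (map_diagram (inv f) ` cut_support ?X ?B) (p (single (B, X) 1))"
      using map_diagram_inv[OF f(1)] permutes_inverses(2)[OF f(1)] by (simp add: image_image)
    moreover have "map_diagram (inv f) ` cut_support ?X ?B = cut_support X B"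
      using all_sign_map[OF inj Bd(2)] contract_map[OF inj] map_diagram_inv[OF f(1)]
      by (simp add: cut_support_def)
    ultimately show ?thesis by simp
  qed
qed

text \<open>Terms for different \<open>X\<close> are different basis vectors, because
  \<open>X\<close> is the metric set of the second factor.\<close>

lemma signed_Delta_Q_full:
  fixes B :: "nat diagram"
  shows "signed (\<Union>X\<in>Pow (set (edges B)). {((contract X B, set (edges B) - X), (B, X))})
    (Delta_Q (single (full B) 1))"
  unfolding Delta_Q_def full_def linear_ext_single case_prod_conv Delta_Q_gen_def Let_def
proof (rule signed_UN)
  fix X
  let ?es = "metric_edges B (set (edges B))"
  have "signed ({(contract X B, set (edges B) - X)} \<times> {(B, X)})
     (tensor (gen_Q (contract X B) (set (edges B) - X) (1, filter (\<lambda>e. e \<notin> X) ?es))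
       (gen_Q B X (1, filter (\<lambda>e. e \<in> X) ?es)) :: _ \<Rightarrow>\<^sub>0 'a)"
    by (intro signed_tensor signed_gen_Q) simp_all
  then show "signed {((contract X B, set (edges B) - X), (B, X))}
     (smul ((- 1) ^ card {(i, j). i < j \<and> j < length ?es \<and> ?es ! i \<in> X \<and> ?es ! j \<in> set (edges B) - X})
       (tensor (gen_Q (contract X B) (set (edges B) - X) (1, filter (\<lambda>e. e \<notin> X) ?es))
         (gen_Q B X (1, filter (\<lambda>e. e \<in> X) ?es))) :: _ \<Rightarrow>\<^sub>0 'a)"
    by (intro signed_smul) (simp_all add: minus_one_power_iff)
qed auto

definition diagonal_support :: "nat diagram \<Rightarrow> (nat diagram \<times> nat diagram) set" where
  "diagonal_support c = {(S, T). T \<in> expansions c \<and> S \<in> p_support T}"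

text \<open>Recovers the pair \<open>(B, X)\<close> from \<open>T\<close>. The disjointness of the
  supports belonging to different pairs rests on it.\<close>

lemma cut_support_eq:
  assumes "B \<in> diagrams" "all_vertices_binary B" "X \<subseteq> set (edges B)" "T \<in> cut_support X B"
  shows "T \<in> diagrams \<and> B = D_max T \<and> X = set (edges B) - set (edges T) \<and> B \<in> binary_expansions T"
proof -
  have T: "T = contract X B" "all_sign True X B" using assms(4) by (auto simp: cut_support_def split: if_splits)
  then have X: "X = set (edges B) - set (edges T)" using set_edges_contract[of X B] assms(3) by blast
  moreover have B: "B \<in> binary_expansions T" using binary_expansionsI assms(1,2) T(1) by metis
  ultimately have "extremal True T B" using T(2) by (simp add: extremal_iff)
  then have "B = D_max T" using D_max_eq by metis
  moreover have "T \<in> diagrams" using contract_in_diagrams[OF assms(1)] T(1) by simp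
  ultimately show ?thesis using X B by blast
qed

text \<open>The first factors \<open>S\<close> recur among the terms, but the second factor
  \<open>T\<close> identifies the term of the diagonal of \<open>Q\<close> from which it comes, so
  the supports stay disjoint after applying \<open>p\<close> to both factors.\<close>

lemma signed_Delta_C:
  fixes p :: "'r::comm_ring_1 Q \<Rightarrow> 'r C"
  assumes p: "is_p p" and q: "is_q q" and c: "c \<in> corollas"
  shows "signed (diagonal_support c) (Delta_C p q (single c 1))"
proof -
  define W where "W = (\<lambda>B :: nat diagram. \<Union>X\<in>Pow (set (edges B)). {((contract X B, set (edges B) - X), (B, X))})"
  have DQ: "signed (\<Union>b\<in>full ` binary_expansions c. W (fst b)) (Delta_Q (q (single c 1)))"
  proof (rule signed_linear[OF _ subset_UNIV q_corolla[OF q c]])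
    show "linear_on_span UNIV Delta_Q" unfolding Delta_Q_def by (rule linear_ext_linear)
    show "signed (W (fst b)) (Delta_Q (single b 1 :: 'r Q))" if "b \<in> full ` binary_expansions c" for b
      using that signed_Delta_Q_full unfolding W_def by (auto simp: full_def)
    show "W (fst a) \<inter> W (fst b) = {}"
      if "a \<in> full ` binary_expansions c" "b \<in> full ` binary_expansions c" "a \<noteq> b" for a b
      using that by (auto simp: W_def full_def)
  qed
  let ?\<Phi> = "\<lambda>d. p_support (fst (fst d)) \<times> cut_support (snd (snd d)) (fst (snd d))"
  let ?A = "\<Union>b\<in>full ` binary_expansions c. W (fst b)"
  have A: "\<exists>B X. B \<in> binary_expansions c \<and> X \<subseteq> set (edges B) \<and> d = ((contract X B, set (edges B) - X), (B, X))"
    if "d \<in> ?A" for d using that by (auto simp: W_def full_def)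
  have "signed (\<Union>d\<in>?A. ?\<Phi> d) (tensor_map p p (Delta_Q (q (single c 1))))"
  proof (rule signed_linear[OF _ subset_UNIV DQ])
    show "linear_on_span UNIV (tensor_map p p)" unfolding tensor_map_def by (rule linear_ext_linear)
  next
    fix d assume "d \<in> ?A"
    then obtain B X where B: "B \<in> binary_expansions c" "X \<subseteq> set (edges B)"
      and d: "d = ((contract X B, set (edges B) - X), (B, X))" using A by blast
    have B2: "B \<in> binary_diagrams" "B \<in> diagrams" using B(1) by (auto simp: binary_expansions_def binary_diagrams_def)
    \<comment> \<open>The edges left after contracting \<open>X\<close> are exactly the metric ones,
      so the first factor is fully metric.\<close>
    have "signed (p_support (contract X B)) (p (single (contract X B, set (edges B) - X) 1))"
      using p_fully_metric[OF p contract_in_diagrams[OF B2(2)], of X] by (simp add: set_edges_contract)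
    with p_cut[OF p B2(1) B(2)] show "signed (?\<Phi> d) (tensor_map p p (single d 1))"
      by (simp add: tensor_map_def d signed_tensor)
  next
    fix d d' assume "d \<in> ?A" "d' \<in> ?A" "d \<noteq> d'"
    obtain B X where B: "B \<in> binary_expansions c" "X \<subseteq> set (edges B)"
      and d: "d = ((contract X B, set (edges B) - X), (B, X))" using A \<open>d \<in> ?A\<close> by blast
    obtain B' X' where B': "B' \<in> binary_expansions c" "X' \<subseteq> set (edges B')"
      and d': "d' = ((contract X' B', set (edges B') - X'), (B', X'))" using A \<open>d' \<in> ?A\<close> by blast
    have "cut_support X B \<inter> cut_support X' B' = {}"
    proof (rule ccontr)
      assume "\<not> ?thesis"
      then obtain T where T: "T \<in> cut_support X B" "T \<in> cut_support X' B'" by blast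
      have "B = D_max T \<and> X = set (edges B) - set (edges T)"
        using cut_support_eq[OF _ _ B(2) T(1)] binary_expansionsD[OF B(1)] by blast
      moreover have "B' = D_max T \<and> X' = set (edges B') - set (edges T)"
        using cut_support_eq[OF _ _ B'(2) T(2)] binary_expansionsD[OF B'(1)] by blast
      ultimately show False using \<open>d \<noteq> d'\<close> d d' by simp
    qed
    then show "?\<Phi> d \<inter> ?\<Phi> d' = {}" by (auto simp: d d')
  qed
  also have "(\<Union>d\<in>?A. ?\<Phi> d) = diagonal_support c"
  proof (intro equalityI subsetI)
    fix st assume "st \<in> (\<Union>d\<in>?A. ?\<Phi> d)"
    then obtain d where d: "d \<in> ?A" "st \<in> ?\<Phi> d" by blast
    then obtain B X where B: "B \<in> binary_expansions c" "X \<subseteq> set (edges B)"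
      "d = ((contract X B, set (edges B) - X), (B, X))" using A by blast
    obtain S T where st: "st = (S, T)" by (cases st)
    have S: "S \<in> p_support (contract X B)" and T: "T \<in> cut_support X B" using d(2) B(3) st by auto
    have TX: "T = contract X B" using T by (auto simp: cut_support_def split: if_splits)
    have Bc: "B \<in> diagrams" "well_colored B" "leaf_order B = leaf_order c" "root_color B = root_color c"
      using binary_expansionsD[OF B(1)] by auto
    then have "T \<in> expansions c"
      using contract_in_diagrams[OF Bc(1)] leaf_order_contract[OF Bc(2)] by (simp add: expansions_corolla[OF c] TX)
    with S TX st show "st \<in> diagonal_support c" by (simp add: diagonal_support_def)
  next
    fix st assume "st \<in> diagonal_support c"
    then obtain S T where st: "st = (S, T)" "T \<in> expansions c" "S \<in> p_support T" by (auto simp: diagonal_support_def)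
    have T: "T \<in> diagrams" "leaf_order T = leaf_order c" "root_color T = root_color c"
      using st(2) by (auto simp: expansions_corolla[OF c])
    let ?B = "D_max T"
    let ?X = "set (edges ?B) - set (edges T)"
    have e: "?B \<in> binary_expansions T" "all_sign True ?X ?B" using D_max_extremal[OF T(1)] by (auto simp: extremal_iff)
    have cT: "contract ?X ?B = T" using e(1) by (simp add: binary_expansions_iff)
    have "?B \<in> binary_expansions c"
      using binary_expansionsD[OF e(1)] T by (simp add: binary_expansions_def expansions_corolla[OF c] binary_diagrams_def)
    then have "((contract ?X ?B, set (edges ?B) - ?X), (?B, ?X)) \<in> ?A" by (auto simp: W_def full_def)
    moreover have "st \<in> ?\<Phi> ((contract ?X ?B, set (edges ?B) - ?X), (?B, ?X))"
      using st e(2) cT by (simp add: cut_support_def)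
    ultimately show "st \<in> (\<Union>d\<in>?A. ?\<Phi> d)" by blast
  qed
  finally show ?thesis by (simp add: Delta_C_def)
qed

text \<open>For an expansion \<open>T\<close> of \<open>c\<close> the degree and the number of edges
  add up to \<open>k\<close>. Hence the condition that the degree of \<open>S\<close> is the number
  of edges of \<open>T\<close> says that the two degrees add up to \<open>k\<close>.\<close>

lemma diagonal_support_eq:
  assumes c: "c \<in> corollas" and "coloring c = (xs, y)" "degree c = k"
  shows "diagonal_support c = {(S, T). S \<in> expansions c \<and> T \<in> expansions c \<and>
     coloring S = (xs, y) \<and> coloring T = (xs, y) \<and>
     degree S + degree T = k \<and> diagram_le (D_max S) (D_min T)}"
proof -
  have cc: "c \<in> diagrams" "edges c = []" using c by (auto simp: corollas_def)
  have col: "coloring D = (xs, y)" and deg: "degree D + length (edges D) = k" if "D \<in> expansions c" for D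
  proof -
    have D: "D \<in> diagrams" "leaf_order D = leaf_order c" "root_color D = root_color c"
      using that by (auto simp: expansions_corolla[OF c])
    show "coloring D = (xs, y)" using coloring_leaf_order_eq[of c D] D cc(1) assms(2)
      by (auto simp: diagrams_iff proper_def)
    have "num_leaves D = num_leaves c" using D(2) by (metis length_leaf_order)
    moreover have "length (edges D) + 2 \<le> num_leaves D"
      using D(1) by (intro edges_bound) (auto simp: diagrams_iff proper_def)
    ultimately show "degree D + length (edges D) = k" using assms(3) cc(2) by (simp add: degree_def)
  qed
  show ?thesis
  proof (intro equalityI subsetI)
    fix st assume "st \<in> diagonal_support c"
    then obtain S T where st: "st = (S, T)" "T \<in> expansions c" "S \<in> p_support T" by (auto simp: diagonal_support_def)
    then have S: "S \<in> expansions c" by (simp add: expansions_corolla[OF c] p_support_def)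
    with st col deg[OF st(2)] show "st \<in> {(S, T). S \<in> expansions c \<and> T \<in> expansions c \<and>
       coloring S = (xs, y) \<and> coloring T = (xs, y) \<and>
       degree S + degree T = k \<and> diagram_le (D_max S) (D_min T)}"
      by (simp add: p_support_def)
  next
    fix st assume "st \<in> {(S, T). S \<in> expansions c \<and> T \<in> expansions c \<and>
       coloring S = (xs, y) \<and> coloring T = (xs, y) \<and>
       degree S + degree T = k \<and> diagram_le (D_max S) (D_min T)}"
    then obtain S T where st: "st = (S, T)" "S \<in> expansions c" "T \<in> expansions c" "degree S + degree T = k"
      "diagram_le (D_max S) (D_min T)" by blast
    then have "degree S = length (edges T)" using deg[OF st(3)] by simp
    with st show "st \<in> diagonal_support c"
      by (simp add: diagonal_support_def p_support_def expansions_corolla[OF c])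
  qed
qed

text \<open>\<open>\<epsilon>\<close> compares the coefficient in \<open>x\<close> with the one in
  \<open>g S T\<close>: both are units \<open>1\<close> or \<open>- 1\<close>, so if they differ,
  one is the negative of the other.\<close>

lemma signed_basis_expansion:
  fixes x :: "('b \<times> 'c) \<Rightarrow>\<^sub>0 'r::comm_ring_1"
  assumes x: "signed A x" and g: "\<And>S T. (S, T) \<in> A \<Longrightarrow> signed {(S, T)} (g S T)"
  shows "\<exists>\<epsilon>. (\<forall>S T. \<epsilon> S T \<in> {1, - 1 :: int}) \<and> x = (\<Sum>(S, T)\<in>A. smul (of_int (\<epsilon> S T)) (g S T))"
proof -
  define \<epsilon> :: "'b \<Rightarrow> 'c \<Rightarrow> int" where
    "\<epsilon> = (\<lambda>S T. if lookup x (S, T) = lookup (g S T) (S, T) then 1 else - 1)"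
  have "single (S, T) (lookup x (S, T)) = smul (of_int (\<epsilon> S T)) (g S T)"
    if ST: "(S, T) \<in> A" for S T
  proof -
    obtain r where r: "g S T = single (S, T) r" "r = 1 \<or> r = - 1"
      using g[OF ST] by (rule signed_singletonE)
    have "lookup x (S, T) = 1 \<or> lookup x (S, T) = - 1"
      using x ST by (simp add: signed_def)
    with r have "lookup x (S, T) = of_int (\<epsilon> S T) * r"
      by (auto simp: \<epsilon>_def lookup_single)
    then show ?thesis by (simp add: r(1) smul_single)
  qed
  then have "x = (\<Sum>(S, T)\<in>A. smul (of_int (\<epsilon> S T)) (g S T))"
    by (subst signed_expand[OF x]) (rule sum.cong, auto)
  then show ?thesis by (intro exI[of _ \<epsilon>]) (auto simp: \<epsilon>_def)
qed

text \<open>The orientations are given in advance and arbitrary. Each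
  \<open>gen_C S (\<omega> S)\<close> is a basis vector up to sign, so any choice of orientations is
  absorbed by \<open>\<epsilon>\<close>.\<close>

theorem proposition5p3:
  fixes p :: "'r::comm_ring_1 Q \<Rightarrow> 'r C" and q :: "'r C \<Rightarrow> 'r Q"
    and c :: "nat diagram" and xs :: "color list" and y :: color and k :: nat
    and \<omega> :: "nat diagram \<Rightarrow> orientation"
  assumes "is_p p" and "is_q q"
    and "c \<in> corollas" and "coloring c = (xs, y)" and "degree c = k"
    and "\<And>D. D \<in> diagrams \<Longrightarrow> orientation_on (set (edges D)) (\<omega> D)"
  shows "\<exists>\<epsilon> :: nat diagram \<Rightarrow> nat diagram \<Rightarrow> int.
     (\<forall>S T. \<epsilon> S T \<in> {1, - 1}) \<and>
     Delta_C p q (gen_C c (1, [])) =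
       (\<Sum>(S, T) | S \<in> expansions c \<and> T \<in> expansions c \<and>
             coloring S = (xs, y) \<and> coloring T = (xs, y) \<and>
             degree S + degree T = k \<and> diagram_le (D_max S) (D_min T).
          smul (of_int (\<epsilon> S T)) (tensor (gen_C S (\<omega> S)) (gen_C T (\<omega> T))))"
  unfolding diagonal_support_eq[OF assms(3-5), symmetric]
proof (rule signed_basis_expansion)
  have "gen_C c (1, []) = single c (1 :: 'r)" by (simp add: gen_C_def wedge_sign_def)
  then show "signed (diagonal_support c) (Delta_C p q (gen_C c (1, [])))"
    using signed_Delta_C[OF assms(1-3)] by simp
next
  fix S T assume "(S, T) \<in> diagonal_support c"
  then have "S \<in> diagrams" "T \<in> diagrams"
    unfolding diagonal_support_eq[OF assms(3-5)] by (auto simp: expansions_def)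
  then have "fst (\<omega> S) \<in> {1, - 1}" "fst (\<omega> T) \<in> {1, - 1}" using assms(6) unfolding orientation_on_def by blast+
  from signed_tensor[OF signed_gen_C[OF this(1)] signed_gen_C[OF this(2)]]
  show "signed {(S, T)} (tensor (gen_C S (\<omega> S)) (gen_C T (\<omega> T)) :: _ \<Rightarrow>\<^sub>0 'r)" by simp
qed

end
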